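(* For each $n\ge1$ let $\mathbf p^{(n)}=(p_{ni}:i\ge1)$ be a ranked probability distribution on the positive integers, i.e. $p_{n1}\ge p_{n2}\ge\dots\ge0$ and $\sum_{i\ge1}p_{ni}=1$, and let $\sigma_{\mathbf p^{(n)}}:=\sqrt{\sum_{i\ge1}p_{ni}^2}$. Let $\mathcal T^{(n)}_{\mathbf p}$ be the $\mathbf p^{(n)}$-tree. Conditioned on $\mathcal T^{(n)}_{\mathbf p}$, delete each edge $e$ at the random time $\widehat T_e=\sigma_{\mathbf p^{(n)}}^{-1}(1-U_e)$, where the $U_e$ are i.i.d. uniform on $(0,1)$, and let $\widehat Y^{(n)}(t)=(\widehat Y^{(n)}_i(t))_{i\ge1}$ be the sequence of $\mathbf p^{(n)}$-measures of the tree components of the fragmented forest at time $t$, arranged in decreasing order. Suppose that $\sigma_{\mathbf p^{(n)}}\to0$ as $n\to\infty$. Then the family of processes $\widehat Y^{(n)}(\cdot)$ is tight in $D(\mathbb R_+,\mathbb S^{\downarrow}_{\le1})$.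
   Context: $\mathbf p^{(n)}$-tree (birthday tree): let $Y_{n,0},Y_{n,1},\dots$ be i.i.d. with distribution $\mathbf p^{(n)}$. $\mathcal T^{(n)}_{\mathbf p}$ is the random tree with vertex set $\mathcal V^{(n)}:=\{i\ge1:p_{ni}>0\}$ and undirected edges $\{\{Y_{n,j-1},Y_{n,j}\}: Y_{n,j}\notin\{Y_{n,0},\dots,Y_{n,j-1}\},\ j\ge1\}$. The fragmented forest at time $t$ is obtained from $\mathcal T^{(n)}_{\mathbf p}$ by removing all edges with $\widehat T_e\le t$; the $\mathbf p^{(n)}$-measure of a component is the sum of $p_{ni}$ over its vertices $i$; the sequence is extended by zeros if there are finitely many components. $\mathbb R_+:=[0,\infty)$. $\mathbb S^{\downarrow}_{\le1}:=\{(x_i)_{i=1}^\infty: x_1\ge x_2\ge\dots\ge0,\ \sum_{i}x_i\le1\}$, with the product topology (as a subspace of $\mathbb R^\infty$). $D(\mathbb R_+,\mathbb S^{\downarrow}_{\le1})$ is the space of càdlàg functions $\mathbb R_+\to\mathbb S^{\downarrow}_{\le1}$ with the Skorohod $J_1$ topology. *)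

theory Defs
  imports "HOL-Probability.Probability"
begin

section \<open>The Skorohod \<open>J\<^sub>1\<close> topology\<close>

text \<open>
  A path on \<open>[0,\<infinity>)\<close> is an extensional function on \<open>{0..}\<close>, so that two paths are
  equal iff they agree on \<open>[0,\<infinity>)\<close>.
\<close>

definition cadlag :: "'a::metric_space set \<Rightarrow> (real \<Rightarrow> 'a) set" where
  "cadlag S = {x \<in> {0..} \<rightarrow>\<^sub>E S.
     (\<forall>t\<ge>0. (x \<longlongrightarrow> x t) (at_right t)) \<and>
     (\<forall>t>0. \<exists>l\<in>S. (x \<longlongrightarrow> l) (at_left t))}"

definition time_changes :: "(real \<Rightarrow> real) set" where
  "time_changes = {\<theta>. strict_mono_on {0..} \<theta> \<and> \<theta> ` {0..} = {0..}}"

definition J1_nbhd :: "'a::metric_space set \<Rightarrow> (real \<Rightarrow> 'a) \<Rightarrow> real \<Rightarrow> real \<Rightarrow> (real \<Rightarrow> 'a) set" where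
  "J1_nbhd S x T \<epsilon> = {y \<in> cadlag S. \<exists>\<theta>\<in>time_changes. \<forall>t\<in>{0..T}.
     \<bar>\<theta> t - t\<bar> < \<epsilon> \<and> dist (y t) (x (\<theta> t)) < \<epsilon>}"

text \<open>
  The topology on the right-continuous with left limits (cadlag) paths with values in \<open>S\<close> for which the sets
  \<open>J1_nbhd S x T \<epsilon>\<close> with \<open>T, \<epsilon> > 0\<close> form a base of (not necessarily open) neighbourhoods
  of \<open>x\<close>; see \<open>J1_nbhd_is_nbhd\<close> below. The resulting convergence of sequences
  (\<open>limitin_skorohod_J1\<close> below) is the usual characterisation of \<open>J\<^sub>1\<close>-convergence on the
  half line, Ethier and Kurtz, Markov Processes, Proposition 3.5.3 (c), which determines the
  \<open>J\<^sub>1\<close> topology because the latter is metrizable.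
\<close>

definition skorohod_J1 :: "'a::metric_space set \<Rightarrow> (real \<Rightarrow> 'a) topology" where
  "skorohod_J1 S = topology (\<lambda>G. G \<subseteq> cadlag S \<and>
     (\<forall>x\<in>G. \<exists>T>0. \<exists>\<epsilon>>0. J1_nbhd S x T \<epsilon> \<subseteq> G))"

lemma J1_nbhdI:
  assumes "y \<in> cadlag S" "\<theta> \<in> time_changes"
    "\<And>t. t \<in> {0..T} \<Longrightarrow> \<bar>\<theta> t - t\<bar> < \<epsilon> \<and> dist (y t) (x (\<theta> t)) < \<epsilon>"
  shows "y \<in> J1_nbhd S x T \<epsilon>"
  unfolding J1_nbhd_def using assms by (intro CollectI conjI bexI[of _ \<theta>] ballI) auto

lemma J1_nbhd_mono:
  assumes "T \<le> T'" "\<epsilon>' \<le> \<epsilon>"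
  shows "J1_nbhd S x T' \<epsilon>' \<subseteq> J1_nbhd S x T \<epsilon>"
proof
  fix y assume "y \<in> J1_nbhd S x T' \<epsilon>'"
  then obtain \<theta> where "y \<in> cadlag S" "\<theta> \<in> time_changes"
    and *: "\<And>t. t \<in> {0..T'} \<Longrightarrow> \<bar>\<theta> t - t\<bar> < \<epsilon>' \<and> dist (y t) (x (\<theta> t)) < \<epsilon>'"
    unfolding J1_nbhd_def by blast
  moreover have "\<bar>\<theta> t - t\<bar> < \<epsilon> \<and> dist (y t) (x (\<theta> t)) < \<epsilon>" if "t \<in> {0..T}" for t
    using *[of t] that assms by auto
  ultimately show "y \<in> J1_nbhd S x T \<epsilon>" by (intro J1_nbhdI)
qed

lemma J1_nbhd_self: "x \<in> cadlag S \<Longrightarrow> \<epsilon> > 0 \<Longrightarrow> x \<in> J1_nbhd S x T \<epsilon>"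
  unfolding J1_nbhd_def time_changes_def
  by (auto intro!: exI[of _ "\<lambda>t. t"] simp: strict_mono_on_def)

lemma J1_nbhd_trans:
  assumes "y \<in> J1_nbhd S x (T + 1) (\<epsilon> / 2)" "z \<in> J1_nbhd S y T (min (\<epsilon> / 2) 1)"
  shows "z \<in> J1_nbhd S x T \<epsilon>"
proof -
  obtain \<theta> where l: "\<theta> \<in> time_changes"
    "\<And>t. t \<in> {0..T + 1} \<Longrightarrow> \<bar>\<theta> t - t\<bar> < \<epsilon> / 2 \<and> dist (y t) (x (\<theta> t)) < \<epsilon> / 2"
    using assms(1) unfolding J1_nbhd_def by blast
  obtain \<mu> where m: "\<mu> \<in> time_changes"
    "\<And>t. t \<in> {0..T} \<Longrightarrow> \<bar>\<mu> t - t\<bar> < min (\<epsilon> / 2) 1 \<and> dist (z t) (y (\<mu> t)) < min (\<epsilon> / 2) 1"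
    using assms(2) unfolding J1_nbhd_def by blast
  have m0: "\<mu> t \<ge> 0" if "t \<ge> 0" for t
  proof -
    have "\<mu> t \<in> \<mu> ` {0..}" using that by simp
    also have "\<mu> ` {0..} = {0..}" using m(1) unfolding time_changes_def by blast
    finally show ?thesis by simp
  qed
  have tc: "(\<lambda>t. \<theta> (\<mu> t)) \<in> time_changes"
  proof -
    have "(\<lambda>t. \<theta> (\<mu> t)) ` {0..} = \<theta> ` (\<mu> ` {0..})" by (simp only: image_image)
    also have "\<mu> ` {0..} = {0..}" using m(1) unfolding time_changes_def by blast
    also have "\<theta> ` {0..} = {0..}" using l(1) unfolding time_changes_def by blast
    finally have surj: "(\<lambda>t. \<theta> (\<mu> t)) ` {0..} = {0..}" .
    have mono: "strict_mono_on {0..} \<theta>" "strict_mono_on {0..} \<mu>"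
      using l(1) m(1) unfolding time_changes_def by blast+
    have "\<theta> (\<mu> r) < \<theta> (\<mu> s)" if "0 \<le> r" "0 \<le> s" "r < s" for r s
      using strict_mono_onD[OF mono(2), of r s] strict_mono_onD[OF mono(1), of "\<mu> r" "\<mu> s"]
        m0[of r] m0[of s] that by simp
    then have "strict_mono_on {0..} (\<lambda>t. \<theta> (\<mu> t))"
      by (intro strict_mono_onI) simp
    with surj show ?thesis unfolding time_changes_def by blast
  qed
  have close: "\<bar>\<theta> (\<mu> t) - t\<bar> < \<epsilon> \<and> dist (z t) (x (\<theta> (\<mu> t))) < \<epsilon>" if t: "t \<in> {0..T}" for t
  proof -
    note a = m(2)[OF t]
    have "t \<ge> 0" "t \<le> T" using t by simp_all
    then have "\<mu> t \<in> {0..T + 1}" using a m0[of t] by (simp add: abs_less_iff)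
    note b = l(2)[OF this]
    show ?thesis
      using a[unfolded min_less_iff_conj] b dist_triangle[of "z t" "x (\<theta> (\<mu> t))" "y (\<mu> t)"] by linarith
  qed
  have "z \<in> cadlag S" using assms(2) unfolding J1_nbhd_def by simp
  then show ?thesis using tc close by (rule J1_nbhdI)
qed

lemma openin_skorohod_J1:
  "openin (skorohod_J1 S) G \<longleftrightarrow>
     G \<subseteq> cadlag S \<and> (\<forall>x\<in>G. \<exists>T>0. \<exists>\<epsilon>>0. J1_nbhd S x T \<epsilon> \<subseteq> G)"
proof -
  have "istopology (\<lambda>G. G \<subseteq> cadlag S \<and> (\<forall>x\<in>G. \<exists>T>0. \<exists>\<epsilon>>0. J1_nbhd S x T \<epsilon> \<subseteq> G))"
    (is "istopology ?L")
    unfolding istopology_def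
  proof (intro conjI allI impI)
    fix A B assume A: "?L A" and B: "?L B"
    show "A \<inter> B \<subseteq> cadlag S" using A by blast
    show "\<forall>x\<in>A \<inter> B. \<exists>T>0. \<exists>\<epsilon>>0. J1_nbhd S x T \<epsilon> \<subseteq> A \<inter> B"
    proof
      fix x assume "x \<in> A \<inter> B"
      then obtain T e T' e' where h: "T > 0" "e > 0" "J1_nbhd S x T e \<subseteq> A"
        "T' > 0" "e' > 0" "J1_nbhd S x T' e' \<subseteq> B"
        using A B by blast
      have sub: "J1_nbhd S x (max T T') (min e e') \<subseteq> A \<inter> B"
        using h(3,6) J1_nbhd_mono[of T "max T T'" "min e e'" e S x]
          J1_nbhd_mono[of T' "max T T'" "min e e'" e' S x] by auto
      then show "\<exists>T>0. \<exists>\<epsilon>>0. J1_nbhd S x T \<epsilon> \<subseteq> A \<inter> B"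
        using h by (intro exI[of _ "max T T'"] conjI exI[of _ "min e e'"] sub) auto
    qed
  next
    fix \<K> assume K: "\<forall>A\<in>\<K>. ?L A"
    show "\<Union>\<K> \<subseteq> cadlag S" using K by blast
    show "\<forall>x\<in>\<Union>\<K>. \<exists>T>0. \<exists>\<epsilon>>0. J1_nbhd S x T \<epsilon> \<subseteq> \<Union>\<K>"
    proof
      fix x assume "x \<in> \<Union>\<K>"
      then obtain A where "A \<in> \<K>" "x \<in> A" by blast
      then obtain T e where "T > 0" "e > 0" "J1_nbhd S x T e \<subseteq> A" using K by blast
      moreover have "A \<subseteq> \<Union>\<K>" using \<open>A \<in> \<K>\<close> by blast
      ultimately show "\<exists>T>0. \<exists>\<epsilon>>0. J1_nbhd S x T \<epsilon> \<subseteq> \<Union>\<K>"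
        by (meson order_trans)
    qed
  qed
  then show ?thesis unfolding skorohod_J1_def by simp
qed

lemma topspace_skorohod_J1 [simp]: "topspace (skorohod_J1 S) = cadlag S"
proof -
  have "openin (skorohod_J1 S) (cadlag S)"
    unfolding openin_skorohod_J1 J1_nbhd_def using zero_less_one by blast
  moreover have "topspace (skorohod_J1 S) \<subseteq> cadlag S"
    using openin_topspace[of "skorohod_J1 S"] unfolding openin_skorohod_J1 by (rule conjunct1)
  ultimately show ?thesis using openin_subset by (intro equalityI)
qed

lemma J1_nbhd_is_nbhd:
  assumes "x \<in> cadlag S" "T > 0" "\<epsilon> > 0"
  shows "\<exists>G. openin (skorohod_J1 S) G \<and> x \<in> G \<and> G \<subseteq> J1_nbhd S x T \<epsilon>"
proof -
  define N where "N = J1_nbhd S x T \<epsilon>"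
  define G where "G = {y \<in> cadlag S. \<exists>T'>0. \<exists>\<epsilon>'>0. J1_nbhd S y T' \<epsilon>' \<subseteq> N}"
  have "openin (skorohod_J1 S) G"
    unfolding openin_skorohod_J1
  proof (intro conjI ballI)
    show "G \<subseteq> cadlag S" unfolding G_def by blast
    fix y assume "y \<in> G"
    then obtain T' e' where h: "T' > 0" "e' > 0" "J1_nbhd S y T' e' \<subseteq> N"
      unfolding G_def by blast
    have sub: "J1_nbhd S y (T' + 1) (e' / 2) \<subseteq> G"
    proof
      fix z assume z: "z \<in> J1_nbhd S y (T' + 1) (e' / 2)"
      have "J1_nbhd S z T' (min (e' / 2) 1) \<subseteq> N"
        using J1_nbhd_trans[OF z] h(3) by blast
      moreover have "z \<in> cadlag S" using z unfolding J1_nbhd_def by simp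
      moreover have "0 < min (e' / 2) 1" using h(2) by simp
      ultimately show "z \<in> G" using h(1) unfolding G_def by blast
    qed
    then show "\<exists>T>0. \<exists>\<epsilon>>0. J1_nbhd S y T \<epsilon> \<subseteq> G"
      using h by (intro exI[of _ "T' + 1"] conjI exI[of _ "e' / 2"] sub) auto
  qed
  moreover have "x \<in> G" using assms unfolding G_def N_def by blast
  moreover have "G \<subseteq> N" unfolding G_def using J1_nbhd_self by blast
  ultimately show ?thesis unfolding N_def by blast
qed

lemma limitin_skorohod_J1:
  "limitin (skorohod_J1 S) X x F \<longleftrightarrow>
     x \<in> cadlag S \<and> (\<forall>T>0. \<forall>\<epsilon>>0. eventually (\<lambda>n. X n \<in> J1_nbhd S x T \<epsilon>) F)"
proof (intro iffI conjI allI impI)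
  assume L: "limitin (skorohod_J1 S) X x F"
  then show x: "x \<in> cadlag S" unfolding limitin_def by simp
  fix T \<epsilon> :: real assume "T > 0" "\<epsilon> > 0"
  then obtain G where G: "openin (skorohod_J1 S) G" "x \<in> G" "G \<subseteq> J1_nbhd S x T \<epsilon>"
    using J1_nbhd_is_nbhd[OF x] by blast
  then have "eventually (\<lambda>n. X n \<in> G) F" using L unfolding limitin_def by blast
  then show "eventually (\<lambda>n. X n \<in> J1_nbhd S x T \<epsilon>) F"
    by (rule eventually_mono) (use G in blast)
next
  assume R: "x \<in> cadlag S \<and> (\<forall>T>0. \<forall>\<epsilon>>0. eventually (\<lambda>n. X n \<in> J1_nbhd S x T \<epsilon>) F)"
  show "limitin (skorohod_J1 S) X x F"
    unfolding limitin_def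
  proof (intro conjI allI impI)
    show "x \<in> topspace (skorohod_J1 S)" using R by simp
    fix G assume "openin (skorohod_J1 S) G \<and> x \<in> G"
    then obtain T e where h: "T > 0" "e > 0" "J1_nbhd S x T e \<subseteq> G"
      unfolding openin_skorohod_J1 by blast
    then have "eventually (\<lambda>n. X n \<in> J1_nbhd S x T e) F" using R by blast
    then show "eventually (\<lambda>n. X n \<in> G) F" by (rule eventually_mono) (use h in blast)
  qed
qed


section \<open>Tightness\<close>

text \<open>
  The random elements \<open>Z n\<close>, \<open>n \<in> I\<close>, may live on different probability spaces. Since
  \<open>measure\<close> is \<open>0\<close> on non-measurable sets, the inequality (for \<open>\<epsilon> < 1\<close>) includes the
  measurability of the event.
\<close>

definition tight_family ::
  "'s topology \<Rightarrow> 'i set \<Rightarrow> ('i \<Rightarrow> 'a measure) \<Rightarrow> ('i \<Rightarrow> 'a \<Rightarrow> 's) \<Rightarrow> bool" where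
  "tight_family X I M Z \<longleftrightarrow>
     (\<forall>\<epsilon>>0. \<exists>K. compactin X K \<and>
        (\<forall>n\<in>I. measure (M n) {\<omega> \<in> space (M n). Z n \<omega> \<in> K} \<ge> 1 - \<epsilon>))"


section \<open>Ranked sequences\<close>

text \<open>
  Sequences are indexed from \<open>0\<close>: \<open>x i\<close> stands for the \<open>(i+1)\<close>-st entry. The metric on
  \<open>nat \<Rightarrow> real\<close> is the one of \<open>HOL-Analysis.Function_Metric\<close>, which induces the product
  topology.
\<close>

definition S_down_le1 :: "(nat \<Rightarrow> real) set" where
  "S_down_le1 = {x. decseq x \<and> (\<forall>i. 0 \<le> x i) \<and> summable x \<and> (\<Sum>i. x i) \<le> 1}"

text \<open>\<open>x\<close> lists the positive weights \<open>m c\<close>, \<open>c \<in> C\<close>, in decreasing order and with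
  multiplicities, followed by zeros if \<open>C\<close> is finite.\<close>

definition is_ranking :: "'c set \<Rightarrow> ('c \<Rightarrow> real) \<Rightarrow> (nat \<Rightarrow> real) \<Rightarrow> bool" where
  "is_ranking C m x \<longleftrightarrow> decseq x \<and> (\<forall>i. 0 \<le> x i) \<and>
     (\<exists>f. bij_betw f {i. 0 < x i} C \<and> (\<forall>i. 0 < x i \<longrightarrow> x i = m (f i)))"

definition ranking :: "'c set \<Rightarrow> ('c \<Rightarrow> real) \<Rightarrow> nat \<Rightarrow> real" where
  "ranking C m = (THE x. is_ranking C m x)"

lemma is_ranking_iff_card:
  assumes "is_ranking C m x" "0 < s" "finite {c \<in> C. s < m c}"
  shows "s < x i \<longleftrightarrow> i < card {c \<in> C. s < m c}"
proof -
  obtain f where f: "bij_betw f {i. 0 < x i} C" "\<And>i. 0 < x i \<Longrightarrow> x i = m (f i)"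
    and dec: "decseq x"
    using assms(1) unfolding is_ranking_def by blast
  define A where "A = {j. s < x j}"
  have "f ` A = {c \<in> C. s < m c}"
  proof
    show "f ` A \<subseteq> {c \<in> C. s < m c}"
      using f assms(2) unfolding A_def bij_betw_def by fastforce
    show "{c \<in> C. s < m c} \<subseteq> f ` A"
    proof
      fix c assume c: "c \<in> {c \<in> C. s < m c}"
      then obtain j where "0 < x j" "c = f j" using f(1) unfolding bij_betw_def by auto
      then show "c \<in> f ` A" using c f(2) unfolding A_def by auto
    qed
  qed
  moreover have inj: "inj_on f A"
    using f(1) assms(2) unfolding A_def bij_betw_def by (auto intro: inj_on_subset)
  ultimately have card: "card A = card {c \<in> C. s < m c}" and fin: "finite A"
    using assms(3) card_image[OF inj] finite_imageD[OF _ inj] by auto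
  have down: "k \<in> A" if "j \<in> A" "k \<le> j" for j k
    using that dec unfolding A_def decseq_def by force
  have "j \<in> A \<longleftrightarrow> j < card A" for j
  proof
    assume "j \<in> A"
    then have "{..j} \<subseteq> A" using down by auto
    then have "card {..j} \<le> card A" using fin card_mono by blast
    then show "j < card A" by simp
  next
    assume j: "j < card A"
    show "j \<in> A"
    proof (rule ccontr)
      assume "j \<notin> A"
      then have "A \<subseteq> {..<j}" using down by (meson lessThan_iff not_le subsetI)
      then have "card A \<le> card {..<j}" using card_mono by blast
      then show False using j by simp
    qed
  qed
  then show ?thesis using card unfolding A_def by simp
qed

lemma is_ranking_unique:
  assumes "is_ranking C m x" "is_ranking C m y" "\<And>s. 0 < s \<Longrightarrow> finite {c \<in> C. s < m c}"
  shows "x = y"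
proof
  fix i
  have eq: "s < x i \<longleftrightarrow> s < y i" if "0 < s" for s
    using is_ranking_iff_card[OF assms(1) that] is_ranking_iff_card[OF assms(2) that]
      assms(3)[OF that] by simp
  have n: "0 \<le> x i" "0 \<le> y i" using assms unfolding is_ranking_def by auto
  show "x i = y i"
  proof (rule ccontr)
    assume "x i \<noteq> y i"
    then consider "x i < y i" | "y i < x i" by linarith
    then show False
      using eq[of "(x i + y i) / 2"] n by cases (auto simp: field_simps)
  qed
qed

lemma is_ranking_exists:
  fixes m :: "'c \<Rightarrow> real"
  assumes pos: "\<And>c. c \<in> C \<Longrightarrow> 0 < m c"
    and fin: "\<And>s. 0 < s \<Longrightarrow> finite {c \<in> C. s < m c}"
  shows "\<exists>x. is_ranking C m x"
proof -
  have "C = (\<Union>k. {c \<in> C. inverse (real (Suc k)) < m c})"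
    using pos reals_Archimedean by blast
  moreover have "countable (\<Union>k. {c \<in> C. inverse (real (Suc k)) < m c})"
    by (intro countable_UN countableI_type countable_finite fin) auto
  ultimately have "countable C" by simp
  then obtain g :: "'c \<Rightarrow> nat" where g: "inj_on g C" unfolding countable_def by blast
  define b where "b c c' \<longleftrightarrow> m c' < m c \<or> (m c' = m c \<and> g c < g c')" for c c'
  have b_trans: "b a d" if "b a c" "b c d" for a c d using that unfolding b_def by auto
  have b_irr: "\<not> b c c" for c unfolding b_def by auto
  have b_tot: "b a c \<or> b c a" if "a \<in> C" "c \<in> C" "a \<noteq> c" for a c
  proof -
    have "g a \<noteq> g c" using that g by (meson inj_onD)
    then show ?thesis unfolding b_def by linarith
  qed
  define seg where "seg c = {a \<in> C. b a c}" for c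
  have seg_fin: "finite (seg c)" if "c \<in> C" for c
  proof (rule finite_subset)
    show "seg c \<subseteq> {a \<in> C. m c / 2 < m a}" using pos[OF that] unfolding seg_def b_def by auto
    show "finite {a \<in> C. m c / 2 < m a}" using pos[OF that] by (intro fin) auto
  qed
  define r where "r c = card (seg c)" for c
  have r_mono: "r a < r c" if "a \<in> C" "c \<in> C" "b a c" for a c
  proof -
    have "seg a \<subset> seg c" using that b_trans b_irr unfolding seg_def by blast
    then show ?thesis unfolding r_def using psubset_card_mono[OF seg_fin[OF that(2)]] by blast
  qed
  have r_inj: "inj_on r C"
    by (rule inj_onI) (metis b_tot r_mono less_irrefl_nat)
  have r_pred: "\<exists>a\<in>C. r a = k" if "c \<in> C" "r c = Suc k" for c k
  proof -
    have "finite (r ` seg c)" "r ` seg c \<noteq> {}"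
      using seg_fin[OF that(1)] that(2) unfolding r_def by auto
    then obtain a where a: "a \<in> seg c" "\<And>d. d \<in> seg c \<Longrightarrow> r d \<le> r a"
    proof -
      have "Max (r ` seg c) \<in> r ` seg c" using \<open>finite (r ` seg c)\<close> \<open>r ` seg c \<noteq> {}\<close> by (rule Max_in)
      then obtain a where a: "a \<in> seg c" "Max (r ` seg c) = r a" by blast
      have "r d \<le> r a" if "d \<in> seg c" for d
        using Max_ge[OF \<open>finite (r ` seg c)\<close>, of "r d"] that a(2) by simp
      with a(1) show thesis by (rule that)
    qed
    have aC: "a \<in> C" "b a c" using a(1) unfolding seg_def by auto
    have "seg c = insert a (seg a)"
    proof
      show "insert a (seg a) \<subseteq> seg c" using aC b_trans unfolding seg_def by auto
      show "seg c \<subseteq> insert a (seg a)"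
      proof
        fix d assume d: "d \<in> seg c"
        then have "d \<in> C" unfolding seg_def by simp
        then show "d \<in> insert a (seg a)"
          using b_tot[of a d] aC r_mono[of a d] a(2)[OF d] unfolding seg_def by force
      qed
    qed
    moreover have "a \<notin> seg a" using b_irr unfolding seg_def by simp
    ultimately have "r c = Suc (r a)" unfolding r_def using seg_fin[OF aC(1)] by simp
    then show ?thesis using that(2) aC(1) by auto
  qed
  have r_down: "k \<in> r ` C" if "Suc k \<in> r ` C" for k
    using that r_pred by (metis image_iff)
  have r_down': "j \<in> r ` C" if "k \<in> r ` C" "j \<le> k" for j k
    using that(2,1) by (induction rule: inc_induct) (auto intro: r_down)
  define h where "h = inv_into C r"
  have h: "h i \<in> C" "r (h i) = i" if "i \<in> r ` C" for i
    using that unfolding h_def by (auto intro: inv_into_into f_inv_into_f)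
  define x where "x i = (if i \<in> r ` C then m (h i) else 0)" for i
  have xpos: "{i. 0 < x i} = r ` C" using pos h unfolding x_def by auto
  have "decseq x"
    unfolding decseq_def
  proof (intro allI impI)
    fix i j :: nat assume ij: "i \<le> j"
    show "x j \<le> x i"
    proof (cases "j \<in> r ` C")
      case True
      then have i: "i \<in> r ` C" using r_down' ij by blast
      have "\<not> b (h j) (h i)" using r_mono[of "h j" "h i"] h[OF True] h[OF i] ij by auto
      then show ?thesis using True i unfolding x_def b_def by auto
    next
      case False
      then show ?thesis using pos h(1) unfolding x_def by (auto intro: less_imp_le)
    qed
  qed
  moreover have "\<forall>i. 0 \<le> x i" using pos h(1) unfolding x_def by (auto intro: less_imp_le)
  moreover have "bij_betw h {i. 0 < x i} C"
    unfolding xpos h_def using r_inj by (intro bij_betw_inv_into) (simp add: bij_betw_def)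
  moreover have "\<forall>i. 0 < x i \<longrightarrow> x i = m (h i)" unfolding x_def by auto
  ultimately show ?thesis unfolding is_ranking_def by blast
qed

lemma is_ranking_ranking:
  fixes m :: "'c \<Rightarrow> real"
  assumes "\<And>c. c \<in> C \<Longrightarrow> 0 < m c" "\<And>s. 0 < s \<Longrightarrow> finite {c \<in> C. s < m c}"
  shows "is_ranking C m (ranking C m)"
proof -
  have "\<exists>!x. is_ranking C m x"
    using is_ranking_exists[OF assms] is_ranking_unique[OF _ _ assms(2)] by blast
  then show ?thesis unfolding ranking_def by (rule theI')
qed


section \<open>Birthday trees and their fragmentation\<close>

text \<open>Vertices are labelled by the positive integers, so the label \<open>0\<close> has no mass.\<close>

definition ranked_distribution :: "nat pmf \<Rightarrow> bool" where
  "ranked_distribution p \<longleftrightarrow> pmf p 0 = 0 \<and> (\<forall>i\<ge>1. pmf p (Suc i) \<le> pmf p i)"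

definition sigma_of :: "nat pmf \<Rightarrow> real" where
  "sigma_of p = sqrt (\<Sum>i. (pmf p (Suc i))\<^sup>2)"

definition birthday_edges :: "(nat \<Rightarrow> nat) \<Rightarrow> nat set set" where
  "birthday_edges y = {{y (j - 1), y j} | j. 1 \<le> j \<and> y j \<notin> y ` {..<j}}"

definition edge_rel :: "nat set set \<Rightarrow> (nat \<times> nat) set" where
  "edge_rel E = {(u, v). {u, v} \<in> E}"

definition forest_components :: "nat set \<Rightarrow> nat set set \<Rightarrow> nat set set" where
  "forest_components V E = V // {(u, v). u \<in> V \<and> v \<in> V \<and> (u, v) \<in> (edge_rel E)\<^sup>*}"

text \<open>For a ranked distribution, \<open>set_pmf p\<close> is the vertex set \<open>{i\<ge>1. p\<^sub>i > 0}\<close>. The function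
  \<open>\<tau>\<close> gives the deletion times of the edges.\<close>

definition fragmentation ::
  "nat pmf \<Rightarrow> nat set set \<Rightarrow> (nat set \<Rightarrow> real) \<Rightarrow> real \<Rightarrow> nat \<Rightarrow> real" where
  "fragmentation p E \<tau> = (\<lambda>t\<in>{0..}.
     ranking (forest_components (set_pmf p) {e \<in> E. t < \<tau> e}) (measure_pmf.prob p))"

lemma equiv_forest_components:
  "equiv V {(u, v). u \<in> V \<and> v \<in> V \<and> (u, v) \<in> (edge_rel E)\<^sup>*}"
proof -
  have "sym (edge_rel E)" unfolding edge_rel_def sym_def by (auto simp: insert_commute)
  then have "sym ((edge_rel E)\<^sup>*)" by (rule sym_rtrancl)
  then show ?thesis
    unfolding equiv_def refl_on_def sym_def trans_def by (auto intro: rtrancl_trans)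
qed

lemma is_ranking_fragmentation:
  assumes "0 \<le> t"
  shows "is_ranking (forest_components (set_pmf p) {e \<in> E. t < \<tau> e}) (measure_pmf.prob p)
    (fragmentation p E \<tau> t)"
proof -
  let ?C = "forest_components (set_pmf p) {e \<in> E. t < \<tau> e}"
  let ?R = "{(u, v). u \<in> set_pmf p \<and> v \<in> set_pmf p \<and> (u, v) \<in> (edge_rel {e \<in> E. t < \<tau> e})\<^sup>*}"
  have eq: "equiv (set_pmf p) ?R" by (rule equiv_forest_components)
  have "is_ranking ?C (measure_pmf.prob p) (ranking ?C (measure_pmf.prob p))"
  proof (rule is_ranking_ranking)
    fix c assume c: "c \<in> ?C"
    then obtain v where "v \<in> c" "v \<in> set_pmf p"
      using in_quotient_imp_non_empty[OF eq] in_quotient_imp_subset[OF eq]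
      unfolding forest_components_def by blast
    then show "0 < measure_pmf.prob p c" by (auto intro: measure_pmf_posI)
  next
    fix s :: real assume s: "0 < s"
    have "card A \<le> nat \<lceil>1 / s\<rceil>" if A: "finite A" "A \<subseteq> {c \<in> ?C. s < measure_pmf.prob p c}" for A
    proof -
      have dis: "disjoint_family_on (\<lambda>c. c) A"
        using quotient_disj[OF eq] A(2)
        unfolding forest_components_def disjoint_family_on_def by blast
      have "real (card A) * s = (\<Sum>c\<in>A. s)" by simp
      also have "\<dots> \<le> (\<Sum>c\<in>A. measure_pmf.prob p c)" using A(2) by (intro sum_mono) auto
      also have "\<dots> = measure_pmf.prob p (\<Union>c\<in>A. c)"
        using measure_pmf.finite_measure_finite_Union[OF A(1) _ dis, of p] by simp
      also have "\<dots> \<le> 1" by simp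
      finally have "real (card A) \<le> 1 / s" using s by (simp add: field_simps)
      then show ?thesis by linarith
    qed
    then show "finite {c \<in> ?C. s < measure_pmf.prob p c}"
      by (meson finite_if_finite_subsets_card_bdd)
  qed
  then show ?thesis using assms unfolding fragmentation_def by simp
qed

text \<open>
  Conditionally on the random edge set \<open>E\<close>, the variables \<open>U e\<close>, \<open>e \<in> E\<close>, are i.i.d. uniform
  on \<open>(0,1)\<close>. The variable \<open>U e\<close> is given for each potential edge \<open>e\<close>, but nothing is
  assumed about its law off the event \<open>e \<in> E\<close>.
\<close>

definition sigma_edges :: "'a measure \<Rightarrow> ('a \<Rightarrow> nat set set) \<Rightarrow> 'a measure" where
  "sigma_edges M E = sigma (space M) (range (\<lambda>e. {\<omega> \<in> space M. e \<in> E \<omega>}))"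

definition cond_iid_uniform ::
  "'a measure \<Rightarrow> ('a \<Rightarrow> nat set set) \<Rightarrow> (nat set \<Rightarrow> 'a \<Rightarrow> real) \<Rightarrow> bool" where
  "cond_iid_uniform M E U \<longleftrightarrow>
     (\<forall>e. card e = 2 \<longrightarrow> U e \<in> borel_measurable M) \<and>
     (\<forall>F B. finite F \<longrightarrow> (\<forall>e\<in>F. card e = 2 \<and> B e \<in> sets borel) \<longrightarrow>
        (AE \<omega> in M. F \<subseteq> E \<omega> \<longrightarrow>
           real_cond_exp M (sigma_edges M E) (indicator {\<omega> \<in> space M. \<forall>e\<in>F. U e \<omega> \<in> B e}) \<omega> =
           (\<Prod>e\<in>F. measure (uniform_measure lborel {0<..<1}) (B e))))"

end

(*
  The masses sorted in decreasing order form a compact space, so tightness follows once a path rarely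
  makes two moves larger than eta within a short time, and rarely moves by eta shortly after time 0.
  Fix a vertex r. A vertex is eroded during (a, b] if one of the edges separating it from r is deleted
  in (a, b]. Since the tree has no cycles, two vertices that are not eroded and lie in the same component
  at time a still do so at time b; hence every ranked mass moves by at most the mass of the eroded
  vertices. Two moves larger than eta in consecutive intervals require two different edges to be deleted.
  Given the tree, a given pair of edges is deleted in an interval of length delta with probability at
  most (sigma delta)^2, so summing over the pairs of edges bounds the probability of two such moves by
  (sigma delta)^2 E[L^2] / eta^2, where L is the distance from r to a vertex. There are O(1 / delta)
  intervals to consider, so it remains to see that sigma^2 E[L^2] is bounded. The line of ancestors of
  a_0 begins with a_1, ..., a_k with probability at most p(a_1) ... p(a_k), so the depth of a vertex is at
  least k with probability at most P(k samples from p are distinct), and this decays like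
  (1 - sigma / 2)^(k - 1 / sigma).
*)

theory Submission
  imports Defs
begin

section \<open>Compact sets of paths\<close>

text \<open>Pointwise cluster points of right-continuous paths need not be right-continuous, so
  compactness of the product of the state spaces is not enough. The cluster point is replaced by its
  right limits, and the modulus supplies the time changes: it leaves essentially one large move per
  short cell, and these moves can be aligned. The time that splits an interval between two moves is
  arbitrary; the sum over pairs of distinct edges bounds all splits at once, so finitely many blocks
  of time suffice. The bound p(a_1) ... p(a_k) comes from cutting the sample sequence at the first
  visits of the a_i: between cuts the samples only have to avoid a set of letters, which gives a
  geometric series, and the factors telescope. For the decay, about 1 / \<sigma> samples are held in
  reserve, and every earlier sample enlarges the set that these must avoid.\<close>

lemma time_changes_comp:
  assumes "\<theta> \<in> time_changes" "\<phi> \<in> time_changes"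
  shows "(\<lambda>t. \<theta> (\<phi> t)) \<in> time_changes"
proof -
  have s: "strict_mono_on {0..} \<theta>" "strict_mono_on {0..} \<phi>" "\<theta> ` {0..} = {0..}" "\<phi> ` {0..} = {0..}"
    using assms unfolding time_changes_def by auto
  have "\<phi> r \<ge> 0" if "r \<ge> 0" for r using s(4) that by (metis atLeast_iff imageI)
  then have "strict_mono_on {0..} (\<lambda>t. \<theta> (\<phi> t))"
    using s(1,2) by (auto simp: strict_mono_on_def)
  moreover have "(\<lambda>t. \<theta> (\<phi> t)) ` {0..} = {0..}"
    using s(3,4) by (metis image_image)
  ultimately show ?thesis unfolding time_changes_def by blast
qed

lemma time_changes_mono:
  assumes "\<theta> \<in> time_changes" "0 \<le> r" "r < s"
  shows "\<theta> r < \<theta> s"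
  using assms unfolding time_changes_def strict_mono_on_def by auto

text \<open>The piecewise linear map through (a, a), (c, d) and (b, b), written with
  \<open>min\<close> and \<open>max\<close> of the identity and two lines, so that monotonicity and
  continuity need no case distinction on t.\<close>

lemma time_change_cell:
  fixes a b c d :: real
  assumes a: "0 \<le> a" and c: "a < c" "c < b" and d: "a < d" "d < b"
  shows "\<exists>\<phi>\<in>time_changes. (\<forall>t. t \<le> a \<or> b \<le> t \<longrightarrow> \<phi> t = t) \<and> \<phi> c = d"
proof -
  define u v where "u = (d - a) / (c - a)" and "v = (b - d) / (b - c)"
  have uv: "0 < u" "0 < v" unfolding u_def v_def using c d by auto
  define L M where "L t = a + (t - a) * u" and "M t = b - (b - t) * v" for t
  have LM: "L c = d" "M c = d" unfolding L_def M_def u_def v_def using c by auto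
  have mono: "L s < L t" "M s < M t" if "s < t" for s t
    unfolding L_def M_def using that uv by (auto intro!: mult_strict_right_mono)
  \<comment> \<open>For d \<le> c the maximum of the two lines is a convex kink below the identity
    on [a, b], and \<open>min t\<close> restores the identity outside; for c < d the picture is
    reflected.\<close>
  define \<phi> where "\<phi> t = (if d \<le> c then min t (max (L t) (M t)) else max t (min (L t) (M t)))" for t
  have id: "\<phi> t = t" if t: "t \<le> a \<or> b \<le> t" for t
  proof (cases "d \<le> c")
    case True
    then have "u \<le> 1" "1 \<le> v" unfolding u_def v_def using c by auto
    then have "t \<le> a \<Longrightarrow> t - a \<le> (t - a) * u" "b \<le> t \<Longrightarrow> (b - t) * v \<le> b - t"
      using mult_left_mono_neg[of u 1 "t - a"] mult_left_mono_neg[of 1 v "b - t"] by auto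
    then have "t \<le> max (L t) (M t)" using t unfolding L_def M_def by auto
    then show ?thesis using True unfolding \<phi>_def by simp
  next
    case False
    then have "1 \<le> u" "v \<le> 1" unfolding u_def v_def using c by auto
    then have "t \<le> a \<Longrightarrow> (t - a) * u \<le> t - a" "b \<le> t \<Longrightarrow> b - t \<le> (b - t) * v"
      using mult_left_mono_neg[of 1 u "t - a"] mult_left_mono_neg[of v 1 "b - t"] by auto
    then have "min (L t) (M t) \<le> t" using t unfolding L_def M_def by auto
    then show ?thesis using False unfolding \<phi>_def by simp
  qed
  have \<phi>_mono: "\<phi> s < \<phi> t" if "s < t" for s t
    using mono[OF that] that unfolding \<phi>_def by auto
  have cont: "continuous_on X \<phi>" for X
    unfolding \<phi>_def L_def M_def by (cases "d \<le> c") (auto intro!: continuous_intros)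
  have "\<phi> ` {0..} = {0..}"
  proof
    show "\<phi> ` {0..} \<subseteq> {0..}"
      using id[of 0] \<phi>_mono[of 0] a by (force simp: le_less)
    show "{0..} \<subseteq> \<phi> ` {0..}"
    proof
      fix y :: real assume y: "y \<in> {0..}"
      then have "\<exists>t\<ge>0. t \<le> max y b \<and> \<phi> t = y"
        using id[of 0] id[of "max y b"] a by (intro IVT' cont) auto
      then show "y \<in> \<phi> ` {0..}" by auto
    qed
  qed
  then have "\<phi> \<in> time_changes" unfolding time_changes_def using \<phi>_mono by (simp add: strict_mono_on_def)
  moreover have "\<phi> c = d" unfolding \<phi>_def using LM by auto
  ultimately show ?thesis using id by blast
qed

text \<open>The cells are adjusted one at a time. The map for a new cell moves only points of that
  cell, where the map built so far is the identity, so the composition keeps all earlier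
  values.\<close>

lemma time_change_grid:
  fixes q c d :: "nat \<Rightarrow> real"
  assumes q0: "q 0 \<ge> 0" and c: "\<And>i. i < m \<Longrightarrow> q i < c i \<and> c i < q (Suc i)"
    and d: "\<And>i. i < m \<Longrightarrow> q i < d i \<and> d i < q (Suc i)"
  shows "\<exists>\<theta>\<in>time_changes. (\<forall>t\<ge>q m. \<theta> t = t) \<and> (\<forall>i<m.
     (\<forall>t\<in>{q i..<c i}. \<theta> t \<in> {q i..<d i}) \<and> (\<forall>t\<in>{c i..<q (Suc i)}. \<theta> t \<in> {d i..<q (Suc i)}))"
  using c d
proof (induction m)
  case 0
  have "(\<lambda>t. t) \<in> time_changes" unfolding time_changes_def by (auto simp: strict_mono_on_def)
  then show ?case by (intro bexI[of _ "\<lambda>t. t"]) auto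
next
  case (Suc m)
  obtain \<theta> where \<theta>: "\<theta> \<in> time_changes" "\<forall>t\<ge>q m. \<theta> t = t" "\<forall>i<m.
     (\<forall>t\<in>{q i..<c i}. \<theta> t \<in> {q i..<d i}) \<and> (\<forall>t\<in>{c i..<q (Suc i)}. \<theta> t \<in> {d i..<q (Suc i)})"
    using Suc by (metis less_SucI)
  have qmono: "q i \<le> q m" if "i \<le> m" for i
    using that
  proof (induction rule: inc_induct)
    case (step n)
    then show ?case using Suc.prems(1)[of n] by force
  qed simp
  have qm: "0 \<le> q m" using qmono[of 0] q0 by simp
  obtain \<phi> where \<phi>: "\<phi> \<in> time_changes" "\<And>t. t \<le> q m \<or> q (Suc m) \<le> t \<Longrightarrow> \<phi> t = t" "\<phi> (c m) = d m"
    using time_change_cell[of "q m" "c m" "q (Suc m)" "d m"] Suc.prems[of m] qm by auto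
  have ge: "\<phi> t \<ge> q m" if "t \<ge> q m" for t
    using time_changes_mono[OF \<phi>(1) qm, of t] \<phi>(2)[of "q m"] that by (cases "t = q m") auto
  have eq: "\<theta> (\<phi> t) = (if t < q m then \<theta> t else \<phi> t)" for t
    using \<theta>(2) \<phi>(2)[of t] ge[of t] by auto
  have m0: "0 \<le> q m" "q m < c m" "c m < q (Suc m)" "0 \<le> c m" using Suc.prems(1)[of m] qm by auto
  have last: "(\<forall>t\<in>{q m..<c m}. \<theta> (\<phi> t) \<in> {q m..<d m}) \<and> (\<forall>t\<in>{c m..<q (Suc m)}. \<theta> (\<phi> t) \<in> {d m..<q (Suc m)})"
  proof (intro conjI ballI)
    fix t assume t: "t \<in> {q m..<c m}"
    then have "\<phi> t < d m" using time_changes_mono[OF \<phi>(1), of t "c m"] m0 \<phi>(3) by auto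
    then show "\<theta> (\<phi> t) \<in> {q m..<d m}" using t ge eq by auto
  next
    fix t assume t: "t \<in> {c m..<q (Suc m)}"
    then have "\<phi> t < q (Suc m)" using time_changes_mono[OF \<phi>(1), of t "q (Suc m)"] m0 \<phi>(2) by auto
    moreover have "d m \<le> \<phi> t" using time_changes_mono[OF \<phi>(1), of "c m" t] t m0 \<phi>(3) by (cases "t = c m") auto
    ultimately show "\<theta> (\<phi> t) \<in> {d m..<q (Suc m)}" using t m0 eq by auto
  qed
  have old: "(\<forall>t\<in>{q i..<c i}. \<theta> (\<phi> t) \<in> {q i..<d i}) \<and> (\<forall>t\<in>{c i..<q (Suc i)}. \<theta> (\<phi> t) \<in> {d i..<q (Suc i)})"
    if "i < m" for i
    using \<theta>(3) that eq qmono[of "Suc i"] Suc.prems(1)[of i] by auto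
  have all: "(\<forall>t\<in>{q i..<c i}. \<theta> (\<phi> t) \<in> {q i..<d i}) \<and>
      (\<forall>t\<in>{c i..<q (Suc i)}. \<theta> (\<phi> t) \<in> {d i..<q (Suc i)})" if "i < Suc m" for i
    using last old[of i] that by (cases "i = m") auto
  have id:  "\<theta> (\<phi> t) = t" if "t \<ge> q (Suc m)" for t
  proof -
    have "\<phi> t = t" "t \<ge> q m" using \<phi>(2)[of t] m0 that by linarith+
    then show ?thesis using \<theta>(2) by simp
  qed
  show ?case
    by (rule bexI[OF _ time_changes_comp[OF \<theta>(1) \<phi>(1)]]) (intro conjI allI impI all id)
qed

text \<open>This is a bound on Billingsley's modulus \<open>w''\<close> at scale \<open>\<delta> j\<close> on \<open>[0, j)\<close>, with tolerance
  \<open>1 / (j + 1)\<close>; the second part excludes large moves close to time \<open>0\<close>.\<close>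

definition jump_modulus :: "(nat \<Rightarrow> real) \<Rightarrow> (real \<Rightarrow> 'a::metric_space) \<Rightarrow> bool" where
  "jump_modulus \<delta> x \<longleftrightarrow> (\<forall>j::nat.
     (\<forall>r s t. 0 \<le> r \<and> r < s \<and> s < t \<and> t < real j \<and> t - r < \<delta> j \<longrightarrow>
        dist (x r) (x s) \<le> 1 / real (Suc j) \<or> dist (x s) (x t) \<le> 1 / real (Suc j)) \<and>
     (\<forall>s. 0 \<le> s \<and> s < \<delta> j \<longrightarrow> dist (x 0) (x s) \<le> 1 / real (Suc j)))"

lemma jump_modulusD:
  assumes "jump_modulus \<delta> x" "0 \<le> r" "r < s" "s < t" "t < real j" "t - r < \<delta> j"
  shows "dist (x r) (x s) \<le> 1 / real (Suc j) \<or> dist (x s) (x t) \<le> 1 / real (Suc j)"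
  using assms unfolding jump_modulus_def by blast

lemma jump_modulus_startD:
  assumes "jump_modulus \<delta> x" "0 \<le> s" "s < \<delta> j"
  shows "dist (x 0) (x s) \<le> 1 / real (Suc j)"
  using assms unfolding jump_modulus_def by blast

section \<open>One-sided limits of functions with controlled modulus\<close>

lemma compact_cauchy_filter_tendsto:
  fixes z :: "'b \<Rightarrow> 'a::metric_space"
  assumes S: "compact S" and F: "F \<noteq> bot" "eventually (\<lambda>s. z s \<in> S) F"
    and C: "\<And>e. e > 0 \<Longrightarrow> \<exists>P. eventually P F \<and> (\<forall>s s'. P s \<longrightarrow> P s' \<longrightarrow> dist (z s) (z s') \<le> e)"
  shows "\<exists>l\<in>S. (z \<longlongrightarrow> l) F"
proof -
  have "filtermap z F \<noteq> bot" "eventually (\<lambda>s. s \<in> S) (filtermap z F)"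
    using F by (auto simp: filtermap_bot_iff eventually_filtermap)
  then obtain l where l: "l \<in> S" "inf (nhds l) (filtermap z F) \<noteq> bot"
    using S unfolding compact_filter by blast
  have "(z \<longlongrightarrow> l) F"
  proof (rule tendstoI)
    fix e :: real assume e: "e > 0"
    obtain P where P: "eventually P F" "\<And>s s'. P s \<Longrightarrow> P s' \<Longrightarrow> dist (z s) (z s') \<le> e / 2"
      using C[of "e / 2"] e by auto
    \<comment> \<open>\<open>l\<close> is a cluster point, so values near it occur inside the set on
      which \<open>z\<close> oscillates little; the whole set is then near \<open>l\<close>.\<close>
    have "\<exists>s. P s \<and> dist (z s) l < e / 2"
    proof (rule ccontr)
      assume "\<not> ?thesis"
      then have "eventually (\<lambda>y. \<not> dist y l < e / 2) (filtermap z F)"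
        unfolding eventually_filtermap using P(1) by (auto elim: eventually_mono)
      moreover have "eventually (\<lambda>y. dist y l < e / 2) (nhds l)"
        using e eventually_nhds_metric half_gt_zero by blast
      ultimately have "eventually (\<lambda>_. False) (inf (nhds l) (filtermap z F))"
        unfolding eventually_inf by blast
      then show False using l(2) by (simp add: eventually_False)
    qed
    then obtain s0 where "P s0" "dist (z s0) l < e / 2" by blast
    then have "dist (z s) l < e" if "P s" for s
      using P(2)[OF that, of s0] dist_triangle[of "z s" l "z s0"] by linarith
    then show "eventually (\<lambda>s. dist (z s) l < e) F" using P(1) by (auto elim: eventually_mono)
  qed
  with l show ?thesis by blast
qed

text \<open>If two points x < y of the interval have values further apart than the tolerance, the
  modulus forces the values left of x to be close to the one at x, and the values right of y to be
  close to the one at y. Otherwise the whole interval works for both claims.\<close>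

lemma jump_modulus_oscillation:
  assumes z: "jump_modulus \<delta> z" and ab: "0 \<le> a" "a < b" "b \<le> real j" "b - a \<le> \<delta> j"
  shows "\<exists>x>a. \<forall>s\<in>{a<..<x}. \<forall>t\<in>{a<..<x}. dist (z s) (z t) \<le> 2 / real (Suc j)"
    and "\<exists>y<b. \<forall>s\<in>{y<..<b}. \<forall>t\<in>{y<..<b}. dist (z s) (z t) \<le> 2 / real (Suc j)"
proof -
  let ?P = "\<lambda>I. \<forall>s\<in>I. \<forall>t\<in>I. dist (z s) (z t) \<le> 2 / real (Suc j)"
  have "(\<exists>x>a. ?P {a<..<x}) \<and> (\<exists>y<b. ?P {y<..<b})"
  proof (cases "\<exists>x y. a < x \<and> x < y \<and> y < b \<and> dist (z x) (z y) > 1 / real (Suc j)")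
    case True
    then obtain x y where xy: "a < x" "x < y" "y < b" "dist (z x) (z y) > 1 / real (Suc j)" by blast
    have x: "dist (z s) (z x) \<le> 1 / real (Suc j)" if "s \<in> {a<..<x}" for s
      using jump_modulusD[OF z, of s x y j] that xy ab by auto
    have y: "dist (z y) (z s) \<le> 1 / real (Suc j)" if "s \<in> {y<..<b}" for s
      using jump_modulusD[OF z, of x y s j] that xy ab by auto
    have "?P {a<..<x}"
    proof (intro ballI)
      fix s t assume "s \<in> {a<..<x}" "t \<in> {a<..<x}"
      from this[THEN x] show "dist (z s) (z t) \<le> 2 / real (Suc j)"
        using dist_triangle2[of "z s" "z t" "z x"] by simp
    qed
    moreover have "?P {y<..<b}"
    proof (intro ballI)
      fix s t assume "s \<in> {y<..<b}" "t \<in> {y<..<b}"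
      from this[THEN y] show "dist (z s) (z t) \<le> 2 / real (Suc j)"
        using dist_triangle3[of "z s" "z t" "z y"] by simp
    qed
    ultimately show ?thesis using xy by blast
  next
    case False
    have "?P {a<..<b}"
    proof (intro ballI)
      fix s t assume st: "s \<in> {a<..<b}" "t \<in> {a<..<b}"
      have "dist (z s) (z t) \<le> 1 / real (Suc j)" if "s \<in> {a<..<b}" "t \<in> {a<..<b}" "s < t" for s t
        using False that by (metis greaterThanLessThan_iff not_le)
      from this[of s t] this[of t s] have "dist (z s) (z t) \<le> 1 / real (Suc j)"
        using st by (cases s t rule: linorder_cases) (simp_all add: dist_commute)
      also have "\<dots> \<le> 2 / real (Suc j)" by (simp add: divide_right_mono)
      finally show "dist (z s) (z t) \<le> 2 / real (Suc j)" .
    qed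
    then show ?thesis using ab(2) by blast
  qed
  then show "\<exists>x>a. ?P {a<..<x}" "\<exists>y<b. ?P {y<..<b}" by blast+
qed

lemma ex_small_scale:
  fixes e T :: real
  assumes "0 < e"
  shows "\<exists>j. T \<le> real j \<and> 2 / real (Suc j) \<le> e"
proof -
  define j where "j = nat \<lceil>max (2 / e) T\<rceil>"
  have j: "2 / e \<le> real j" "T \<le> real j" unfolding j_def by linarith+
  then have "2 / real (Suc j) \<le> e" using assms by (simp add: field_simps)
  with j(2) show ?thesis by blast
qed

lemma jump_modulus_right_limit:
  fixes z :: "real \<Rightarrow> 'a::metric_space"
  assumes "compact S" "\<And>t. t \<ge> 0 \<Longrightarrow> z t \<in> S" "\<And>j. \<delta> j > 0" "jump_modulus \<delta> z" "t \<ge> 0"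
  shows "\<exists>l\<in>S. (z \<longlongrightarrow> l) (at_right t)"
proof (rule compact_cauchy_filter_tendsto[OF assms(1)])
  show "eventually (\<lambda>s. z s \<in> S) (at_right t)"
    using eventually_at_right_less[of t] by eventually_elim (use assms(2,5) in auto)
  fix e :: real assume "e > 0"
  then obtain j where j: "t + 1 \<le> real j" "2 / real (Suc j) \<le> e" using ex_small_scale by blast
  have "t < t + min (\<delta> j) 1" "t + min (\<delta> j) 1 \<le> real j" "t + min (\<delta> j) 1 - t \<le> \<delta> j"
    using assms(3)[of j] j(1) by auto
  from jump_modulus_oscillation(1)[OF assms(4,5) this] obtain x
    where x: "t < x" "\<forall>s\<in>{t<..<x}. \<forall>s'\<in>{t<..<x}. dist (z s) (z s') \<le> 2 / real (Suc j)" by blast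
  show "\<exists>P. eventually P (at_right t) \<and> (\<forall>s s'. P s \<longrightarrow> P s' \<longrightarrow> dist (z s) (z s') \<le> e)"
    using eventually_at_right_real[OF x(1)] x(2) j(2)
    by (intro exI[of _ "\<lambda>s. s \<in> {t<..<x}"]) (blast intro: order_trans)
qed simp

lemma jump_modulus_left_limit:
  fixes z :: "real \<Rightarrow> 'a::metric_space"
  assumes "compact S" "\<And>t. t \<ge> 0 \<Longrightarrow> z t \<in> S" "\<And>j. \<delta> j > 0" "jump_modulus \<delta> z" "t > 0"
  shows "\<exists>l\<in>S. (z \<longlongrightarrow> l) (at_left t)"
proof (rule compact_cauchy_filter_tendsto[OF assms(1)])
  show "eventually (\<lambda>s. z s \<in> S) (at_left t)"
    using eventually_at_left_real[OF assms(5)] by eventually_elim (use assms(2) in auto)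
  fix e :: real assume "e > 0"
  then obtain j where j: "t \<le> real j" "2 / real (Suc j) \<le> e" using ex_small_scale by blast
  have "0 \<le> t - min (\<delta> j) t" "t - min (\<delta> j) t < t" "t \<le> real j" "t - (t - min (\<delta> j) t) \<le> \<delta> j"
    using assms(3)[of j] assms(5) j(1) by auto
  from jump_modulus_oscillation(2)[OF assms(4) this] obtain y
    where y: "y < t" "\<forall>s\<in>{y<..<t}. \<forall>s'\<in>{y<..<t}. dist (z s) (z s') \<le> 2 / real (Suc j)" by blast
  show "\<exists>P. eventually P (at_left t) \<and> (\<forall>s s'. P s \<longrightarrow> P s' \<longrightarrow> dist (z s) (z s') \<le> e)"
    using eventually_at_left_real[OF y(1)] y(2) j(2)
    by (intro exI[of _ "\<lambda>s. s \<in> {y<..<t}"]) (blast intro: order_trans)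
qed simp

text \<open>With at most one large move the path is a step function up to a small error, and c is
  the first time at which it has left the ball around f a. The point b' keeps c away from b: a move
  that takes place only at b would leave no time before b at which to switch.\<close>

lemma switch_time:
  fixes f :: "real \<Rightarrow> 'a::metric_space"
  assumes ab: "a < b'" "b' < b" and e: "e > 0"
    and dich: "\<And>r s t. a \<le> r \<Longrightarrow> r < s \<Longrightarrow> s < t \<Longrightarrow> t \<le> b \<Longrightarrow> dist (f r) (f s) \<le> e \<or> dist (f s) (f t) \<le> e"
    and rc: "\<And>t. a \<le> t \<Longrightarrow> t < b \<Longrightarrow> (f \<longlongrightarrow> f t) (at_right t)"
    and b': "dist (f b') (f b) \<le> \<eta>"
  shows "\<exists>c. a < c \<and> c < b \<and> (\<forall>s\<in>{a..<c}. dist (f a) (f s) \<le> e) \<and> (\<forall>s\<in>{c..<b}. dist (f s) (f b) \<le> 2 * e + \<eta>)"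
proof -
  have \<eta>: "\<eta> \<ge> 0" using b' zero_le_dist order_trans by blast
  define A where "A = {s. a \<le> s \<and> s \<le> b' \<and> dist (f a) (f s) > e}"
  show ?thesis
  proof (cases "A = {}")
    case True
    have "dist (f s) (f b) \<le> 2 * e + \<eta>" if "s \<in> {b'..<b}" for s
    proof (cases "s = b'")
      case False
      then have "dist (f b') (f s) \<le> e \<or> dist (f s) (f b) \<le> e"
        using dich[of b' s b] that ab by auto
      then show ?thesis using b' e \<eta> dist_triangle3[of "f s" "f b" "f b'"] by auto
    qed (use b' e in auto)
    moreover have "dist (f a) (f s) \<le> e" if "s \<in> {a..<b'}" for s
    proof -
      have "s \<notin> A" using True by simp
      then show ?thesis using that unfolding A_def by auto
    qed
    ultimately show ?thesis using ab by blast
  next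
    case False
    have bdd: "bdd_below A" unfolding A_def by (auto intro: bdd_belowI[of _ a])
    define c where "c = Inf A"
    have low: "dist (f a) (f s) \<le> e" if "a \<le> s" "s < c" for s
    proof (rule ccontr)
      assume n: "\<not> ?thesis"
      obtain s' where "s' \<in> A" using False by blast
      then have "c \<le> s'" "s' \<le> b'" using cInf_lower[OF _ bdd] unfolding c_def A_def by auto
      then have "s \<in> A" using n that unfolding A_def by auto
      then show False using cInf_lower[OF _ bdd, of s] that unfolding c_def by auto
    qed
    have "eventually (\<lambda>s. dist (f s) (f a) < e) (at_right a)"
      using rc[of a] ab e by (intro tendstoD) auto
    then obtain a' where a': "a' > a" "\<And>s. a < s \<Longrightarrow> s < a' \<Longrightarrow> dist (f s) (f a) < e"
      unfolding eventually_at_right_field by blast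
    \<comment> \<open>Right-continuity at a keeps the path near its start for a while, which makes c
      strictly larger than a.\<close>
    have ca: "c \<ge> a'"
      unfolding c_def
    proof (rule cInf_greatest[OF False])
      fix s assume s: "s \<in> A"
      show "a' \<le> s"
      proof (rule ccontr)
        assume "\<not> a' \<le> s"
        moreover have "a \<le> s" "dist (f a) (f s) > e" using s unfolding A_def by auto
        ultimately show False using a'(2)[of s] e by (cases "s = a") (auto simp: dist_commute)
      qed
    qed
    have cb: "c \<le> b'"
    proof -
      obtain s where "s \<in> A" using False by blast
      then have "c \<le> s" "s \<le> b'" using cInf_lower[OF _ bdd] unfolding c_def A_def by auto
      then show ?thesis by simp
    qed
    \<comment> \<open>A time s' < s in \<open>A\<close> witnesses the large move; the values at s
      and at b are then both within e of f s'.\<close>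
    have gt: "dist (f s) (f b) \<le> 2 * e" if s: "c < s" "s \<le> b" for s
    proof -
      obtain s' where s': "s' \<in> A" "s' < s"
        using cInf_lessD[OF False, of s] s unfolding c_def by blast
      have s2: "a \<le> s'" "s' \<le> b'" "dist (f a) (f s') > e" using s' unfolding A_def by auto
      then have "a \<noteq> s'" using e by auto
      then have "a < s'" using s2 by simp
      then have "dist (f s') (f s) \<le> e" "dist (f s') (f b) \<le> e"
        using dich[of a s' s] dich[of a s' b] s s' s2 ab by auto
      then show ?thesis using dist_triangle3[of "f s" "f b" "f s'"] by linarith
    qed
    have ac: "a < c" "c < b" using ca cb a' ab by auto
    have "dist (f c) (f b) \<le> 2 * e"
    proof (rule tendsto_upperbound)
      show "((\<lambda>s. dist (f s) (f b)) \<longlongrightarrow> dist (f c) (f b)) (at_right c)"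
        using rc[of c] ac by (intro tendsto_intros) auto
      show "eventually (\<lambda>s. dist (f s) (f b) \<le> 2 * e) (at_right c)"
        using eventually_at_right_real[OF ac(2)] by eventually_elim (auto intro: gt)
    qed simp
    then have "dist (f s) (f b) \<le> 2 * e + \<eta>" if "s \<in> {c..<b}" for s
      using gt[of s] that \<eta> by (cases "s = c") auto
    moreover have "dist (f a) (f s) \<le> e" if "s \<in> {a..<c}" for s
      using low that by simp
    ultimately show ?thesis using ac by blast
  qed
qed

lemma grid_cell:
  fixes q :: "nat \<Rightarrow> real"
  assumes "q 0 \<le> t" "t < q m"
  shows "\<exists>i<m. q i \<le> t \<and> t < q (Suc i)"
  using assms(2)
proof (induction m)
  case 0 then show ?case using assms(1) by simp
next
  case (Suc m)
  then show ?case by (cases "t < q m") (auto simp: less_Suc_eq)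
qed

text \<open>The bounds in the modulus are closed conditions on finitely many coordinates: a strict
  violation by the limit would be inherited by the nearby paths.\<close>

lemma jump_modulus_pointwise_limit:
  fixes z :: "real \<Rightarrow> 'a::metric_space"
  assumes "G \<noteq> bot" "eventually (\<lambda>x. jump_modulus \<delta> x) G"
    and lim: "\<And>t. t \<ge> 0 \<Longrightarrow> ((\<lambda>x. x t) \<longlongrightarrow> z t) G"
  shows "jump_modulus \<delta> z"
  unfolding jump_modulus_def
proof (intro allI conjI impI)
  have ev: "eventually (\<lambda>x. c < dist (x r) (x s)) G" if "c < dist (z r) (z s)" "0 \<le> r" "0 \<le> s" for c r s
    using order_tendstoD(1)[OF tendsto_dist[OF lim[OF that(2)] lim[OF that(3)]] that(1)] .
  fix j :: nat and r s t :: real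
  assume a: "0 \<le> r \<and> r < s \<and> s < t \<and> t < real j \<and> t - r < \<delta> j"
  show "dist (z r) (z s) \<le> 1 / real (Suc j) \<or> dist (z s) (z t) \<le> 1 / real (Suc j)"
  proof (rule ccontr)
    assume "\<not> ?thesis"
    then have "eventually (\<lambda>x. 1 / real (Suc j) < dist (x r) (x s)) G"
      "eventually (\<lambda>x. 1 / real (Suc j) < dist (x s) (x t)) G"
      using a by (intro ev; linarith)+
    then have "eventually (\<lambda>x. False) G"
      using assms(2)
    proof eventually_elim
      case (elim x)
      then show ?case using jump_modulusD[OF elim(3), of r s t j] a by linarith
    qed
    then show False using assms(1) by (simp add: eventually_False)
  qed
next
  have ev: "eventually (\<lambda>x. c < dist (x r) (x s)) G" if "c < dist (z r) (z s)" "0 \<le> r" "0 \<le> s" for c r s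
    using order_tendstoD(1)[OF tendsto_dist[OF lim[OF that(2)] lim[OF that(3)]] that(1)] .
  fix j :: nat and s :: real
  assume a: "0 \<le> s \<and> s < \<delta> j"
  show "dist (z 0) (z s) \<le> 1 / real (Suc j)"
  proof (rule ccontr)
    assume "\<not> ?thesis"
    then have "eventually (\<lambda>x. 1 / real (Suc j) < dist (x 0) (x s)) G"
      using a by (intro ev; linarith)
    then have "eventually (\<lambda>x. False) G"
      using assms(2)
    proof eventually_elim
      case (elim x)
      then show ?case using jump_modulus_startD[OF elim(2), of s j] a by linarith
    qed
    then show False using assms(1) by (simp add: eventually_False)
  qed
qed

section \<open>Right-continuous modification of a pointwise limit\<close>

lemma filterlim_shift_right:
  fixes z :: "real \<Rightarrow> 'a::metric_space"
  assumes "(z \<longlongrightarrow> l) (at_right t)"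
  shows "((\<lambda>h. z (t + h)) \<longlongrightarrow> l) (at_right 0)"
  using assms filterlim_at_right_to_0[of z "nhds l" t] by (simp add: add.commute)

text \<open>\<open>z\<close> stands for a pointwise cluster point of paths, and \<open>w\<close> for
  the function of its right limits, which may differ from \<open>z\<close>.\<close>

locale right_regularization =
  fixes S :: "'a::metric_space set" and \<delta> :: "nat \<Rightarrow> real" and z w :: "real \<Rightarrow> 'a"
  assumes S: "compact S" and zS: "\<And>t. t \<ge> 0 \<Longrightarrow> z t \<in> S" and \<delta>: "\<And>j. \<delta> j > 0"
    and z: "jump_modulus \<delta> z"
    and w: "\<And>t. t \<ge> 0 \<Longrightarrow> w t \<in> S \<and> (z \<longlongrightarrow> w t) (at_right t)"
    and ext: "w \<in> extensional {0..}"
begin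

lemma w_near:
  assumes "\<And>s. a < s \<Longrightarrow> s < b \<Longrightarrow> dist (z s) l \<le> e" "a \<le> s" "s < b" "0 \<le> s"
  shows "dist (w s) l \<le> e"
proof (rule tendsto_upperbound)
  show "((\<lambda>r. dist (z r) l) \<longlongrightarrow> dist (w s) l) (at_right s)"
    using w[OF assms(4)] by (intro tendsto_intros) auto
  show "eventually (\<lambda>r. dist (z r) l \<le> e) (at_right s)"
    using eventually_at_right_real[OF assms(3)] by eventually_elim (use assms in auto)
qed simp

text \<open>The second clause of the modulus excludes a jump directly after 0. This matters because
  every time change fixes 0, so the values there must match without any shift of time.\<close>

lemma w0: "w 0 = z 0"
proof (rule tendsto_unique)
  show "(z \<longlongrightarrow> w 0) (at_right 0)" using w by simp
  show "(z \<longlongrightarrow> z 0) (at_right 0)"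
  proof (rule tendstoI)
    fix e :: real assume "e > 0"
    obtain j where j: "inverse (real (Suc j)) < e" using reals_Archimedean \<open>e > 0\<close> by blast
    show "eventually (\<lambda>s. dist (z s) (z 0) < e) (at_right 0)"
      using eventually_at_right_real[OF \<delta>[of j]]
    proof eventually_elim
      case (elim s)
      then show ?case using jump_modulus_startD[OF z, of s j] j by (simp add: dist_commute inverse_eq_divide)
    qed
  qed
qed simp

text \<open>In the first clause all three times are shifted to the right by a common h: their
  differences do not change, and the strict bound t < j leaves room for the shift.\<close>

lemma jump_modulus_w: "jump_modulus \<delta> w"
  unfolding jump_modulus_def
proof (intro allI conjI impI)
  have lim: "((\<lambda>h. dist (z (r + h)) (z (s + h))) \<longlongrightarrow> dist (w r) (w s)) (at_right 0)"
    if "0 \<le> r" "0 \<le> s" for r s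
    using w that by (intro tendsto_dist filterlim_shift_right) auto
  fix j :: nat and r s t :: real
  assume a: "0 \<le> r \<and> r < s \<and> s < t \<and> t < real j \<and> t - r < \<delta> j"
  show "dist (w r) (w s) \<le> 1 / real (Suc j) \<or> dist (w s) (w t) \<le> 1 / real (Suc j)"
  proof (rule ccontr)
    assume "\<not> ?thesis"
    then have "eventually (\<lambda>h. 1 / real (Suc j) < dist (z (r + h)) (z (s + h))) (at_right 0)"
      "eventually (\<lambda>h. 1 / real (Suc j) < dist (z (s + h)) (z (t + h))) (at_right 0)"
      using a by (intro order_tendstoD(1)[OF lim]; linarith)+
    moreover have "eventually (\<lambda>h. h \<in> {0<..<real j - t}) (at_right 0)"
      using a by (intro eventually_at_right_real) auto
    ultimately have "eventually (\<lambda>h. False) (at_right (0::real))"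
    proof eventually_elim
      case (elim h)
      then show ?case using jump_modulusD[OF z, of "r + h" "s + h" "t + h" j] a by force
    qed
    then show False by (simp add: eventually_False)
  qed
next
  fix j :: nat and s :: real
  assume a: "0 \<le> s \<and> s < \<delta> j"
  show "dist (w 0) (w s) \<le> 1 / real (Suc j)"
    unfolding w0
  proof (rule tendsto_upperbound)
    show "((\<lambda>h. dist (z 0) (z (s + h))) \<longlongrightarrow> dist (z 0) (w s)) (at_right 0)"
      using w a by (intro tendsto_intros filterlim_shift_right) auto
    show "eventually (\<lambda>h. dist (z 0) (z (s + h)) \<le> 1 / real (Suc j)) (at_right 0)"
    proof -
      have "0 < \<delta> j - s" using a by simp
      from eventually_at_right_real[OF this] show ?thesis
      proof eventually_elim
        case (elim h)
        then show ?case using jump_modulus_startD[OF z, of "s + h" j] a by force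
      qed
    qed
  qed simp
qed

lemma w_cadlag: "w \<in> cadlag S"
  unfolding cadlag_def
proof (intro CollectI conjI allI impI)
  show "w \<in> {0..} \<rightarrow>\<^sub>E S" using w ext by (auto simp: PiE_def)
  fix t :: real
  {
    assume t: "t \<ge> 0"
    show "(w \<longlongrightarrow> w t) (at_right t)"
    proof (rule tendstoI)
      fix e :: real assume e: "e > 0"
      have "eventually (\<lambda>s. dist (z s) (w t) < e / 2) (at_right t)"
        using w[OF t] e by (intro tendstoD) auto
      then obtain b where b: "b > t" "\<And>s. t < s \<Longrightarrow> s < b \<Longrightarrow> dist (z s) (w t) < e / 2"
        unfolding eventually_at_right_field by blast
      show "eventually (\<lambda>s. dist (w s) (w t) < e) (at_right t)"
        using eventually_at_right_real[OF b(1)]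
      proof eventually_elim
        case (elim s)
        have "dist (w s) (w t) \<le> e / 2"
          by (rule w_near[of t b]) (use b elim t in \<open>auto intro: less_imp_le\<close>)
        then show ?case using e by simp
      qed
    qed
  }
  assume t: "t > 0"
  obtain l where l: "l \<in> S" "(z \<longlongrightarrow> l) (at_left t)"
    using jump_modulus_left_limit[OF S zS \<delta> z t] by blast
  have "(w \<longlongrightarrow> l) (at_left t)"
  proof (rule tendstoI)
    fix e :: real assume e: "e > 0"
    have "eventually (\<lambda>s. dist (z s) l < e / 2) (at_left t)"
      using l e by (intro tendstoD) auto
    then obtain b where b: "b < t" "\<And>s. b < s \<Longrightarrow> s < t \<Longrightarrow> dist (z s) l < e / 2"
      unfolding eventually_at_left_field by blast
    have "max b 0 < t" using b t by simp
    from eventually_at_left_real[OF this]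
    show "eventually (\<lambda>s. dist (w s) l < e) (at_left t)"
    proof eventually_elim
      case (elim s)
      have "dist (w s) l \<le> e / 2"
        by (rule w_near[of "max b 0" t]) (use b elim t in \<open>auto intro: less_imp_le\<close>)
      then show ?case using e by simp
    qed
  qed
  with l show "\<exists>l\<in>S. (w \<longlongrightarrow> l) (at_left t)" by blast
qed

text \<open>Agreement up to a small error at finitely many times is enough: on each cell of a fine
  grid, both the path and \<open>w\<close> are close to a step function with one switch, and a time
  change that stays within the cells carries one switch to the other.\<close>

lemma J1_close:
  assumes "T > 0" "\<epsilon> > 0"
    and lim: "\<And>t. t \<ge> 0 \<Longrightarrow> ((\<lambda>x. x t) \<longlongrightarrow> z t) G"
    and ev: "eventually (\<lambda>x. x \<in> cadlag S \<and> jump_modulus \<delta> x) G"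
  shows "eventually (\<lambda>x. x \<in> J1_nbhd S w T \<epsilon>) G"
proof -
  \<comment> \<open>The j-th clause of the modulus is used: its tolerance \<open>\<kappa>\<close> is
    small against \<epsilon>, and its time range exceeds T with room for the last cell. At most 13
    \<open>\<kappa>\<close> are spent below.\<close>
  define j where "j = nat \<lceil>max (20 / \<epsilon>) (T + 3)\<rceil> + 1"
  have j: "real j > 20 / \<epsilon>" "real j > T + 3" unfolding j_def by linarith+
  define \<kappa> where "\<kappa> = 1 / real (Suc j)"
  have "20 / real (Suc j) < \<epsilon>" using j(1) \<open>\<epsilon> > 0\<close> by (simp add: field_simps)
  then have \<kappa>: "\<kappa> > 0" "20 * \<kappa> < \<epsilon>" unfolding \<kappa>_def by auto
  define \<mu> where "\<mu> = min (\<delta> j) (min \<epsilon> 1) / 3"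
  have \<mu>: "\<mu> > 0" "3 * \<mu> \<le> \<delta> j" "3 * \<mu> \<le> \<epsilon>" "3 * \<mu> \<le> 1"
    using \<delta>[of j] \<open>\<epsilon> > 0\<close> unfolding \<mu>_def by auto
  define m where "m = nat \<lceil>T / \<mu>\<rceil> + 1"
  have m: "T < real m * \<mu>" "real m * \<mu> \<le> T + 2 * \<mu>"
  proof -
    have "T / \<mu> < real m" "real m \<le> T / \<mu> + 2" unfolding m_def using \<open>T > 0\<close> \<mu>(1) by (simp_all, linarith+)
    then show "T < real m * \<mu>" "real m * \<mu> \<le> T + 2 * \<mu>" using \<mu>(1) by (auto simp: field_simps)
  qed
  have "\<exists>h>0. h \<le> \<mu> \<and> (\<forall>s. real k * \<mu> < s \<and> s < real k * \<mu> + h \<longrightarrow> dist (z s) (w (real k * \<mu>)) \<le> \<kappa>)" for k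
  proof -
    have "eventually (\<lambda>s. dist (z s) (w (real k * \<mu>)) < \<kappa>) (at_right (real k * \<mu>))"
      using w[of "real k * \<mu>"] \<mu> \<kappa> by (intro tendstoD) auto
    then obtain b where b: "b > real k * \<mu>" "\<And>s. real k * \<mu> < s \<Longrightarrow> s < b \<Longrightarrow> dist (z s) (w (real k * \<mu>)) < \<kappa>"
      unfolding eventually_at_right_field by blast
    then show ?thesis
      using \<mu>(1) by (intro exI[of _ "min \<mu> (b - real k * \<mu>)"]) (auto intro: less_imp_le)
  qed
  then obtain h where h: "\<And>k. h k > 0" "\<And>k. h k \<le> \<mu>"
    "\<And>k s. real k * \<mu> < s \<Longrightarrow> s < real k * \<mu> + h k \<Longrightarrow> dist (z s) (w (real k * \<mu>)) \<le> \<kappa>"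
    by metis
  have hw: "dist (w s) (w (real k * \<mu>)) \<le> \<kappa>" if "real k * \<mu> < s" "s < real k * \<mu> + h k" for k s
  proof (rule w_near[of "real k * \<mu>" "real k * \<mu> + h k"])
    have "0 \<le> real k * \<mu>" using \<mu>(1) by simp
    then show "0 \<le> s" using that by linarith
  qed (use that h(3) in auto)
  \<comment> \<open>The grid is moved slightly to the right of the multiples of
    \<open>\<mu>\<close>, to where \<open>z\<close> is already near its right limit; at a multiple
    itself \<open>z\<close> and \<open>w\<close> can differ. The time 0 is kept, as the two agree
    there. The points \<open>b\<close> play the role of b' in \<open>switch_time\<close>.\<close>
  define b where "b k = real k * \<mu> + h k / 3" for k
  define q where "q k = (if k = 0 then 0 else real k * \<mu> + 2 * h k / 3)" for k
  have b_in: "real k * \<mu> < b k" "b k < real k * \<mu> + h k" "b k \<ge> 0" for k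
    using h(1)[of k] \<mu>(1) unfolding b_def by auto
  have q_in: "real k * \<mu> < q k" "q k < real k * \<mu> + h k" "b k < q k" if "k > 0" for k
    using h(1)[of k] that unfolding q_def b_def by auto
  have q_bd: "real k * \<mu> \<le> q k" "q k < real k * \<mu> + \<mu>" for k
    using q_in[of k] h(1,2)[of k] \<mu>(1) by (cases "k = 0"; force simp: q_def)+
  have q0: "q k \<ge> 0" for k using q_bd(1)[of k] \<mu>(1) by (smt (verit) mult_nonneg_nonneg of_nat_0_le_iff)
  have cell: "q i < b (Suc i)" "b (Suc i) < q (Suc i)" "q (Suc i) - q i < 2 * \<mu>" for i
  proof -
    have "real (Suc i) * \<mu> = real i * \<mu> + \<mu>" by (simp add: algebra_simps)
    then show "q i < b (Suc i)" "b (Suc i) < q (Suc i)" "q (Suc i) - q i < 2 * \<mu>"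
      using q_bd(2)[of i] q_bd[of "Suc i"] q_bd(1)[of i] b_in(1)[of "Suc i"] q_in(3)[of "Suc i"]
      by linarith+
  qed
  have q_mono: "q i \<le> q k" if "i \<le> k" for i k
  proof (rule lift_Suc_mono_le[of q, OF _ that])
    show "q n \<le> q (Suc n)" for n using cell(1,2)[of n] by simp
  qed
  have q_lt: "q m < real j" using q_bd(2)[of m] m(2) \<mu>(4) j(2) by linarith
  have T_lt: "T < q m" using m(1) q_bd(1)[of m] by linarith
  have zw: "dist (z (q i)) (w (q i)) \<le> 2 * \<kappa>" for i
  proof (cases "i = 0")
    case True then show ?thesis using w0 \<kappa> by (simp add: q_def)
  next
    case False
    then show ?thesis using h(3)[of i "q i"] hw[of i "q i"] q_in[of i]
        dist_triangle2[of "z (q i)" "w (q i)" "w (real i * \<mu>)"] by linarith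
  qed
  have zb: "dist (z (b i)) (z (q i)) \<le> 2 * \<kappa>" "dist (w (b i)) (w (q i)) \<le> 2 * \<kappa>" if "i > 0" for i
    using h(3)[of i "b i"] h(3)[of i "q i"] hw[of i "b i"] hw[of i "q i"] q_in[OF that] b_in[of i]
      dist_triangle2[of "z (b i)" "z (q i)" "w (real i * \<mu>)"]
      dist_triangle2[of "w (b i)" "w (q i)" "w (real i * \<mu>)"] by linarith+
  have dich: "dist (x r) (x s) \<le> \<kappa> \<or> dist (x s) (x t) \<le> \<kappa>"
    if "jump_modulus \<delta> x" "i < m" "q i \<le> r" "r < s" "s < t" "t \<le> q (Suc i)" for x :: "real \<Rightarrow> 'a" and i r s t
  proof -
    have "q (Suc i) \<le> q m" using that by (intro q_mono) auto
    then show ?thesis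
      unfolding \<kappa>_def using that q0[of i] q_lt cell(3)[of i] \<mu>(1,2)
      by (intro jump_modulusD[OF that(1)]) linarith+
  qed
  have rc: "(x \<longlongrightarrow> x t) (at_right t)" if "x \<in> cadlag S" "q i \<le> t" for x :: "real \<Rightarrow> 'a" and t i
    using that q0[of i] unfolding cadlag_def by auto
  have "\<exists>d. q i < d \<and> d < q (Suc i) \<and> (\<forall>s\<in>{q i..<d}. dist (w (q i)) (w s) \<le> \<kappa>) \<and>
      (\<forall>s\<in>{d..<q (Suc i)}. dist (w s) (w (q (Suc i))) \<le> 2 * \<kappa> + 2 * \<kappa>)" if "i < m" for i
    by (rule switch_time[OF cell(1,2) \<kappa>(1) dich[OF jump_modulus_w that] rc[OF w_cadlag] zb(2)]) auto
  then obtain d where d: "\<And>i. i < m \<Longrightarrow> q i < d i \<and> d i < q (Suc i)"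
    "\<And>i s. i < m \<Longrightarrow> s \<in> {q i..<d i} \<Longrightarrow> dist (w (q i)) (w s) \<le> \<kappa>"
    "\<And>i s. i < m \<Longrightarrow> s \<in> {d i..<q (Suc i)} \<Longrightarrow> dist (w s) (w (q (Suc i))) \<le> 2 * \<kappa> + 2 * \<kappa>"
    by metis
  have evq: "eventually (\<lambda>x. \<forall>i\<le>m. dist (x (q i)) (z (q i)) < \<kappa>) G"
    "eventually (\<lambda>x. \<forall>i\<le>m. dist (x (b i)) (z (b i)) < \<kappa>) G"
  proof -
    have "eventually (\<lambda>x. \<forall>i\<in>{..m}. dist (x (f i)) (z (f i)) < \<kappa>) G" if "\<And>i. f i \<ge> 0" for f :: "nat \<Rightarrow> real"
      using that \<kappa>(1) lim by (intro eventually_ball_finite) (auto intro!: tendstoD)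
    from this[of q] this[of b] show "eventually (\<lambda>x. \<forall>i\<le>m. dist (x (q i)) (z (q i)) < \<kappa>) G"
      "eventually (\<lambda>x. \<forall>i\<le>m. dist (x (b i)) (z (b i)) < \<kappa>) G"
      using q0 b_in(3) unfolding Ball_def atMost_iff by blast+
  qed
  from ev evq show ?thesis
  proof eventually_elim
    case (elim x)
    then have x: "x \<in> cadlag S" "jump_modulus \<delta> x" by auto
    have xq: "dist (x (q i)) (w (q i)) \<le> 3 * \<kappa>" if "i \<le> m" for i
      using elim(2) that zw[of i] dist_triangle[of "x (q i)" "w (q i)" "z (q i)"] by force
    have xb: "dist (x (b (Suc i))) (x (q (Suc i))) \<le> 4 * \<kappa>" if "i < m" for i
    proof -
      have "dist (x (q (Suc i))) (z (q (Suc i))) < \<kappa>" "dist (x (b (Suc i))) (z (b (Suc i))) < \<kappa>"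
        using elim that by auto
      then show ?thesis using zb(1)[of "Suc i"]
          dist_triangle2[of "x (b (Suc i))" "x (q (Suc i))" "z (q (Suc i))"]
          dist_triangle[of "x (b (Suc i))" "z (q (Suc i))" "z (b (Suc i))"] by simp
    qed
    have "\<exists>c. q i < c \<and> c < q (Suc i) \<and> (\<forall>s\<in>{q i..<c}. dist (x (q i)) (x s) \<le> \<kappa>) \<and>
        (\<forall>s\<in>{c..<q (Suc i)}. dist (x s) (x (q (Suc i))) \<le> 2 * \<kappa> + 4 * \<kappa>)" if "i < m" for i
      by (rule switch_time[OF cell(1,2) \<kappa>(1) dich[OF x(2) that] rc[OF x(1)] xb[OF that]]) auto
    then obtain c where c: "\<And>i. i < m \<Longrightarrow> q i < c i \<and> c i < q (Suc i)"
      "\<And>i s. i < m \<Longrightarrow> s \<in> {q i..<c i} \<Longrightarrow> dist (x (q i)) (x s) \<le> \<kappa>"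
      "\<And>i s. i < m \<Longrightarrow> s \<in> {c i..<q (Suc i)} \<Longrightarrow> dist (x s) (x (q (Suc i))) \<le> 2 * \<kappa> + 4 * \<kappa>"
      by metis
    obtain \<theta> where \<theta>: "\<theta> \<in> time_changes"
      "\<And>i t. i < m \<Longrightarrow> t \<in> {q i..<c i} \<Longrightarrow> \<theta> t \<in> {q i..<d i}"
      "\<And>i t. i < m \<Longrightarrow> t \<in> {c i..<q (Suc i)} \<Longrightarrow> \<theta> t \<in> {d i..<q (Suc i)}"
      using time_change_grid[of q m c d] q0 c(1) d(1) by blast
    show ?case
    proof (rule J1_nbhdI[OF x(1) \<theta>(1)])
      fix t assume "t \<in> {0..T}"
      then obtain i where i: "i < m" "q i \<le> t" "t < q (Suc i)"
        using grid_cell[of q t m] T_lt by (auto simp: q_def)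
      show "\<bar>\<theta> t - t\<bar> < \<epsilon> \<and> dist (x t) (w (\<theta> t)) < \<epsilon>"
      proof (cases "t < c i")
        case True
        then have *: "\<theta> t \<in> {q i..<d i}" "dist (x (q i)) (x t) \<le> \<kappa>" using \<theta>(2)[of i t] c(2)[of i t] i by auto
        moreover have "dist (w (q i)) (w (\<theta> t)) \<le> \<kappa>" using d(2) i * by auto
        moreover have "dist (x t) (w (\<theta> t)) \<le> dist (x (q i)) (x t) + dist (x (q i)) (w (q i)) + dist (w (q i)) (w (\<theta> t))"
          using dist_triangle3[of "x t" "w (\<theta> t)" "x (q i)"] dist_triangle[of "x (q i)" "w (\<theta> t)" "w (q i)"] by linarith
        ultimately show ?thesis using xq[of i] i cell(3)[of i] d(1)[of i] \<mu> \<kappa> by auto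
      next
        case False
        then have *: "\<theta> t \<in> {d i..<q (Suc i)}" "dist (x t) (x (q (Suc i))) \<le> 6 * \<kappa>"
          using \<theta>(3)[of i t] c(3)[of i t] i by simp_all
        moreover have "dist (w (\<theta> t)) (w (q (Suc i))) \<le> 4 * \<kappa>" using d(3)[of i "\<theta> t"] i * by simp
        moreover have "dist (x t) (w (\<theta> t)) \<le> dist (x t) (x (q (Suc i))) +
            dist (x (q (Suc i))) (w (q (Suc i))) + dist (w (\<theta> t)) (w (q (Suc i)))"
          using dist_triangle[of "x t" "w (\<theta> t)" "x (q (Suc i))"]
            dist_triangle2[of "x (q (Suc i))" "w (\<theta> t)" "w (q (Suc i))"] by linarith
        ultimately show ?thesis using xq[of "Suc i"] i cell(3)[of i] d(1)[of i] \<mu> \<kappa> by auto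
      qed
    qed
  qed
qed

end

section \<open>Compactness in the J1 topology\<close>

lemma compact_PiE_UNIV:
  assumes "\<And>t. compact (A t)"
  shows "compact (Pi\<^sub>E UNIV A :: ('i \<Rightarrow> 'a::topological_space) set)"
  using assms by (simp add: compactin_PiE flip: compactin_euclidean_iff euclidean_product_topology)

text \<open>A cover without finite subcover yields a filter on the set that eventually avoids each
  member of the cover. It has a pointwise cluster point by Tychonoff's theorem; the right-continuous
  modification of that point lies in the set, hence in some member U of the cover, and
  \<open>J1_close\<close> forces a finer filter into U.\<close>

lemma compactin_jump_modulus:
  fixes S :: "'a::metric_space set"
  assumes S: "compact S" and \<delta>: "\<And>j. \<delta> j > 0"
  shows "compactin (skorohod_J1 S) {x \<in> cadlag S. jump_modulus \<delta> x}"
proof -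
  let ?K = "{x \<in> cadlag S. jump_modulus \<delta> x}"
  have "\<exists>\<F>. finite \<F> \<and> \<F> \<subseteq> \<U> \<and> ?K \<subseteq> \<Union>\<F>"
    if \<U>: "\<And>U. U \<in> \<U> \<Longrightarrow> openin (skorohod_J1 S) U" "?K \<subseteq> \<Union>\<U>" for \<U>
  proof (rule ccontr)
    assume no: "\<not> ?thesis"
    define F where "F = (INF \<F>\<in>{\<F>. finite \<F> \<and> \<F> \<subseteq> \<U>}. principal (?K - \<Union>\<F>))"
    have evF: "eventually P F \<longleftrightarrow> (\<exists>\<F>\<in>{\<F>. finite \<F> \<and> \<F> \<subseteq> \<U>}. eventually P (principal (?K - \<Union>\<F>)))" for P
      unfolding F_def
    proof (rule eventually_INF_base)
      show "{\<F>. finite \<F> \<and> \<F> \<subseteq> \<U>} \<noteq> {}" by auto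
      fix a b assume "a \<in> {\<F>. finite \<F> \<and> \<F> \<subseteq> \<U>}" "b \<in> {\<F>. finite \<F> \<and> \<F> \<subseteq> \<U>}"
      then show "\<exists>x\<in>{\<F>. finite \<F> \<and> \<F> \<subseteq> \<U>}.
          principal (?K - \<Union>x) \<le> inf (principal (?K - \<Union>a)) (principal (?K - \<Union>b))"
        by (intro bexI[of _ "a \<union> b"]) auto
    qed
    have Fbot: "F \<noteq> bot"
    proof
      assume "F = bot"
      then have "eventually (\<lambda>_. False) F" by simp
      then show False using no unfolding evF eventually_principal by blast
    qed
    have FK: "eventually (\<lambda>x. x \<in> ?K) F"
      unfolding evF eventually_principal by (intro bexI[of _ "{}"]) auto
    have FU: "eventually (\<lambda>x. x \<notin> U) F" if "U \<in> \<U>" for U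
      unfolding evF eventually_principal using that by (intro bexI[of _ "{U}"]) auto
    \<comment> \<open>Paths take the value \<open>undefined\<close> at negative times, so these
      factors are singletons.\<close>
    define A where "A t = (if t \<ge> 0 then S else {undefined})" for t :: real
    have "compact (Pi\<^sub>E UNIV A)" unfolding A_def by (intro compact_PiE_UNIV) (auto simp: S)
    moreover have "eventually (\<lambda>x. x \<in> Pi\<^sub>E UNIV A) F"
      using FK by eventually_elim (auto simp: cadlag_def PiE_def extensional_def A_def)
    ultimately obtain z where z: "z \<in> Pi\<^sub>E UNIV A" "inf (nhds z) F \<noteq> bot"
      using Fbot unfolding compact_filter by blast
    define G where "G = inf (nhds z) F"
    have G: "G \<noteq> bot" "G \<le> F" "G \<le> nhds z" using z(2) unfolding G_def by auto
    have lim: "((\<lambda>x. x t) \<longlongrightarrow> z t) G" for t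
    proof -
      have "eventually (\<lambda>x. x t \<in> V) (nhds z)" if "open V" "z t \<in> V" for V
        using open_vimage[OF that(1) continuous_on_product_coordinates[of t]] that(2)
        by (auto simp: eventually_nhds intro!: exI[of _ "(\<lambda>x. x t) -` V"])
      then show ?thesis using G(3) by (intro topological_tendstoI) (auto dest: filter_leD)
    qed
    have GK: "eventually (\<lambda>x. x \<in> ?K) G" using FK G(2) by (auto dest: filter_leD)
    have zS: "z t \<in> S" if "t \<ge> 0" for t
    proof -
      have "z t \<in> A t" using z(1) by (auto simp: PiE_def Pi_def)
      then show ?thesis using that unfolding A_def by simp
    qed
    have zm: "jump_modulus \<delta> z"
      by (rule jump_modulus_pointwise_limit[OF G(1) _ lim]) (use GK in \<open>auto elim: eventually_mono\<close>)
    obtain w0 where w0: "\<And>t. t \<ge> 0 \<Longrightarrow> w0 t \<in> S \<and> (z \<longlongrightarrow> w0 t) (at_right t)"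
      using jump_modulus_right_limit[OF S zS \<delta> zm] by metis
    define w where "w = restrict w0 {0..}"
    interpret right_regularization S \<delta> z w
      by unfold_locales (use S zS \<delta> zm w0 in \<open>auto simp: w_def\<close>)
    have "w \<in> ?K" using w_cadlag jump_modulus_w by simp
    then obtain U where U: "U \<in> \<U>" "w \<in> U" using \<U>(2) by blast
    then obtain T \<epsilon> where T: "T > 0" "\<epsilon> > 0" "J1_nbhd S w T \<epsilon> \<subseteq> U"
      using \<U>(1) unfolding openin_skorohod_J1 by blast
    have "eventually (\<lambda>x. x \<in> J1_nbhd S w T \<epsilon>) G"
      by (rule J1_close[OF T(1,2) lim]) (use GK in simp)
    moreover have "eventually (\<lambda>x. x \<notin> U) G" using FU[OF U(1)] G(2) by (auto dest: filter_leD)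
    ultimately have "eventually (\<lambda>_. False) G" by eventually_elim (use T(3) in blast)
    then show False using G(1) by (simp add: eventually_False)
  qed
  then show ?thesis unfolding compactin_def by auto
qed

section \<open>Ranked masses of the classes of an equivalence relation\<close>

lemma finite_massive_classes:
  fixes p :: "'b pmf"
  assumes eq: "equiv V R" and s: "0 < s"
  shows "finite {c \<in> V // R. s < measure_pmf.prob p c}"
proof -
  have "card A \<le> nat \<lceil>1 / s\<rceil>" if A: "A \<subseteq> {c \<in> V // R. s < measure_pmf.prob p c}" "finite A" for A
  proof -
    have dis: "disjoint_family_on (\<lambda>c. c) A"
      unfolding disjoint_family_on_def
    proof (intro ballI impI)
      fix c d assume "c \<in> A" "d \<in> A" "c \<noteq> d"
      moreover from this have "c \<in> V // R" "d \<in> V // R" using A(1) by auto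
      ultimately show "c \<inter> d = {}" using quotient_disj[OF eq, of c d] by blast
    qed
    have "real (card A) * s = (\<Sum>c\<in>A. s)" by simp
    also have "\<dots> \<le> (\<Sum>c\<in>A. measure_pmf.prob p c)" using A(1) by (intro sum_mono) auto
    also have "\<dots> = measure_pmf.prob p (\<Union>c\<in>A. c)"
      using measure_pmf.finite_measure_finite_Union[OF A(2) _ dis, of p] by simp
    also have "\<dots> \<le> 1" by simp
    finally have "real (card A) \<le> 1 / s" using s by (simp add: field_simps)
    then show ?thesis by linarith
  qed
  then have "finite {c \<in> V // R. s < measure_pmf.prob p c} \<and>
      card {c \<in> V // R. s < measure_pmf.prob p c} \<le> nat \<lceil>1 / s\<rceil>"
    by (rule finite_if_finite_subsets_card_bdd)
  then show ?thesis by (rule conjunct1)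
qed

text \<open>The ranking is studied for arbitrary equivalence relations, because the left limits of
  the fragmentation belong to intersections of connectivity relations.\<close>

definition rank_masses :: "'b pmf \<Rightarrow> ('b \<times> 'b) set \<Rightarrow> nat \<Rightarrow> real" where
  "rank_masses p R = ranking (set_pmf p // R) (measure_pmf.prob p)"

lemma is_ranking_rank_masses:
  assumes eq: "equiv (set_pmf p) R"
  shows "is_ranking (set_pmf p // R) (measure_pmf.prob p) (rank_masses p R)"
  unfolding rank_masses_def
proof (rule is_ranking_ranking)
  fix c assume c: "c \<in> set_pmf p // R"
  then obtain v where "v \<in> set_pmf p" "c = R `` {v}" by (rule quotientE)
  moreover from this have "v \<in> c" using equiv_class_self[OF eq] by simp
  ultimately show "0 < measure_pmf.prob p c" by (auto intro: measure_pmf_posI)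
qed (use finite_massive_classes[OF eq] in auto)

lemma less_rank_masses_iff:
  assumes "equiv (set_pmf p) R" "0 < s"
  shows "s < rank_masses p R k \<longleftrightarrow> k < card {c \<in> set_pmf p // R. s < measure_pmf.prob p c}"
  using is_ranking_iff_card[OF is_ranking_rank_masses[OF assms(1)] assms(2) finite_massive_classes[OF assms]] .

lemma rank_masses_nonneg: "equiv (set_pmf p) R \<Longrightarrow> 0 \<le> rank_masses p R k"
  using is_ranking_rank_masses[of p R] unfolding is_ranking_def by blast

lemma rank_masses_in_S_down:
  assumes eq: "equiv (set_pmf p) R"
  shows "rank_masses p R \<in> S_down_le1"
proof -
  define x where "x = rank_masses p R"
  obtain f where f: "bij_betw f {i. 0 < x i} (set_pmf p // R)" "\<And>i. 0 < x i \<Longrightarrow> x i = measure_pmf.prob p (f i)"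
    and x: "decseq x" "\<And>i. 0 \<le> x i"
    using is_ranking_rank_masses[OF eq] unfolding is_ranking_def x_def by blast
  have bound: "sum x {..<n} \<le> 1" for n
  proof -
    define I where "I = {i. i < n \<and> 0 < x i}"
    have dis: "disjoint_family_on f I"
    proof -
      have "f i \<inter> f j = {}" if "i \<in> I" "j \<in> I" "i \<noteq> j" for i j
      proof -
        have ij: "i \<in> {i. 0 < x i}" "j \<in> {i. 0 < x i}" using that unfolding I_def by simp_all
        have "f i \<in> set_pmf p // R" "f j \<in> set_pmf p // R"
          using bij_betwE[OF f(1)] ij by blast+
        moreover have "f i \<noteq> f j"
          using bij_betw_imp_inj_on[OF f(1)] ij that(3) by (metis inj_onD)
        ultimately show ?thesis using quotient_disj[OF eq, of "f i" "f j"] by blast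
      qed
      then show ?thesis unfolding disjoint_family_on_def by blast
    qed
    have "sum x {..<n} = sum x I"
      using x(2) unfolding I_def by (intro sum.mono_neutral_right) (auto simp: order_less_le)
    also have "\<dots> = (\<Sum>i\<in>I. measure_pmf.prob p (f i))" using f(2) by (auto simp: I_def)
    also have "\<dots> = measure_pmf.prob p (\<Union>i\<in>I. f i)"
      using measure_pmf.finite_measure_finite_Union[OF _ _ dis, of p] by (simp add: I_def)
    also have "\<dots> \<le> 1" by simp
    finally show ?thesis .
  qed
  have "summable x" using x(2) bound by (intro summableI_nonneg_bounded)
  moreover have "suminf x \<le> 1" by (intro suminf_le_const \<open>summable x\<close> bound)
  ultimately have "x \<in> S_down_le1" using x unfolding S_down_le1_def by simp
  then show ?thesis unfolding x_def .
qed

text \<open>A massive class has a representative outside \<open>B\<close>, which matches the massive classes of the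
  two relations.\<close>

lemma rank_masses_close:
  assumes eq: "equiv (set_pmf p) R" "equiv (set_pmf p) R'" and sub: "R' \<subseteq> R"
    and good: "\<And>u v. (u, v) \<in> R \<Longrightarrow> u \<notin> B \<Longrightarrow> v \<notin> B \<Longrightarrow> (u, v) \<in> R'"
    and B: "measure_pmf.prob p B \<le> \<eta>"
  shows "\<bar>rank_masses p R k - rank_masses p R' k\<bar> \<le> \<eta>"
proof -
  let ?V = "set_pmf p" and ?P = "measure_pmf.prob p"
  have \<eta>: "0 \<le> \<eta>" using B measure_nonneg order_trans by blast
  have nn: "0 \<le> rank_masses p R k" "0 \<le> rank_masses p R' k" using eq by (auto intro: rank_masses_nonneg)
  have ex: "\<exists>v\<in>c. v \<notin> B \<and> v \<in> ?V" if "\<eta> < ?P c" for c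
  proof (rule ccontr)
    assume "\<not> ?thesis"
    then have "c \<inter> ?V \<subseteq> B" by blast
    then have "?P (c \<inter> ?V) \<le> ?P B" by (intro measure_pmf.finite_measure_mono) auto
    then show False using that B by (simp add: measure_Int_set_pmf)
  qed
  \<comment> \<open>Splitting a class costs at most the mass of \<open>B\<close>: the part of the
    class outside \<open>B\<close> stays together.\<close>
  have "rank_masses p R k \<le> rank_masses p R' k + \<eta>"
  proof (rule ccontr)
    assume n: "\<not> ?thesis"
    define s where "s = (rank_masses p R k - \<eta> + rank_masses p R' k) / 2"
    have s: "rank_masses p R' k < s" "s + \<eta> < rank_masses p R k" "0 < s"
      using n nn by (auto simp: s_def field_simps)
    define C where "C = {c \<in> ?V // R. s + \<eta> < ?P c}"
    define C' where "C' = {c \<in> ?V // R'. s < ?P c}"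
    have "\<exists>v\<in>c. v \<notin> B \<and> v \<in> ?V" if "c \<in> C" for c
      using ex[of c] that s(3) unfolding C_def by auto
    then obtain g where g: "\<And>c. c \<in> C \<Longrightarrow> g c \<in> c" "\<And>c. c \<in> C \<Longrightarrow> g c \<notin> B" "\<And>c. c \<in> C \<Longrightarrow> g c \<in> ?V"
      by metis
    define f where "f c = R' `` {g c}" for c
    have fc: "f c \<subseteq> c" "c - B \<subseteq> f c" if "c \<in> C" for c
    proof -
      have cq: "c \<in> ?V // R" using that unfolding C_def by simp
      show "f c \<subseteq> c"
      proof
        fix v assume "v \<in> f c"
        then have "(g c, v) \<in> R" using sub unfolding f_def by blast
        then show "v \<in> c" by (rule in_quotient_imp_closed[OF eq(1) cq g(1)[OF that]])
      qed
      show "c - B \<subseteq> f c"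
      proof
        fix v assume v: "v \<in> c - B"
        then have "(g c, v) \<in> R" using in_quotient_imp_in_rel[OF eq(1) cq, of "g c" v] g(1)[OF that] by simp
        then show "v \<in> f c" using good[of "g c" v] g(2)[OF that] v unfolding f_def by simp
      qed
    qed
    have fC: "f ` C \<subseteq> C'"
    proof (intro image_subsetI)
      fix c assume c: "c \<in> C"
      have "?P c \<le> ?P (f c \<union> B)" using fc(2)[OF c] by (intro measure_pmf.finite_measure_mono) auto
      also have "\<dots> \<le> ?P (f c) + ?P B" by (intro measure_Un_le) auto
      finally have "s < ?P (f c)" using c B unfolding C_def by simp
      moreover have "f c \<in> ?V // R'" unfolding f_def by (rule quotientI[OF g(3)[OF c]])
      ultimately show "f c \<in> C'" unfolding C'_def by simp
    qed
    have "inj_on f C"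
    proof (rule inj_onI)
      fix c d assume cd: "c \<in> C" "d \<in> C" "f c = f d"
      have "g c \<in> f c" unfolding f_def by (rule equiv_class_self[OF eq(2) g(3)[OF cd(1)]])
      then have "g c \<in> d" using fc(1)[OF cd(2)] unfolding cd(3) by blast
      then have "g c \<in> c \<inter> d" using g(1)[OF cd(1)] by simp
      moreover have "c \<in> ?V // R" "d \<in> ?V // R" using cd unfolding C_def by simp_all
      ultimately show "c = d" using quotient_disj[OF eq(1), of c d] by blast
    qed
    moreover have "finite C'" unfolding C'_def by (rule finite_massive_classes[OF eq(2) s(3)])
    ultimately have "card C \<le> card C'" using fC card_inj_on_le by blast
    moreover have "k < card C"
    proof -
      have "0 < s + \<eta>" using s(3) \<eta> by simp
      from less_rank_masses_iff[OF eq(1) this, of k] show ?thesis using s(2) unfolding C_def by simp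
    qed
    ultimately have "s < rank_masses p R' k"
      using less_rank_masses_iff[OF eq(2) s(3), of k] unfolding C'_def by simp
    then show False using s by simp
  qed
  \<comment> \<open>Conversely, each massive class lies in a class that is at least as heavy, and
    two of them cannot lie in the same one, since their representatives outside \<open>B\<close>
    would then be related by \<open>R'\<close>.\<close>
  moreover have "rank_masses p R' k \<le> rank_masses p R k + \<eta>"
  proof (rule ccontr)
    assume n: "\<not> ?thesis"
    define s where "s = (rank_masses p R k + \<eta> + rank_masses p R' k) / 2"
    have s: "rank_masses p R k + \<eta> < s" "s < rank_masses p R' k" "0 < s"
      using n nn \<eta> by (auto simp: s_def field_simps)
    define C where "C = {c \<in> ?V // R. s < ?P c}"
    define C' where "C' = {c \<in> ?V // R'. s < ?P c}"
    have "\<exists>v\<in>c. v \<notin> B \<and> v \<in> ?V" if "c \<in> C'" for c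
      using ex[of c] that s(1) nn unfolding C'_def by auto
    then obtain g where g: "\<And>c. c \<in> C' \<Longrightarrow> g c \<in> c" "\<And>c. c \<in> C' \<Longrightarrow> g c \<notin> B" "\<And>c. c \<in> C' \<Longrightarrow> g c \<in> ?V"
      by metis
    define f where "f c = R `` {g c}" for c
    have fC: "f ` C' \<subseteq> C"
    proof (intro image_subsetI)
      fix c assume c: "c \<in> C'"
      then have cq: "c \<in> ?V // R'" unfolding C'_def by simp
      have "c \<subseteq> f c"
      proof
        fix v assume "v \<in> c"
        then have "(g c, v) \<in> R'" using in_quotient_imp_in_rel[OF eq(2) cq, of "g c" v] g(1)[OF c] by simp
        then show "v \<in> f c" using sub unfolding f_def by blast
      qed
      then have "?P c \<le> ?P (f c)" by (intro measure_pmf.finite_measure_mono) auto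
      moreover have "s < ?P c" using c unfolding C'_def by simp
      moreover have "f c \<in> ?V // R" unfolding f_def by (rule quotientI[OF g(3)[OF c]])
      ultimately show "f c \<in> C" unfolding C_def by simp
    qed
    have "inj_on f C'"
    proof (rule inj_onI)
      fix c d assume cd: "c \<in> C'" "d \<in> C'" "f c = f d"
      have "(g c, g d) \<in> R"
        using eq_equiv_class[OF _ eq(1) g(3)[OF cd(2)]] cd(3) unfolding f_def by simp
      then have "(g c, g d) \<in> R'" using good[of "g c" "g d"] g(2)[OF cd(1)] g(2)[OF cd(2)] by simp
      moreover have "c \<in> ?V // R'" "d \<in> ?V // R'" using cd unfolding C'_def by auto
      ultimately show "c = d" using quotient_eqI[OF eq(2), of c d "g c" "g d"] g(1)[OF cd(1)] g(1)[OF cd(2)] by simp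
    qed
    moreover have "finite C" unfolding C_def by (rule finite_massive_classes[OF eq(1) s(3)])
    ultimately have "card C' \<le> card C" using fC card_inj_on_le by blast
    moreover have "k < card C'"
      using less_rank_masses_iff[OF eq(2) s(3), of k] s(2) unfolding C'_def by simp
    ultimately have "s < rank_masses p R k"
      using less_rank_masses_iff[OF eq(1) s(3), of k] unfolding C_def by simp
    then show False using s \<eta> by simp
  qed
  ultimately show ?thesis by linarith
qed

text \<open>The metric on sequences is a sum with weights 2^-n, n \<ge> 0, of total 2.\<close>

lemma dist_seq_le:
  fixes f g :: "nat \<Rightarrow> real"
  assumes "\<And>k. \<bar>f k - g k\<bar> \<le> \<eta>"
  shows "dist f g \<le> 2 * \<eta>"
proof -
  let ?a = "\<lambda>n. (1 / 2) ^ n * min (dist (f (from_nat n)) (g (from_nat n))) 1 :: real"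
  have geo: "(\<lambda>n. (1 / 2) ^ n * \<eta>) sums (2 * \<eta>)"
    using sums_mult2[OF geometric_sums[of "1 / 2 :: real"], of \<eta>] by simp
  have le: "?a n \<le> (1 / 2) ^ n * \<eta>" for n
    using assms[of "from_nat n"] by (intro mult_left_mono) (auto simp: dist_real_def)
  have nn: "0 \<le> ?a n" for n by simp
  have "summable ?a"
  proof (rule summable_comparison_test'[OF sums_summable[OF geo], of 0])
    fix n show "norm (?a n) \<le> (1 / 2) ^ n * \<eta>" using le[of n] nn[of n] by (simp only: real_norm_def abs_of_nonneg)
  qed
  then have "suminf ?a \<le> 2 * \<eta>"
    using suminf_le[OF le _ sums_summable[OF geo]] sums_unique[OF geo] by linarith
  then show ?thesis unfolding dist_fun_def .
qed

lemma prob_pmf_Compl: "measure_pmf.prob p (- A) = 1 - measure_pmf.prob p A"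
  using measure_pmf.prob_compl[of A p] by (simp only: space_measure_pmf Compl_eq_Diff_UNIV sets_measure_pmf UNIV_I)

text \<open>Supplies an exceptional set for \<open>rank_masses_close\<close> outside which only
  finitely many pairs of vertices have to be watched.\<close>

lemma nat_pmf_tail:
  fixes p :: "nat pmf"
  assumes "0 < \<eta>"
  shows "\<exists>n. measure_pmf.prob p (- {..<n}) \<le> \<eta>"
proof -
  have "(\<lambda>n. measure_pmf.prob p {..<n}) \<longlonglongrightarrow> measure_pmf.prob p (\<Union>n. {..<n})"
    by (intro measure_pmf.finite_Lim_measure_incseq) (auto simp: incseq_def)
  moreover have "(\<Union>n::nat. {..<n}) = UNIV" by auto
  ultimately have "(\<lambda>n. measure_pmf.prob p {..<n}) \<longlonglongrightarrow> 1" by simp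
  then have "eventually (\<lambda>n. 1 - \<eta> < measure_pmf.prob p {..<n}) sequentially"
    using assms by (intro order_tendstoD(1)) auto
  then obtain n where "1 - \<eta> < measure_pmf.prob p {..<n}"
    by (rule exE[OF eventually_happens'[OF sequentially_bot]])
  then have "measure_pmf.prob p (- {..<n}) \<le> \<eta>" unfolding prob_pmf_Compl by linarith
  then show ?thesis by blast
qed

text \<open>Both properties are inherited from the membership of single pairs: up to a small mass
  only finitely many pairs count, and on these a decreasing family of relations is constant close to
  t on either side.\<close>

lemma rank_masses_cadlag:
  fixes R :: "real \<Rightarrow> (nat \<times> nat) set"
  assumes eq: "\<And>t. t \<ge> 0 \<Longrightarrow> equiv (set_pmf p) (R t)"
    and anti: "\<And>s t. 0 \<le> s \<Longrightarrow> s \<le> t \<Longrightarrow> R t \<subseteq> R s"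
    and rc: "\<And>t u v. t \<ge> 0 \<Longrightarrow> (u, v) \<in> R t \<Longrightarrow> \<exists>s>t. (u, v) \<in> R s"
  shows "(\<lambda>t\<in>{0..}. rank_masses p (R t)) \<in> cadlag S_down_le1"
proof -
  define x where "x = (\<lambda>t\<in>{0..}. rank_masses p (R t))"
  have conv: "(x \<longlongrightarrow> rank_masses p L) F"
    if ev: "\<And>u v. eventually (\<lambda>s. (u, v) \<in> R s \<longleftrightarrow> (u, v) \<in> L) F"
      and sub: "eventually (\<lambda>s. 0 \<le> s \<and> (L \<subseteq> R s \<or> R s \<subseteq> L)) F" and L: "equiv (set_pmf p) L" for L F
  proof (rule tendstoI)
    fix e :: real assume e: "e > 0"
    obtain n where n: "measure_pmf.prob p (- {..<n}) \<le> e / 3" using nat_pmf_tail[of "e / 3" p] e by auto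
    have "eventually (\<lambda>s. \<forall>a\<in>{..<n} \<times> {..<n}. a \<in> R s \<longleftrightarrow> a \<in> L) F"
      using ev by (intro eventually_ball_finite) auto
    then show "eventually (\<lambda>s. dist (x s) (rank_masses p L) < e) F"
      using sub
    proof eventually_elim
      case (elim s)
      have "\<bar>rank_masses p (R s) k - rank_masses p L k\<bar> \<le> e / 3" for k
        using elim(2)
      proof (elim conjE disjE)
        assume "0 \<le> s" "L \<subseteq> R s"
        then show ?thesis
          using elim(1) by (intro rank_masses_close[OF eq L _ _ n]) auto
      next
        assume "0 \<le> s" "R s \<subseteq> L"
        then have "\<bar>rank_masses p L k - rank_masses p (R s) k\<bar> \<le> e / 3"
          using elim(1) by (intro rank_masses_close[OF L eq _ _ n]) auto
        then show ?thesis by (simp add: abs_minus_commute)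
      qed
      then have "dist (rank_masses p (R s)) (rank_masses p L) \<le> 2 * (e / 3)" by (rule dist_seq_le)
      then show ?case using elim(2) e unfolding x_def by simp
    qed
  qed
  have right: "(x \<longlongrightarrow> x t) (at_right t)" if t: "t \<ge> 0" for t
  proof -
    have "(x \<longlongrightarrow> rank_masses p (R t)) (at_right t)"
    proof (rule conv[OF _ _ eq[OF t]])
      show "eventually (\<lambda>s. 0 \<le> s \<and> (R t \<subseteq> R s \<or> R s \<subseteq> R t)) (at_right t)"
        using eventually_at_right_less[of t]
      proof eventually_elim
        case (elim s)
        then show ?case using anti[of t s] t by simp
      qed
      fix u v
      show "eventually (\<lambda>s. (u, v) \<in> R s \<longleftrightarrow> (u, v) \<in> R t) (at_right t)"
      proof (cases "(u, v) \<in> R t")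
        case True
        then obtain r where r: "r > t" "(u, v) \<in> R r" using rc[OF t] by blast
        show ?thesis
          using eventually_at_right_real[OF r(1)]
        proof eventually_elim
          case (elim s)
          then have "R r \<subseteq> R s" using t by (intro anti) auto
          then show ?case using True r by blast
        qed
      next
        case False
        show ?thesis
          using eventually_at_right_less[of t]
        proof eventually_elim
          case (elim s)
          then have "R s \<subseteq> R t" using t by (intro anti) auto
          then show ?case using False by blast
        qed
      qed
    qed
    then show ?thesis using t by (simp add: x_def)
  qed
  have left: "\<exists>l\<in>S_down_le1. (x \<longlongrightarrow> l) (at_left t)" if t: "t > 0" for t
  proof -
    \<comment> \<open>From the left the relations decrease to their intersection, which is again an
      equivalence relation; its ranked masses are the left limit.\<close>
    define L where "L = (\<Inter>s\<in>{0..<t}. R s)"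
    have L: "equiv (set_pmf p) L"
    proof -
      have Rs: "equiv (set_pmf p) (R s)" if "s \<in> {0..<t}" for s using eq that by simp
      have "L \<subseteq> R 0" using t unfolding L_def by auto
      then have "L \<subseteq> set_pmf p \<times> set_pmf p" using equiv_type[OF eq[of 0]] by auto
      moreover have "(u, u) \<in> L" if "u \<in> set_pmf p" for u
        unfolding L_def
      proof (rule INT_I)
        fix s assume "s \<in> {0..<t}"
        from Rs[OF this] show "(u, u) \<in> R s" using that by (auto simp: equiv_def refl_on_def)
      qed
      moreover have "sym L"
        unfolding L_def
      proof (rule sym_INTER, rule ballI)
        fix s assume "s \<in> {0..<t}"
        from Rs[OF this] show "sym (R s)" by (auto simp: equiv_def)
      qed
      moreover have "trans L"
        unfolding L_def
      proof (rule trans_INTER, rule ballI)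
        fix s assume "s \<in> {0..<t}"
        from Rs[OF this] show "trans (R s)" by (auto simp: equiv_def)
      qed
      ultimately show ?thesis unfolding equiv_def refl_on_def by auto
    qed
    have "(x \<longlongrightarrow> rank_masses p L) (at_left t)"
    proof (rule conv[OF _ _ L])
      show "eventually (\<lambda>s. 0 \<le> s \<and> (L \<subseteq> R s \<or> R s \<subseteq> L)) (at_left t)"
        using eventually_at_left_real[OF t]
      proof eventually_elim
        case (elim s)
        then have "L \<subseteq> R s" unfolding L_def by force
        then show ?case using elim by simp
      qed
      fix u v
      show "eventually (\<lambda>s. (u, v) \<in> R s \<longleftrightarrow> (u, v) \<in> L) (at_left t)"
      proof (cases "(u, v) \<in> L")
        case True
        show ?thesis
          using eventually_at_left_real[OF t]
        proof eventually_elim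
          case (elim s)
          then show ?case using True unfolding L_def by simp
        qed
      next
        case False
        then obtain r where r: "0 \<le> r" "r < t" "(u, v) \<notin> R r" unfolding L_def by auto
        show ?thesis
          using eventually_at_left_real[OF r(2)]
        proof eventually_elim
          case (elim s)
          then have "R s \<subseteq> R r" using r by (intro anti) auto
          then show ?case using False r by blast
        qed
      qed
    qed
    then show ?thesis using rank_masses_in_S_down[OF L] by blast
  qed
  have "x \<in> {0..} \<rightarrow>\<^sub>E S_down_le1"
    unfolding x_def using rank_masses_in_S_down[OF eq] by auto
  then have "x \<in> cadlag S_down_le1"
    unfolding cadlag_def by (intro CollectI conjI allI impI right left)
  then show ?thesis unfolding x_def .
qed

section \<open>The fragmentation as a path of ranked masses\<close>

definition connected_rel :: "nat pmf \<Rightarrow> nat set set \<Rightarrow> (nat \<times> nat) set" where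
  "connected_rel p E = {(u, v). u \<in> set_pmf p \<and> v \<in> set_pmf p \<and> (u, v) \<in> (edge_rel E)\<^sup>*}"

lemma equiv_connected_rel: "equiv (set_pmf p) (connected_rel p E)"
  unfolding connected_rel_def by (rule equiv_forest_components)

lemma fragmentation_eq:
  "fragmentation p E \<tau> = (\<lambda>t\<in>{0..}. rank_masses p (connected_rel p {e \<in> E. t < \<tau> e}))"
  unfolding fragmentation_def rank_masses_def forest_components_def connected_rel_def by simp

lemma edge_rel_mono: "E \<subseteq> E' \<Longrightarrow> (edge_rel E)\<^sup>* \<subseteq> (edge_rel E')\<^sup>*"
  unfolding edge_rel_def by (intro rtrancl_mono) auto

lemma connected_rel_mono: "E \<subseteq> E' \<Longrightarrow> connected_rel p E \<subseteq> connected_rel p E'"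
  using edge_rel_mono unfolding connected_rel_def by blast

text \<open>Right-continuity holds because a connection uses finitely many edges, and an edge
  present at time t has a deletion time strictly after t; all of them survive until some common
  later time.\<close>

lemma fragmentation_cadlag: "fragmentation p E \<tau> \<in> cadlag S_down_le1"
  unfolding fragmentation_eq
proof (rule rank_masses_cadlag)
  show "equiv (set_pmf p) (connected_rel p {e \<in> E. t < \<tau> e})" for t by (rule equiv_connected_rel)
  show "connected_rel p {e \<in> E. t < \<tau> e} \<subseteq> connected_rel p {e \<in> E. s < \<tau> e}" if "s \<le> t" for s t
    using that by (intro connected_rel_mono) auto
  fix t u v assume uv: "(u, v) \<in> connected_rel p {e \<in> E. t < \<tau> e}"
  then have "(u, v) \<in> (edge_rel {e \<in> E. t < \<tau> e})\<^sup>*" unfolding connected_rel_def by auto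
  then have "\<exists>s>t. (u, v) \<in> (edge_rel {e \<in> E. s < \<tau> e})\<^sup>*"
  proof (induction rule: rtrancl_induct)
    case base
    then show ?case by (intro exI[of _ "t + 1"]) auto
  next
    case (step v w)
    then obtain s where s: "s > t" "(u, v) \<in> (edge_rel {e \<in> E. s < \<tau> e})\<^sup>*" by blast
    have vw: "{v, w} \<in> E" "t < \<tau> {v, w}" using step unfolding edge_rel_def by auto
    define r where "r = min s ((t + \<tau> {v, w}) / 2)"
    have r: "t < r" "r \<le> s" "r < \<tau> {v, w}" using s vw by (auto simp: r_def min_def field_simps)
    have "(u, v) \<in> (edge_rel {e \<in> E. r < \<tau> e})\<^sup>*"
    proof -
      have "{e \<in> E. s < \<tau> e} \<subseteq> {e \<in> E. r < \<tau> e}" using r by auto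
      from edge_rel_mono[OF this] s(2) show ?thesis by blast
    qed
    moreover have "(v, w) \<in> edge_rel {e \<in> E. r < \<tau> e}" using vw r unfolding edge_rel_def by auto
    ultimately have "(u, w) \<in> (edge_rel {e \<in> E. r < \<tau> e})\<^sup>*" by (rule rtrancl.rtrancl_into_rtrancl)
    then show ?case using r(1) by blast
  qed
  then obtain s where "t < s" "(u, v) \<in> (edge_rel {e \<in> E. s < \<tau> e})\<^sup>*" by blast
  moreover have "u \<in> set_pmf p" "v \<in> set_pmf p" using uv unfolding connected_rel_def by auto
  ultimately show "\<exists>s>t. (u, v) \<in> connected_rel p {e \<in> E. s < \<tau> e}"
    unfolding connected_rel_def by blast
qed

section \<open>Separating edges of a birthday tree\<close>

lemma sym_edge_rel_rtrancl: "(u, v) \<in> (edge_rel E)\<^sup>* \<Longrightarrow> (v, u) \<in> (edge_rel E)\<^sup>*"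
proof -
  have "sym (edge_rel E)" unfolding edge_rel_def sym_def by (auto simp: insert_commute)
  then show "(u, v) \<in> (edge_rel E)\<^sup>* \<Longrightarrow> (v, u) \<in> (edge_rel E)\<^sup>*" using sym_rtrancl symD by metis
qed

lemma edge_rel_rtrancl_mono: "(u, v) \<in> (edge_rel E)\<^sup>* \<Longrightarrow> E \<subseteq> E' \<Longrightarrow> (u, v) \<in> (edge_rel E')\<^sup>*"
  using edge_rel_mono by blast

lemma connected_remove_edge:
  fixes x y :: nat
  assumes "(u, v) \<in> (edge_rel F)\<^sup>*"
  defines "D \<equiv> (edge_rel (F - {{x, y}}))\<^sup>*"
  shows "(u, v) \<in> D \<or> (u, x) \<in> D \<and> (y, v) \<in> D \<or> (u, y) \<in> D \<and> (x, v) \<in> D"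
  using assms(1)
proof (induction rule: rtrancl_induct)
  case base
  then show ?case unfolding D_def by simp
next
  case (step v w)
  have trans: "(a, c) \<in> D" if "(a, b) \<in> D" "(b, c) \<in> D" for a b c
    using that unfolding D_def by (rule rtrancl_trans)
  have refl: "(a, a) \<in> D" for a unfolding D_def by simp
  show ?case
  proof (cases "{v, w} = {x, y}")
    case True
    then have "v = x \<and> w = y \<or> v = y \<and> w = x" by (auto simp: doubleton_eq_iff)
    then show ?thesis using step.IH refl by blast
  next
    case False
    then have "(v, w) \<in> D" using step(2) unfolding D_def edge_rel_def by auto
    then show ?thesis using step.IH trans by blast
  qed
qed

lemma finite_connecting_edges:
  assumes "(u, v) \<in> (edge_rel F)\<^sup>*"
  shows "\<exists>F0. finite F0 \<and> F0 \<subseteq> F \<and> (u, v) \<in> (edge_rel F0)\<^sup>*"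
  using assms
proof (induction rule: rtrancl_induct)
  case base
  then show ?case by (intro exI[of _ "{}"]) auto
next
  case (step v w)
  then obtain F0 where F0: "finite F0" "F0 \<subseteq> F" "(u, v) \<in> (edge_rel F0)\<^sup>*" by blast
  have "(u, v) \<in> (edge_rel (insert {v, w} F0))\<^sup>*"
    using F0(3) by (rule edge_rel_rtrancl_mono) auto
  moreover have "(v, w) \<in> edge_rel (insert {v, w} F0)" unfolding edge_rel_def by simp
  ultimately have "(u, w) \<in> (edge_rel (insert {v, w} F0))\<^sup>*" by (rule rtrancl.rtrancl_into_rtrancl)
  then show ?case using F0 step(2) by (intro exI[of _ "insert {v, w} F0"]) (auto simp: edge_rel_def)
qed

text \<open>In a forest, a minimal set of edges connecting \<open>u\<close> and \<open>v\<close> only contains edges whose removal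
  from the whole forest separates \<open>u\<close> from \<open>v\<close>.\<close>

lemma forest_connected_without:
  assumes doubleton: "\<And>e. e \<in> E \<Longrightarrow> \<exists>x y. e = {x, y}"
    and forest: "\<And>x y. {x, y} \<in> E \<Longrightarrow> (x, y) \<notin> (edge_rel (E - {{x, y}}))\<^sup>*"
    and F: "F \<subseteq> E" "(u, v) \<in> (edge_rel F)\<^sup>*"
    and keep: "\<And>e. e \<in> F - F' \<Longrightarrow> (u, v) \<in> (edge_rel (E - {e}))\<^sup>*"
  shows "(u, v) \<in> (edge_rel F')\<^sup>*"
proof -
  obtain F0 where "finite F0" "F0 \<subseteq> F" "(u, v) \<in> (edge_rel F0)\<^sup>*" using finite_connecting_edges[OF F(2)] by blast
  then show ?thesis
  proof (induction F0 rule: finite_psubset_induct)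
    case (psubset F0)
    show ?case
    proof (cases "F0 \<subseteq> F'")
      case True
      then show ?thesis using psubset.prems(2) by (rule edge_rel_rtrancl_mono[rotated])
    next
      case False
      then obtain x y where e: "{x, y} \<in> F0" "{x, y} \<notin> F'"
        using doubleton psubset.prems(1) F(1) by (metis subset_eq)
      let ?D = "(edge_rel (E - {{x, y}}))\<^sup>*"
      have uv: "(u, v) \<in> ?D" using keep[of "{x, y}"] e psubset.prems(1) by blast
      have mono: "(a, b) \<in> ?D" if "(a, b) \<in> (edge_rel (F0 - {{x, y}}))\<^sup>*" for a b
        using that by (rule edge_rel_rtrancl_mono) (use psubset.prems(1) F(1) in blast)
      have no: "(x, y) \<notin> ?D" "(y, x) \<notin> ?D"
        using forest[of x y] e psubset.prems(1) F(1) sym_edge_rel_rtrancl by blast+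
      \<comment> \<open>If the edge were needed, u and v would lie at different ends of it, and
        their connection in the forest without this edge would close a cycle.\<close>
      have "(u, v) \<in> (edge_rel (F0 - {{x, y}}))\<^sup>*"
      proof (rule ccontr)
        assume "\<not> ?thesis"
        then consider "(u, x) \<in> ?D" "(y, v) \<in> ?D" | "(u, y) \<in> ?D" "(x, v) \<in> ?D"
          using connected_remove_edge[OF psubset.prems(2), of x y] mono by blast
        then show False
        proof cases
          case 1
          then have "(y, x) \<in> ?D" using uv sym_edge_rel_rtrancl rtrancl_trans by metis
          then show False using no by blast
        next
          case 2
          then have "(x, y) \<in> ?D" using uv sym_edge_rel_rtrancl rtrancl_trans by metis
          then show False using no by blast
        qed
      qed
      then show ?thesis using psubset.IH[of "F0 - {{x, y}}"] e psubset.prems by blast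
    qed
  qed
qed

text \<open>\<open>b\<close> is the parent of \<open>a\<close> in the tree rooted at y 0: the sample
  just before the first visit of \<open>a\<close>.\<close>

definition link :: "(nat \<Rightarrow> nat) \<Rightarrow> nat \<Rightarrow> nat \<Rightarrow> bool" where
  "link y b a \<longleftrightarrow> (\<exists>t. y (Suc t) = a \<and> y t = b \<and> (\<forall>s\<le>t. y s \<noteq> a))"

lemma birthday_edges_link: "birthday_edges y = {{b, a} | b a. link y b a}"
proof
  show "birthday_edges y \<subseteq> {{b, a} | b a. link y b a}"
  proof
    fix e assume "e \<in> birthday_edges y"
    then obtain j where j: "e = {y (j - 1), y j}" "1 \<le> j" "y j \<notin> y ` {..<j}"
      unfolding birthday_edges_def by blast
    obtain t where t: "j = Suc t" using j(2) by (cases j) auto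
    have "y s \<noteq> y (Suc t)" if "s \<le> t" for s
      using j(3) that unfolding t by (metis image_eqI lessThan_iff less_Suc_eq_le)
    then have "link y (y (j - 1)) (y j)" unfolding link_def t by (intro exI[of _ t]) auto
    then show "e \<in> {{b, a} | b a. link y b a}" using j by blast
  qed
  show "{{b, a} | b a. link y b a} \<subseteq> birthday_edges y"
  proof clarify
    fix b a assume "link y b a"
    then obtain t where t: "y (Suc t) = a" "y t = b" "\<forall>s\<le>t. y s \<noteq> a" unfolding link_def by blast
    then have "y (Suc t) \<notin> y ` {..<Suc t}" by (metis image_iff lessThan_iff less_Suc_eq_le)
    then show "{b, a} \<in> birthday_edges y" unfolding birthday_edges_def using t
      by (intro CollectI exI[of _ "Suc t"]) auto
  qed
qed

definition hit :: "(nat \<Rightarrow> nat) \<Rightarrow> nat \<Rightarrow> nat" where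
  "hit y a = (LEAST t. y t = a)"

lemma hit: "a \<in> range y \<Longrightarrow> y (hit y a) = a" "t < hit y a \<Longrightarrow> y t \<noteq> a"
  unfolding hit_def by (auto intro: LeastI dest: not_less_Least)

lemma hit_le: "y t = a \<Longrightarrow> hit y a \<le> t"
  unfolding hit_def by (rule Least_le)

lemma link_hit:
  assumes "link y b a"
  shows "y (hit y a - 1) = b" "0 < hit y a" "hit y b < hit y a" "a \<in> range y" "b \<in> range y"
proof -
  obtain t where t: "y (Suc t) = a" "y t = b" "\<forall>s\<le>t. y s \<noteq> a" using assms unfolding link_def by blast
  have "a \<in> range y" using t by auto
  then have "hit y a = Suc t" using hit(1)[of a y] hit_le[of y "Suc t" a] t(1) t(3) by (metis le_SucE)
  then show "y (hit y a - 1) = b" "0 < hit y a" "hit y b < hit y a" "a \<in> range y" "b \<in> range y"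
    using t hit_le[of y t b] by auto
qed

lemma link_unique: "link y b a \<Longrightarrow> link y b' a \<Longrightarrow> b = b'"
  using link_hit(1) by metis

text \<open>The descendants of \<open>a\<close> are closed under all edges except the one to its
  parent \<open>b\<close>, because every vertex has at most one parent; and \<open>b\<close> is not
  among them, as first visits come later along a line of descent.\<close>

lemma birthday_edges_forest:
  assumes "{u, v} \<in> birthday_edges y"
  shows "(u, v) \<notin> (edge_rel (birthday_edges y - {{u, v}}))\<^sup>*"
proof -
  let ?E = "birthday_edges y"
  define P where "P a x \<longleftrightarrow> (a, x) \<in> {(b, a). link y b a}\<^sup>*" for a x
  have P_hit: "hit y a \<le> hit y x" if "P a x" for a x
    using that unfolding P_def by (induction rule: rtrancl_induct) (auto dest: link_hit(3))
  have P_link: "P a c \<longleftrightarrow> P a d" if "link y d c" "c \<noteq> a" for a c d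
  proof
    assume "P a c"
    then show "P a d" using that link_unique[OF that(1)] unfolding P_def
      by (cases rule: rtrancl.cases) auto
  next
    assume "P a d"
    then show "P a c" using that unfolding P_def by (auto intro: rtrancl.rtrancl_into_rtrancl)
  qed
  have main: "(a, b) \<notin> (edge_rel (?E - {{b, a}}))\<^sup>*" if ba: "link y b a" for a b
  proof
    have inv: "P a x \<longleftrightarrow> P a x'" if edge: "(x, x') \<in> edge_rel (?E - {{b, a}})" for x x'
    proof -
      obtain d c where dc: "{x, x'} = {d, c}" "link y d c" "{x, x'} \<noteq> {b, a}"
        using edge unfolding edge_rel_def birthday_edges_link by blast
      then have "c \<noteq> a" using link_unique[OF ba] by blast
      then show ?thesis using P_link[OF dc(2)] dc(1) by (auto simp: doubleton_eq_iff)
    qed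
    assume "(a, b) \<in> (edge_rel (?E - {{b, a}}))\<^sup>*"
    then have "P a b"
    proof (induction rule: rtrancl_induct)
      case base
      then show ?case unfolding P_def by simp
    next
      case (step x x')
      then show ?case using inv by blast
    qed
    then show False using P_hit link_hit(3)[OF ba] by force
  qed
  obtain b a where e: "{u, v} = {b, a}" "link y b a" using assms unfolding birthday_edges_link by blast
  have "(a, b) \<notin> (edge_rel (?E - {{u, v}}))\<^sup>*" using main[OF e(2)] unfolding e(1) .
  moreover from this have "(b, a) \<notin> (edge_rel (?E - {{u, v}}))\<^sup>*" using sym_edge_rel_rtrancl by blast
  moreover have "u = b \<and> v = a \<or> u = a \<and> v = b" using e(1) by (simp add: doubleton_eq_iff)
  ultimately show ?thesis by metis
qed

lemma birthday_edges_doubleton: "e \<in> birthday_edges y \<Longrightarrow> \<exists>u v. e = {u, v}"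
  unfolding birthday_edges_link by blast

lemma card_birthday_edge: "e \<in> birthday_edges y \<Longrightarrow> card e = 2"
proof -
  assume "e \<in> birthday_edges y"
  then obtain b a where e: "e = {b, a}" "link y b a" unfolding birthday_edges_link by blast
  then have "b \<noteq> a" using link_hit(3) by blast
  then show ?thesis using e by simp
qed

text \<open>In a tree these are the edges of the path from \<open>u\<close> to \<open>r\<close>.
  Stated through connectivity, the set depends on the edge set alone and is measurable for the
  \<sigma>-field on which the deletion times are conditioned.\<close>

definition separating_edges :: "nat set set \<Rightarrow> nat \<Rightarrow> nat \<Rightarrow> nat set set" where
  "separating_edges E r u = {e \<in> E. (u, r) \<notin> (edge_rel (E - {e}))\<^sup>*}"

text \<open>An edge deleted between the two times separates neither \<open>u\<close> nor
  \<open>v\<close> from \<open>r\<close>, hence not \<open>u\<close> from \<open>v\<close>;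
  \<open>forest_connected_without\<close> shows that such edges can be spared.\<close>

lemma connected_unless_separated:
  fixes \<tau> :: "nat set \<Rightarrow> real"
  assumes E: "E = birthday_edges y"
    and u: "\<And>e. e \<in> separating_edges E r u \<Longrightarrow> a < \<tau> e \<Longrightarrow> b < \<tau> e"
    and v: "\<And>e. e \<in> separating_edges E r v \<Longrightarrow> a < \<tau> e \<Longrightarrow> b < \<tau> e"
    and uv: "(u, v) \<in> (edge_rel {e \<in> E. a < \<tau> e})\<^sup>*"
  shows "(u, v) \<in> (edge_rel {e \<in> E. b < \<tau> e})\<^sup>*"
proof (rule forest_connected_without[OF _ _ _ uv])
  show "\<exists>x y. e = {x, y}" if "e \<in> E" for e using birthday_edges_doubleton that unfolding E by blast
  show "(x, y) \<notin> (edge_rel (E - {{x, y}}))\<^sup>*" if "{x, y} \<in> E" for x y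
    using birthday_edges_forest that unfolding E by blast
  fix e assume e: "e \<in> {e \<in> E. a < \<tau> e} - {e \<in> E. b < \<tau> e}"
  then have "(u, r) \<in> (edge_rel (E - {e}))\<^sup>*" "(v, r) \<in> (edge_rel (E - {e}))\<^sup>*"
    using u[of e] v[of e] unfolding separating_edges_def by auto
  then show "(u, v) \<in> (edge_rel (E - {e}))\<^sup>*" using sym_edge_rel_rtrancl rtrancl_trans by metis
qed auto

section \<open>Lines of ancestors and distances in the tree\<close>

fun ancestral :: "(nat \<Rightarrow> nat) \<Rightarrow> nat list \<Rightarrow> bool" where
  "ancestral y [] = True"
| "ancestral y [a] = (a \<in> range y)"
| "ancestral y (a # b # l) = (link y b a \<and> ancestral y (b # l))"

fun path_edges :: "nat list \<Rightarrow> nat set set" where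
  "path_edges (a # b # l) = insert {b, a} (path_edges (b # l))"
| "path_edges _ = {}"

lemma path_edges_card: "finite (path_edges (a # l)) \<and> card (path_edges (a # l)) \<le> length l"
proof (induction l arbitrary: a)
  case (Cons b l)
  then show ?case using Cons[of b] card_insert_le_m1[of "Suc (length l)" "path_edges (b # l)" "{b, a}"] by simp
qed simp

lemma ancestral_to_root:
  assumes "u \<in> range y"
  shows "\<exists>l. ancestral y (u # l) \<and> last (u # l) = y 0"
  using assms
proof (induction "hit y u" arbitrary: u rule: less_induct)
  case less
  show ?case
  proof (cases "hit y u")
    case 0
    then have "u = y 0" using hit(1)[OF less.prems] by simp
    then show ?thesis by (intro exI[of _ "[]"]) auto
  next
    case (Suc t)
    have "link y (y t) u" unfolding link_def
      using hit(1)[OF less.prems] hit(2)[of _ y u] Suc by (intro exI[of _ t]) auto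
    moreover obtain l where "ancestral y (y t # l)" "last (y t # l) = y 0"
      using less.hyps[of "y t"] link_hit(3)[OF calculation] by auto
    ultimately show ?thesis by (intro exI[of _ "y t # l"]) auto
  qed
qed

lemma ancestral_take: "ancestral y (u # l) \<Longrightarrow> ancestral y (u # take k l)"
proof (induction l arbitrary: u k)
  case (Cons b l)
  then show ?case using link_hit(4)[of y b u] by (cases k) auto
qed auto

lemma ancestral_hit: "ancestral y (a # l) \<Longrightarrow> x \<in> set l \<Longrightarrow> hit y x < hit y a"
proof (induction l arbitrary: a)
  case (Cons b l)
  then show ?case using link_hit(3)[of y b a] by fastforce
qed simp

lemma ancestral_range: "ancestral y l \<Longrightarrow> set l \<subseteq> range y"
  by (induction y l rule: ancestral.induct) (auto dest: link_hit)

lemma ancestral_distinct: "ancestral y l \<Longrightarrow> distinct l"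
proof (induction y l rule: ancestral.induct)
  case (3 y a b l)
  then show ?case using ancestral_hit[of y a "b # l"] by force
qed auto

lemma ancestral_connected:
  assumes "ancestral y (u # l)" "e \<notin> path_edges (u # l)"
  shows "(u, last (u # l)) \<in> (edge_rel (birthday_edges y - {e}))\<^sup>*"
  using assms
proof (induction l arbitrary: u)
  case (Cons b l)
  then have "(b, last (b # l)) \<in> (edge_rel (birthday_edges y - {e}))\<^sup>*" by auto
  moreover have "(u, b) \<in> edge_rel (birthday_edges y - {e})"
    using Cons.prems unfolding edge_rel_def birthday_edges_link by (auto simp: insert_commute)
  ultimately show ?case by (simp add: converse_rtrancl_into_rtrancl)
qed simp

text \<open>Depth at least \<open>k\<close>. Lines of ancestors are listed from the vertex towards
  the root and may stop before it; as lists of numbers they form a countable set.\<close>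

definition deep :: "(nat \<Rightarrow> nat) \<Rightarrow> nat \<Rightarrow> nat \<Rightarrow> bool" where
  "deep y k u \<longleftrightarrow> (\<exists>l. length l = k \<and> ancestral y (u # l))"

text \<open>The path from \<open>u\<close> to \<open>r\<close> is covered by the lines of ancestors
  of its two ends. The statement about all smaller \<open>i\<close> suits the later sums of
  indicators.\<close>

lemma card_separating_edges:
  assumes "u \<in> range y" "r \<in> range y"
  shows "\<exists>k k'. finite (separating_edges (birthday_edges y) r u) \<and>
     card (separating_edges (birthday_edges y) r u) \<le> k + k' \<and> (\<forall>i\<le>k. deep y i u) \<and> (\<forall>i\<le>k'. deep y i r)"
proof -
  obtain l where l: "ancestral y (u # l)" "last (u # l) = y 0" using ancestral_to_root[OF assms(1)] by blast
  obtain l' where l': "ancestral y (r # l')" "last (r # l') = y 0" using ancestral_to_root[OF assms(2)] by blast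
  let ?S = "separating_edges (birthday_edges y) r u" and ?P = "path_edges (u # l) \<union> path_edges (r # l')"
  have sub: "?S \<subseteq> ?P"
  proof
    fix e assume e: "e \<in> ?S"
    show "e \<in> ?P"
    proof (rule ccontr)
      assume "e \<notin> ?P"
      then have "(u, y 0) \<in> (edge_rel (birthday_edges y - {e}))\<^sup>*" "(r, y 0) \<in> (edge_rel (birthday_edges y - {e}))\<^sup>*"
        using ancestral_connected[OF l(1), of e] ancestral_connected[OF l'(1), of e] l(2) l'(2) by auto
      then have "(u, r) \<in> (edge_rel (birthday_edges y - {e}))\<^sup>*"
        using sym_edge_rel_rtrancl rtrancl_trans by metis
      then show False using e unfolding separating_edges_def by blast
    qed
  qed
  have fin: "finite ?P" "card ?P \<le> length l + length l'"
    using path_edges_card[of u l] path_edges_card[of r l'] card_Un_le[of "path_edges (u # l)" "path_edges (r # l')"] by auto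
  have "finite ?S" "card ?S \<le> length l + length l'"
    using finite_subset[OF sub fin(1)] card_mono[OF fin(1) sub] fin(2) by auto
  moreover have "deep y i u" if "i \<le> length l" for i
    unfolding deep_def using ancestral_take[OF l(1), of i] that by (intro exI[of _ "take i l"]) auto
  moreover have "deep y i r" if "i \<le> length l'" for i
    unfolding deep_def using ancestral_take[OF l'(1), of i] that by (intro exI[of _ "take i l'"]) auto
  ultimately show ?thesis by (intro exI[of _ "length l"] exI[of _ "length l'"]) auto
qed

section \<open>The law of ancestral lines\<close>

definition word_weight :: "nat pmf \<Rightarrow> nat list \<Rightarrow> ennreal" where
  "word_weight p w = (\<Prod>x\<leftarrow>w. ennreal (pmf p x))"

text \<open>The expected number of initial segments of the sample sequence that belong to
  \<open>L\<close>. It bounds the probability that one of them does, and may exceed 1 when words of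
  \<open>L\<close> extend each other.\<close>

definition lang_weight :: "nat pmf \<Rightarrow> nat list set \<Rightarrow> ennreal" where
  "lang_weight p L = (\<integral>\<^sup>+w. word_weight p w * indicator L w \<partial>count_space UNIV)"

definition conc :: "nat list set \<Rightarrow> nat list set \<Rightarrow> nat list set" where
  "conc L M = {v @ w | v w. v \<in> L \<and> w \<in> M}"

lemma concI: "v \<in> L \<Longrightarrow> w \<in> M \<Longrightarrow> v @ w \<in> conc L M"
  unfolding conc_def by blast

lemma word_weight_simps [simp]:
  "word_weight p [] = 1" "word_weight p (a # w) = ennreal (pmf p a) * word_weight p w"
  "word_weight p (v @ w) = word_weight p v * word_weight p w"
  unfolding word_weight_def by simp_all

lemma lang_weight_mono: "L \<subseteq> M \<Longrightarrow> lang_weight p L \<le> lang_weight p M"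
  unfolding lang_weight_def by (intro nn_integral_mono mult_left_mono) (auto simp: indicator_def)

lemma lang_weight_singleton [simp]: "lang_weight p {w} = word_weight p w"
  unfolding lang_weight_def by (subst nn_integral_count_space'[of "{w}"]) auto

lemma lang_weight_Un: "lang_weight p (L \<union> M) \<le> lang_weight p L + lang_weight p M"
  unfolding lang_weight_def
  by (subst nn_integral_add[symmetric]) (auto intro!: nn_integral_mono simp: indicator_def)

text \<open>Only an inequality, as a word may factor in several ways; the choice of one
  factorisation per word embeds the language into the set of pairs.\<close>

lemma lang_weight_conc: "lang_weight p (conc L M) \<le> lang_weight p L * lang_weight p M"
proof -
  let ?A = "conc L M"
  have "\<exists>v u. w \<in> ?A \<longrightarrow> v \<in> L \<and> u \<in> M \<and> v @ u = w" for w
    unfolding conc_def by blast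
  then obtain f g where fg: "\<And>w. w \<in> ?A \<Longrightarrow> f w \<in> L \<and> g w \<in> M \<and> f w @ g w = w"
    by metis
  define h where "h w = (f w, g w)" for w
  define F where "F x = (word_weight p (fst x) * indicator L (fst x)) * (word_weight p (snd x) * indicator M (snd x))"
    for x :: "nat list \<times> nat list"
  have "inj_on h ?A"
  proof (rule inj_onI)
    fix w w' assume w: "w \<in> ?A" "w' \<in> ?A" "h w = h w'"
    then have "f w = f w'" "g w = g w'" unfolding h_def by simp_all
    then show "w = w'" using fg[OF w(1)] fg[OF w(2)] by metis
  qed
  then have bij: "bij_betw h ?A (h ` ?A)" by (simp add: bij_betw_def)
  have "lang_weight p ?A = (\<integral>\<^sup>+w. word_weight p w \<partial>count_space ?A)"
    unfolding lang_weight_def by (simp add: nn_integral_count_space_indicator)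
  also have "\<dots> = (\<integral>\<^sup>+w. F (h w) \<partial>count_space ?A)"
  proof (rule nn_integral_cong)
    fix w assume "w \<in> space (count_space ?A)"
    then have w: "f w \<in> L" "g w \<in> M" "f w @ g w = w" using fg by auto
    have "word_weight p w = word_weight p (f w @ g w)" by (simp only: w(3))
    then show "word_weight p w = F (h w)" using w(1,2) unfolding F_def h_def by simp
  qed
  also have "\<dots> = (\<integral>\<^sup>+x. F x \<partial>count_space (h ` ?A))"
    by (rule nn_integral_bij_count_space[OF bij])
  also have "\<dots> = (\<integral>\<^sup>+x. F x * indicator (h ` ?A) x \<partial>count_space UNIV)"
    by (simp add: nn_integral_count_space_indicator)
  also have "\<dots> \<le> (\<integral>\<^sup>+x. F x \<partial>count_space UNIV)"
    by (intro nn_integral_mono) (auto simp: indicator_def)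
  also have "\<dots> = (\<integral>\<^sup>+v. \<integral>\<^sup>+w. F (v, w) \<partial>count_space UNIV \<partial>count_space UNIV)"
    by (rule nn_integral_fst_count_space[symmetric])
  also have "\<dots> = lang_weight p L * lang_weight p M"
    unfolding F_def lang_weight_def by (simp add: nn_integral_cmult nn_integral_multc)
  finally show ?thesis .
qed

lemma lang_weight_letters: "lang_weight p ((\<lambda>a. [a]) ` A) = emeasure (measure_pmf p) A"
proof -
  have bij: "bij_betw (\<lambda>a. [a]) A ((\<lambda>a. [a]) ` A)" by (auto simp: bij_betw_def inj_on_def)
  have "lang_weight p ((\<lambda>a. [a]) ` A) = (\<integral>\<^sup>+w. word_weight p w \<partial>count_space ((\<lambda>a. [a]) ` A))"
    unfolding lang_weight_def by (simp add: nn_integral_count_space_indicator)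
  also have "\<dots> = (\<integral>\<^sup>+a. word_weight p [a] \<partial>count_space A)"
    by (rule nn_integral_bij_count_space[OF bij, symmetric])
  also have "\<dots> = emeasure (measure_pmf p) A" by (simp add: nn_integral_pmf)
  finally show ?thesis .
qed

lemma lang_weight_lists_length: "lang_weight p {w \<in> lists A. length w = n} \<le> emeasure (measure_pmf p) A ^ n"
proof (induction n)
  case 0
  have "lang_weight p {w \<in> lists A. length w = 0} \<le> lang_weight p {[]}" by (rule lang_weight_mono) auto
  then show ?case by simp
next
  case (Suc n)
  have "{w \<in> lists A. length w = Suc n} \<subseteq> conc ((\<lambda>a. [a]) ` A) {w \<in> lists A. length w = n}"
  proof
    fix w assume w: "w \<in> {w \<in> lists A. length w = Suc n}"
    then obtain a v where "w = a # v" by (cases w) auto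
    then have "w = [a] @ v" "[a] \<in> (\<lambda>a. [a]) ` A" "v \<in> {w \<in> lists A. length w = n}" using w by auto
    then show "w \<in> conc ((\<lambda>a. [a]) ` A) {w \<in> lists A. length w = n}" using concI by metis
  qed
  then have "lang_weight p {w \<in> lists A. length w = Suc n}
      \<le> lang_weight p ((\<lambda>a. [a]) ` A) * lang_weight p {w \<in> lists A. length w = n}"
    by (rule order_trans[OF lang_weight_mono lang_weight_conc])
  also have "\<dots> \<le> emeasure (measure_pmf p) A ^ Suc n"
    unfolding power_Suc lang_weight_letters by (intro mult_left_mono Suc.IH) auto
  finally show ?case .
qed

text \<open>Grouping the words by length bounds the weight by a geometric series of ratio 1 -
  P(B).\<close>

lemma lang_weight_lists:
  assumes B: "0 < measure_pmf.prob p B"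
  shows "lang_weight p (lists (- B)) \<le> ennreal (1 / measure_pmf.prob p B)"
proof -
  let ?q = "measure_pmf.prob p (- B)"
  have q: "?q = 1 - measure_pmf.prob p B" by (rule prob_pmf_Compl)
  have "lang_weight p (lists (- B)) \<le> (\<integral>\<^sup>+w. (\<Sum>n. word_weight p w * indicator {w \<in> lists (- B). length w = n} w) \<partial>count_space UNIV)"
    unfolding lang_weight_def
  proof (rule nn_integral_mono)
    fix w
    have "word_weight p w * indicator (lists (- B)) w
        = (\<Sum>n\<in>{length w}. word_weight p w * indicator {w \<in> lists (- B). length w = n} w)"
      by (simp add: indicator_def)
    also have "\<dots> \<le> (\<Sum>n. word_weight p w * indicator {w \<in> lists (- B). length w = n} w)"
      by (rule sum_le_suminf) auto
    finally show "word_weight p w * indicator (lists (- B)) w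
        \<le> (\<Sum>n. word_weight p w * indicator {w \<in> lists (- B). length w = n} w)" .
  qed
  also have "\<dots> = (\<Sum>n. lang_weight p {w \<in> lists (- B). length w = n})"
    unfolding lang_weight_def by (rule nn_integral_suminf) simp
  also have "\<dots> \<le> (\<Sum>n. emeasure (measure_pmf p) (- B) ^ n)"
    by (intro suminf_le lang_weight_lists_length) auto
  also have "\<dots> = (\<Sum>n. ennreal (?q ^ n))"
    by (simp add: measure_pmf.emeasure_eq_measure ennreal_power)
  also have "\<dots> = ennreal (\<Sum>n. ?q ^ n)"
    using B q by (intro suminf_ennreal2 summable_geometric) auto
  also have "(\<Sum>n. ?q ^ n) = 1 / measure_pmf.prob p B"
    using B q by (subst suminf_geometric) auto
  finally show ?thesis .
qed

text \<open>\<open>path_lang B [a\<^sub>0, \<dots>, a\<^sub>k]\<close> contains the initial segments, up to the first visit of \<open>a\<^sub>0\<close>, of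
  the sequences that avoid \<open>B\<close> up to that time and for which \<open>a\<^sub>i\<^sub>+\<^sub>1\<close> is the parent of \<open>a\<^sub>i\<close> for all \<open>i\<close>.\<close>

fun path_lang :: "nat set \<Rightarrow> nat list \<Rightarrow> nat list set" where
  "path_lang B [] = {}"
| "path_lang B [a] = conc (lists (- insert a B)) {[a]}"
| "path_lang B (a # b # l) =
     conc (path_lang (insert a B) (b # l)) ({[a]} \<union> conc (lists (- insert a B)) {[b, a]})"

text \<open>The sequence is cut right after the first visit of the parent \<open>b\<close>. Then
  either \<open>a\<close> follows at once, or \<open>b\<close> returns immediately before the first
  visit of \<open>a\<close>, and up to that return the samples only avoid \<open>a\<close> and
  \<open>B\<close>.\<close>

lemma ancestral_path_lang:
  assumes "ancestral y (a # l)" "\<And>s. s \<le> hit y a \<Longrightarrow> y s \<notin> B"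
  shows "map y [0..<Suc (hit y a)] \<in> path_lang B (a # l)"
  using assms
proof (induction l arbitrary: a B)
  case Nil
  have "map y [0..<hit y a] \<in> lists (- insert a B)"
    using Nil.prems(2) hit(2)[of _ y a] by (auto simp: in_lists_conv_set)
  moreover have "y (hit y a) = a" using hit(1) Nil.prems(1) by simp
  ultimately show ?case by (simp add: concI)
next
  case (Cons b l)
  have ba: "link y b a" "ancestral y (b # l)" using Cons.prems(1) by auto
  note h = link_hit[OF ba(1)]
  have a: "y (hit y a) = a" using hit(1)[OF h(4)] .
  let ?s = "hit y b" and ?t = "hit y a"
  have v: "map y [0..<Suc ?s] \<in> path_lang (insert a B) (b # l)"
    using Cons.prems(2) h(3) hit(2)[of _ y a] by (intro Cons.IH[OF ba(2)]) auto
  have split: "map y [0..<Suc ?t] = map y [0..<Suc ?s] @ map y [Suc ?s..<Suc ?t]"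
    using h(3) upt_add_eq_append[of 0 "Suc ?s" "?t - ?s"] by (simp flip: map_append)
  have "map y [Suc ?s..<Suc ?t] \<in> {[a]} \<union> conc (lists (- insert a B)) {[b, a]}"
  proof (cases "?t = Suc ?s")
    case True
    then show ?thesis using a by simp
  next
    case False
    then obtain r where r: "?t = Suc r" "Suc ?s \<le> r" using h(3) by (cases ?t) auto
    have "map y [Suc ?s..<r] \<in> lists (- insert a B)"
      using Cons.prems(2) hit(2)[of _ y a] r by (auto simp: in_lists_conv_set)
    moreover have "map y [Suc ?s..<Suc ?t] = map y [Suc ?s..<r] @ [b, a]"
      using r a h(1) by simp
    ultimately show ?thesis by (simp add: concI)
  qed
  then show ?case unfolding path_lang.simps split by (rule concI[OF v])
qed

text \<open>With Q = P(insert a B), the piece after the first visit of \<open>b\<close> has weight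
  at most p(a) + p(a) p(b) / Q = p(a) (Q + p(b)) / Q. Here Q + p(b) is the denominator in the
  induction hypothesis, so the factors telescope.\<close>

lemma path_lang_weight:
  assumes "distinct (a # l)" "set (a # l) \<inter> B = {}" "set (a # l) \<subseteq> set_pmf p"
  shows "lang_weight p (path_lang B (a # l))
    \<le> ennreal ((\<Prod>x\<leftarrow>a # l. pmf p x) / measure_pmf.prob p (insert a B))"
  using assms
proof (induction l arbitrary: a B)
  case Nil
  have pos: "0 < measure_pmf.prob p (insert a B)" using Nil by (intro measure_pmf_posI[of a]) auto
  have "lang_weight p (path_lang B [a]) \<le> lang_weight p (lists (- insert a B)) * lang_weight p {[a]}"
    unfolding path_lang.simps by (rule lang_weight_conc)
  also have "\<dots> \<le> ennreal (1 / measure_pmf.prob p (insert a B)) * ennreal (pmf p a)"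
    by (intro mult_mono lang_weight_lists pos) auto
  also have "\<dots> = ennreal (pmf p a / measure_pmf.prob p (insert a B))"
    using pos by (simp flip: ennreal_mult)
  finally show ?case by simp
next
  case (Cons b l)
  define Q where "Q = measure_pmf.prob p (insert a B)"
  define R where "R = (\<Prod>x\<leftarrow>b # l. pmf p x)"
  have Q: "0 < Q" using Cons.prems unfolding Q_def by (intro measure_pmf_posI[of a]) auto
  have pb: "0 < pmf p b" using Cons.prems by (auto simp: pmf_positive)
  have R: "0 \<le> R" unfolding R_def by (intro prod_list_nonneg) auto
  have "measure_pmf.prob p (insert b (insert a B)) = measure_pmf.prob p {b} + Q"
  proof -
    have "insert b (insert a B) = {b} \<union> insert a B" by auto
    moreover have "b \<notin> insert a B" using Cons.prems by auto
    ultimately show ?thesis unfolding Q_def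
      using measure_pmf.finite_measure_Union[of "{b}" p "insert a B"] by simp
  qed
  then have Qb: "measure_pmf.prob p (insert b (insert a B)) = pmf p b + Q" by (simp add: measure_pmf_single)
  have IH: "lang_weight p (path_lang (insert a B) (b # l)) \<le> ennreal (R / (pmf p b + Q))"
    using Cons.IH[of b "insert a B"] Cons.prems unfolding Qb R_def by auto
  have "lang_weight p ({[a]} \<union> conc (lists (- insert a B)) {[b, a]})
      \<le> lang_weight p {[a]} + lang_weight p (lists (- insert a B)) * lang_weight p {[b, a]}"
    by (rule order_trans[OF lang_weight_Un]) (intro add_left_mono lang_weight_conc)
  also have "\<dots> \<le> ennreal (pmf p a) + ennreal (1 / Q) * (ennreal (pmf p b) * ennreal (pmf p a))"
  proof (intro add_mono mult_mono)
    show "lang_weight p (lists (- insert a B)) \<le> ennreal (1 / Q)"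
      using lang_weight_lists[of p "insert a B"] Q unfolding Q_def by blast
  qed simp_all
  also have "\<dots> = ennreal (pmf p a + 1 / Q * (pmf p b * pmf p a))"
    using Q by (simp flip: ennreal_mult ennreal_plus)
  finally have W: "lang_weight p ({[a]} \<union> conc (lists (- insert a B)) {[b, a]})
      \<le> ennreal (pmf p a + 1 / Q * (pmf p b * pmf p a))" .
  have "lang_weight p (path_lang B (a # b # l)) \<le> lang_weight p (path_lang (insert a B) (b # l)) *
      lang_weight p ({[a]} \<union> conc (lists (- insert a B)) {[b, a]})"
    unfolding path_lang.simps by (rule lang_weight_conc)
  also have "\<dots> \<le> ennreal (R / (pmf p b + Q)) * ennreal (pmf p a + 1 / Q * (pmf p b * pmf p a))"
    by (intro mult_mono IH W) auto
  also have "\<dots> = ennreal (R / (pmf p b + Q) * (pmf p a + 1 / Q * (pmf p b * pmf p a)))"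
    using Q R by (intro ennreal_mult[symmetric]) auto
  also have "R / (pmf p b + Q) * (pmf p a + 1 / Q * (pmf p b * pmf p a)) = pmf p a * R / Q"
  proof -
    have "pmf p a + 1 / Q * (pmf p b * pmf p a) = pmf p a * (pmf p b + Q) / Q"
      using Q by (simp add: field_simps)
    moreover have "pmf p b + Q \<noteq> 0" using Q pb by simp
    ultimately show ?thesis by simp
  qed
  finally show ?case unfolding Q_def R_def by simp
qed

text \<open>With nothing else to avoid, the one denominator left is p(a), which cancels the factor
  of the starting vertex.\<close>

lemma path_lang_weight_root:
  assumes "distinct (a # l)" "set (a # l) \<subseteq> set_pmf p"
  shows "lang_weight p (path_lang {} (a # l)) \<le> ennreal (\<Prod>x\<leftarrow>l. pmf p x)"
proof -
  have "pmf p a > 0" using assms by (auto simp: pmf_positive)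
  then have "(\<Prod>x\<leftarrow>a # l. pmf p x) / measure_pmf.prob p {a} = (\<Prod>x\<leftarrow>l. pmf p x)"
    by (simp add: measure_pmf_single)
  then show ?thesis using path_lang_weight[OF assms(1) _ assms(2), of "{}"] by simp
qed

text \<open>The probability that \<open>k\<close> independent samples are distinct and avoid
  \<open>A\<close>.\<close>

primrec distinct_avoid :: "nat pmf \<Rightarrow> nat \<Rightarrow> nat set \<Rightarrow> ennreal" where
  "distinct_avoid p 0 A = 1"
| "distinct_avoid p (Suc k) A = (\<integral>\<^sup>+v. indicator (- A) v * distinct_avoid p k (insert v A) \<partial>measure_pmf p)"

text \<open>The product of 1 - x + x^2 / 2 and 1 + x + x^2 / 2 is 1 + x^4 / 4 \<ge> 1, so the
  quadratic Taylor bound for exp x can be inverted.\<close>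

lemma exp_minus_le_quadratic:
  fixes x :: real
  assumes "0 \<le> x"
  shows "exp (- x) \<le> 1 - x + x\<^sup>2 / 2"
proof -
  have pos: "0 < 1 + x + x\<^sup>2 / 2" using assms by (simp add: add_pos_nonneg)
  have "1 \<le> (1 - x + x\<^sup>2 / 2) * (1 + x + x\<^sup>2 / 2)"
  proof -
    have "(1 - x + x\<^sup>2 / 2) * (1 + x + x\<^sup>2 / 2) = 1 + (x\<^sup>2)\<^sup>2 / 4"
      by (simp add: algebra_simps power2_eq_square)
    then show ?thesis by simp
  qed
  then have "1 / (1 + x + x\<^sup>2 / 2) \<le> 1 - x + x\<^sup>2 / 2" using pos by (simp add: divide_le_eq)
  moreover have "exp (- x) \<le> 1 / (1 + x + x\<^sup>2 / 2)"
    using exp_lower_Taylor_quadratic[OF assms] pos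
    by (simp add: exp_minus inverse_eq_divide frac_le)
  ultimately show ?thesis by linarith
qed

text \<open>The sum of the squared masses is written as the mean mass of a sampled vertex, the form
  in which it enters integrals against \<open>p\<close>.\<close>

locale pmf_sigma =
  fixes p :: "nat pmf" and \<sigma> :: real
  assumes \<sigma>: "0 < \<sigma>" and E_pmf: "measure_pmf.expectation p (pmf p) = \<sigma>\<^sup>2"
begin

lemma integrable_bounded: "(\<And>v. \<bar>f v\<bar> \<le> c) \<Longrightarrow> integrable (measure_pmf p) f" for f :: "nat \<Rightarrow> real"
  by (intro measure_pmf.integrable_const_bound[where B = c]) auto

lemma integrable_pmf: "integrable (measure_pmf p) (pmf p)"
  by (intro integrable_bounded[where c = 1]) (simp add: pmf_le_1)

lemma pmf_le_\<sigma>: "pmf p v \<le> \<sigma>"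
proof -
  have "pmf p v * pmf p v = measure_pmf.expectation p (\<lambda>u. indicator {v} u * pmf p v)"
    by (simp add: measure_pmf_single)
  also have "\<dots> \<le> measure_pmf.expectation p (pmf p)"
  proof (rule integral_mono)
    show "integrable (measure_pmf p) (\<lambda>u. indicator {v} u * pmf p v)"
      by (intro integrable_bounded[where c = 1]) (simp add: pmf_le_1 indicator_def)
  qed (auto simp: integrable_pmf indicator_def)
  finally have "(pmf p v)\<^sup>2 \<le> \<sigma>\<^sup>2" unfolding E_pmf by (simp add: power2_eq_square)
  then show ?thesis using \<sigma> by (simp add: power2_le_iff_abs_le)
qed

lemma \<sigma>_le_1: "\<sigma> \<le> 1"
proof -
  have "measure_pmf.expectation p (pmf p) \<le> measure_pmf.expectation p (\<lambda>_. 1)"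
    by (intro integral_mono integrable_pmf) (auto simp: pmf_le_1)
  then have "\<sigma>\<^sup>2 \<le> 1\<^sup>2" using E_pmf by simp
  then show ?thesis by (rule power2_le_imp_le) simp
qed

text \<open>As p(v) / \<sigma> \<le> 1, the quadratic bound at this point is at most 1 - p(v) / (2
  \<sigma>), whose mean is 1 - \<sigma> / 2.\<close>

lemma expectation_exp_le:
  assumes "1 / \<sigma> \<le> m"
  shows "measure_pmf.expectation p (\<lambda>v. exp (- (m * pmf p v))) \<le> 1 - \<sigma> / 2"
proof -
  let ?E = "measure_pmf.expectation p"
  have le: "exp (- (m * pmf p v)) \<le> 1 - pmf p v / (2 * \<sigma>)" for v
  proof -
    have "- (m * pmf p v) \<le> - (pmf p v / \<sigma>)"
      using mult_right_mono[OF assms, of "pmf p v"] by simp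
    then have "exp (- (m * pmf p v)) \<le> exp (- (pmf p v / \<sigma>))" by simp
    also have "\<dots> \<le> 1 - pmf p v / \<sigma> + (pmf p v / \<sigma>)\<^sup>2 / 2"
      using \<sigma> by (intro exp_minus_le_quadratic) simp
    also have "(pmf p v / \<sigma>)\<^sup>2 \<le> pmf p v / \<sigma>"
    proof -
      have "pmf p v / \<sigma> \<le> 1" using pmf_le_\<sigma>[of v] \<sigma> by simp
      then have "(pmf p v / \<sigma>) * (pmf p v / \<sigma>) \<le> 1 * (pmf p v / \<sigma>)"
        using \<sigma> by (intro mult_right_mono) auto
      then show ?thesis by (simp add: power2_eq_square)
    qed
    finally show ?thesis by (simp add: field_simps)
  qed
  have m: "0 \<le> m" using assms \<sigma> by (meson divide_nonneg_pos order_trans zero_le_one)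
  have "?E (\<lambda>v. exp (- (m * pmf p v))) \<le> ?E (\<lambda>v. 1 - pmf p v / (2 * \<sigma>))"
  proof (rule integral_mono[OF _ _ le])
    show "integrable (measure_pmf p) (\<lambda>v. exp (- (m * pmf p v)))"
      using m by (intro integrable_bounded[where c = 1]) simp
    show "integrable (measure_pmf p) (\<lambda>v. 1 - pmf p v / (2 * \<sigma>))"
      using integrable_pmf by simp
  qed
  also have "\<dots> = 1 - \<sigma> / 2"
    using integrable_pmf E_pmf \<sigma> by (simp add: power2_eq_square)
  finally show ?thesis .
qed

lemma distinct_avoid_le_power: "distinct_avoid p k A \<le> ennreal ((1 - measure_pmf.prob p A) ^ k)"
proof (induction k arbitrary: A)
  case (Suc k)
  have nn: "0 \<le> 1 - measure_pmf.prob p A" for A by simp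
  have "distinct_avoid p (Suc k) A \<le> (\<integral>\<^sup>+v. ennreal ((1 - measure_pmf.prob p A) ^ k) * indicator (- A) v \<partial>measure_pmf p)"
    unfolding distinct_avoid.simps
  proof (rule nn_integral_mono)
    fix v
    have "distinct_avoid p k (insert v A) \<le> ennreal ((1 - measure_pmf.prob p (insert v A)) ^ k)" by (rule Suc.IH)
    also have "\<dots> \<le> ennreal ((1 - measure_pmf.prob p A) ^ k)"
      by (intro ennreal_leI power_mono diff_left_mono nn measure_pmf.finite_measure_mono) auto
    finally show "indicator (- A) v * distinct_avoid p k (insert v A)
        \<le> ennreal ((1 - measure_pmf.prob p A) ^ k) * indicator (- A) v"
      by (simp add: indicator_def)
  qed
  also have "\<dots> = ennreal ((1 - measure_pmf.prob p A) ^ k) * ennreal (1 - measure_pmf.prob p A)"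
    by (simp add: nn_integral_cmult_indicator measure_pmf.emeasure_eq_measure prob_pmf_Compl)
  also have "\<dots> = ennreal ((1 - measure_pmf.prob p A) ^ Suc k)"
    by (simp add: ennreal_mult' mult.commute)
  finally show ?case .
qed simp

text \<open>The last m samples are held in reserve: the need to avoid \<open>A\<close> costs them a
  factor exp (- m P(A)). Each of the first k samples v enlarges the set by p(v), which contributes a
  factor exp (- m p(v)) of mean at most 1 - \<sigma> / 2.\<close>

lemma distinct_avoid_le_exp:
  assumes m: "1 / \<sigma> \<le> real m"
  shows "distinct_avoid p (k + m) A \<le> ennreal ((1 - \<sigma> / 2) ^ k * exp (- (real m * measure_pmf.prob p A)))"
proof (induction k arbitrary: A)
  case 0
  have "(1 - measure_pmf.prob p A) ^ m \<le> exp (- measure_pmf.prob p A) ^ m"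
    using exp_ge_add_one_self[of "- measure_pmf.prob p A"] by (intro power_mono) auto
  also have "\<dots> = exp (- (real m * measure_pmf.prob p A))"
    by (simp flip: exp_of_nat_mult)
  finally show ?case using distinct_avoid_le_power[of m A] by (simp add: ennreal_leI order_trans)
next
  case (Suc k)
  let ?c = "(1 - \<sigma> / 2) ^ k * exp (- (real m * measure_pmf.prob p A))"
  have q: "0 \<le> 1 - \<sigma> / 2" using \<sigma>_le_1 by simp
  have c: "0 \<le> ?c" using q by simp
  have "distinct_avoid p (Suc k + m) A \<le> (\<integral>\<^sup>+v. ennreal ?c * ennreal (exp (- (real m * pmf p v))) \<partial>measure_pmf p)"
    unfolding distinct_avoid.simps add_Suc
  proof (rule nn_integral_mono)
    fix v
    show "indicator (- A) v * distinct_avoid p (k + m) (insert v A) \<le> ennreal ?c * ennreal (exp (- (real m * pmf p v)))"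
    proof (cases "v \<in> A")
      case False
      then have "measure_pmf.prob p ({v} \<union> A) = pmf p v + measure_pmf.prob p A"
        using measure_pmf.finite_measure_Union[of "{v}" p A] by (simp add: measure_pmf_single)
      then have "exp (- (real m * measure_pmf.prob p (insert v A)))
          = exp (- (real m * measure_pmf.prob p A)) * exp (- (real m * pmf p v))"
        by (simp add: algebra_simps flip: exp_add)
      then show ?thesis using Suc.IH[of "insert v A"] False c
        by (simp add: mult.assoc flip: ennreal_mult)
    qed simp
  qed
  also have "\<dots> = ennreal ?c * (\<integral>\<^sup>+v. ennreal (exp (- (real m * pmf p v))) \<partial>measure_pmf p)"
    by (rule nn_integral_cmult) simp
  also have "(\<integral>\<^sup>+v. ennreal (exp (- (real m * pmf p v))) \<partial>measure_pmf p)
      = ennreal (measure_pmf.expectation p (\<lambda>v. exp (- (real m * pmf p v))))"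
    by (intro nn_integral_eq_integral integrable_bounded[where c = 1]) auto
  also have "ennreal ?c * \<dots> \<le> ennreal ?c * ennreal (1 - \<sigma> / 2)"
    by (intro mult_left_mono ennreal_leI expectation_exp_le m) auto
  also have "\<dots> = ennreal ((1 - \<sigma> / 2) ^ Suc k * exp (- (real m * measure_pmf.prob p A)))"
    using c q by (simp add: mult_ac flip: ennreal_mult)
  finally show ?case .
qed

text \<open>The smallest reserve that \<open>distinct_avoid_le_exp\<close> permits.\<close>

definition burn_in :: nat where "burn_in = nat \<lceil>1 / \<sigma>\<rceil>"

lemma burn_in: "1 / \<sigma> \<le> real burn_in" "real burn_in \<le> 2 / \<sigma>"
proof -
  show "1 / \<sigma> \<le> real burn_in" unfolding burn_in_def by linarith
  have "real burn_in \<le> 1 / \<sigma> + 1" unfolding burn_in_def using \<sigma> by (simp, linarith?)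
  moreover have "1 \<le> 1 / \<sigma>" using \<sigma> \<sigma>_le_1 by simp
  ultimately show "real burn_in \<le> 2 / \<sigma>" by simp
qed

definition decay :: "nat \<Rightarrow> real" where
  "decay k = (if k < burn_in then 1 else (1 - \<sigma> / 2) ^ (k - burn_in))"

lemma decay_nonneg: "0 \<le> decay k"
  using \<sigma>_le_1 unfolding decay_def by simp

lemma distinct_avoid_le_decay: "distinct_avoid p k A \<le> ennreal (decay k)"
proof (cases "k < burn_in")
  case True
  have "(1 - measure_pmf.prob p A) ^ k \<le> 1" by (intro power_le_one) auto
  then have "ennreal ((1 - measure_pmf.prob p A) ^ k) \<le> ennreal 1" by (rule ennreal_leI)
  then show ?thesis using order_trans[OF distinct_avoid_le_power[of k A]] True unfolding decay_def by simp
next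
  case False
  have "distinct_avoid p (k - burn_in + burn_in) A
      \<le> ennreal ((1 - \<sigma> / 2) ^ (k - burn_in) * exp (- (real burn_in * measure_pmf.prob p A)))"
    by (rule distinct_avoid_le_exp[OF burn_in(1)])
  also have "\<dots> \<le> ennreal ((1 - \<sigma> / 2) ^ (k - burn_in) * 1)"
    using \<sigma>_le_1 by (intro ennreal_leI mult_left_mono) auto
  finally show ?thesis using False unfolding decay_def by simp
qed

lemma sum_odd: "(\<Sum>i<k. 2 * real i + 1) = (real k)\<^sup>2"
  by (induction k) (auto simp: power2_eq_square algebra_simps)

text \<open>The odd weights sum to squares, so this will bound a second moment. The terms before
  \<open>burn_in\<close> give at most 4 / \<sigma>^2; the geometric tail gives 8 / \<sigma>^2
  through the derivative of the geometric series, and at most 8 / \<sigma>^2 through the shift by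
  \<open>burn_in\<close>.\<close>

lemma suminf_decay: "(\<Sum>i. ennreal ((2 * real i + 1) * decay i)) \<le> ennreal (20 / \<sigma>\<^sup>2)"
proof -
  define q where "q = 1 - \<sigma> / 2"
  have q: "0 \<le> q" "q < 1" "1 - q = \<sigma> / 2" using \<sigma> \<sigma>_le_1 unfolding q_def by auto
  let ?m = "real burn_in"
  define f where "f i = (2 * real i + 1) * decay i" for i
  have tail: "f (i + burn_in) \<le> 2 * (real (Suc i) * q ^ i) + 2 * ?m * q ^ i" for i
  proof -
    have "f (i + burn_in) = (2 * real i + 2 * ?m + 1) * q ^ i" unfolding f_def decay_def q_def by simp
    also have "\<dots> \<le> (2 * real (Suc i) + 2 * ?m) * q ^ i" using q by (intro mult_right_mono) auto
    finally show ?thesis by (simp add: algebra_simps)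
  qed
  have s1: "(\<lambda>i. real (Suc i) * q ^ i) sums (1 / (1 - q)\<^sup>2)"
    using geometric_deriv_sums[of q] q(1,2) by simp
  have s2: "(\<lambda>i. q ^ i) sums (1 / (1 - q))" using geometric_sums[of q] q(1,2) by simp
  have S: "(\<lambda>i. 2 * (real (Suc i) * q ^ i) + 2 * ?m * q ^ i) sums (2 * (1 / (1 - q)\<^sup>2) + 2 * ?m * (1 / (1 - q)))"
    by (intro sums_add sums_mult s1 s2)
  have f0: "0 \<le> f i" for i unfolding f_def using decay_nonneg by simp
  have "summable (\<lambda>i. f (i + burn_in))"
  proof (rule summable_comparison_test'[OF sums_summable[OF S], of 0])
    fix i show "norm (f (i + burn_in)) \<le> 2 * (real (Suc i) * q ^ i) + 2 * ?m * q ^ i"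
      using tail[of i] f0[of "i + burn_in"] by (simp only: real_norm_def abs_of_nonneg)
  qed
  then have sf: "summable f" using summable_iff_shift by blast
  have "suminf f = (\<Sum>i. f (i + burn_in)) + sum f {..<burn_in}"
    by (rule suminf_split_initial_segment[OF sf])
  also have "(\<Sum>i. f (i + burn_in)) \<le> 2 * (1 / (1 - q)\<^sup>2) + 2 * ?m * (1 / (1 - q))"
    using suminf_le[OF tail \<open>summable (\<lambda>i. f (i + burn_in))\<close> sums_summable[OF S]] sums_unique[OF S] by linarith
  also have "sum f {..<burn_in} = ?m\<^sup>2"
    using sum_odd[of burn_in] unfolding f_def decay_def by simp
  also have "2 * (1 / (1 - q)\<^sup>2) + 2 * ?m * (1 / (1 - q)) + ?m\<^sup>2
      \<le> 2 * (1 / (\<sigma> / 2)\<^sup>2) + 2 * (2 / \<sigma>) * (1 / (\<sigma> / 2)) + (2 / \<sigma>)\<^sup>2"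
    unfolding q(3) using burn_in(2) \<sigma> by (intro add_mono mult_right_mono mult_left_mono power_mono) auto
  also have "\<dots> = 20 / \<sigma>\<^sup>2" using \<sigma> by (simp add: field_simps power2_eq_square)
  finally have "suminf f \<le> 20 / \<sigma>\<^sup>2" by simp
  then have "ennreal (suminf f) \<le> ennreal (20 / \<sigma>\<^sup>2)" by (rule ennreal_leI)
  then show ?thesis using suminf_ennreal2[OF f0 sf] unfolding f_def by simp
qed

end

section \<open>Independent samples and the probability of a line of ancestors\<close>

locale iid_pmf = prob_space M for M :: "'a measure" +
  fixes p :: "nat pmf" and Y :: "nat \<Rightarrow> 'a \<Rightarrow> nat"
  assumes indep: "indep_vars (\<lambda>_. count_space UNIV) Y UNIV"
    and distr: "\<And>j. distr M (count_space UNIV) (Y j) = measure_pmf p"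
begin

lemma Y_measurable [measurable]: "Y j \<in> measurable M (count_space UNIV)"
  using indep unfolding indep_vars_def by blast

lemma prob_Y: "prob {\<omega> \<in> space M. Y j \<omega> \<in> A} = measure_pmf.prob p A"
proof -
  have "measure_pmf.prob p A = measure (distr M (count_space UNIV) (Y j)) A" by (simp add: distr)
  also have "\<dots> = prob (Y j -` A \<inter> space M)" by (rule measure_distr) auto
  also have "Y j -` A \<inter> space M = {\<omega> \<in> space M. Y j \<omega> \<in> A}" by auto
  finally show ?thesis by simp
qed

lemma prob_prefix_in:
  "prob {\<omega> \<in> space M. \<forall>i<n. Y i \<omega> \<in> A i} = (\<Prod>i<n. measure_pmf.prob p (A i))"
proof (cases "n = 0")
  case True
  then show ?thesis using prob_space by simp
next
  case False
  have "prob (\<Inter>i\<in>{..<n}. Y i -` A i \<inter> space M) = (\<Prod>i\<in>{..<n}. prob (Y i -` A i \<inter> space M))"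
    using False by (intro indep_varsD[OF indep]) auto
  moreover have "(\<Inter>i\<in>{..<n}. Y i -` A i \<inter> space M) = {\<omega> \<in> space M. \<forall>i<n. Y i \<omega> \<in> A i}"
    using False by auto
  moreover have "prob (Y i -` A i \<inter> space M) = measure_pmf.prob p (A i)" for i
    using prob_Y[of i "A i"] by (simp add: vimage_def Int_def conj_commute)
  ultimately show ?thesis by simp
qed

lemma prefix_eq_iff:
  "map (\<lambda>i. Y i \<omega>) [0..<n] = w \<longleftrightarrow> n = length w \<and> (\<forall>i<n. Y i \<omega> = w ! i)"
proof -
  have "(\<forall>i<n. map (\<lambda>i. Y i \<omega>) [0..<n] ! i = w ! i) \<longleftrightarrow> (\<forall>i<n. Y i \<omega> = w ! i)" by simp
  then show ?thesis by (simp only: list_eq_iff_nth_eq length_map length_upt diff_zero)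
qed

lemma prob_prefix: "emeasure M {\<omega> \<in> space M. map (\<lambda>i. Y i \<omega>) [0..<length w] = w} = word_weight p w"
proof -
  have "prob {\<omega> \<in> space M. map (\<lambda>i. Y i \<omega>) [0..<length w] = w} = (\<Prod>i<length w. pmf p (w ! i))"
    using prob_prefix_in[of "length w" "\<lambda>i. {w ! i}"] by (simp only: prefix_eq_iff measure_pmf_single singleton_iff) simp
  then have "emeasure M {\<omega> \<in> space M. map (\<lambda>i. Y i \<omega>) [0..<length w] = w} = ennreal (\<Prod>i<length w. pmf p (w ! i))"
    by (simp only: emeasure_eq_measure)
  also have "\<dots> = (\<Prod>i<length w. ennreal (pmf p (w ! i)))" by (rule prod_ennreal[symmetric]) simp
  also have "\<dots> = word_weight p w"
    unfolding word_weight_def by (induction w) (simp_all add: prod.lessThan_Suc_shift del: prod.lessThan_Suc)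
  finally show ?thesis .
qed

lemma prefix_measurable [measurable]:
  "{\<omega> \<in> space M. map (\<lambda>i. Y i \<omega>) [0..<n] = w} \<in> sets M"
proof -
  have "Measurable.pred M (\<lambda>\<omega>. Y i \<omega> = w ! i)" for i
    by (rule pred_eq_const1[OF Y_measurable]) simp
  then have "Measurable.pred M (\<lambda>\<omega>. n = length w \<and> (\<forall>i. i < n \<longrightarrow> Y i \<omega> = w ! i))"
    by (intro pred_intros_logic pred_intros_countable) auto
  then show ?thesis unfolding prefix_eq_iff pred_def .
qed

text \<open>A union bound over the words of \<open>L\<close>, so that the length \<open>n\<close>
  may depend on the outcome.\<close>

lemma emeasure_prefix_in_lang:
  assumes "A \<in> sets M" "\<And>\<omega>. \<omega> \<in> A \<Longrightarrow> \<exists>n. map (\<lambda>i. Y i \<omega>) [0..<n] \<in> L"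
  shows "emeasure M A \<le> lang_weight p L"
proof -
  let ?E = "\<lambda>w. {\<omega> \<in> space M. map (\<lambda>i. Y i \<omega>) [0..<length w] = w}"
  have "emeasure M A = (\<integral>\<^sup>+\<omega>. indicator A \<omega> \<partial>M)" using assms(1) by simp
  also have "\<dots> \<le> (\<integral>\<^sup>+\<omega>. \<integral>\<^sup>+w. indicator L w * indicator (?E w) \<omega> \<partial>count_space UNIV \<partial>M)"
  proof (rule nn_integral_mono)
    fix \<omega> assume \<omega>: "\<omega> \<in> space M"
    show "indicator A \<omega> \<le> (\<integral>\<^sup>+w. indicator L w * indicator (?E w) \<omega> \<partial>count_space UNIV)"
    proof (cases "\<omega> \<in> A")
      case True
      then obtain n where n: "map (\<lambda>i. Y i \<omega>) [0..<n] \<in> L" using assms(2) by blast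
      let ?w = "map (\<lambda>i. Y i \<omega>) [0..<n]"
      have "(1::ennreal) = indicator L ?w * indicator (?E ?w) \<omega>" using n \<omega> by simp
      also have "\<dots> \<le> (\<integral>\<^sup>+w. indicator L w * indicator (?E w) \<omega> \<partial>count_space UNIV)"
        by (rule nn_integral_ge_point) simp
      finally show ?thesis using True by simp
    qed simp
  qed
  also have "\<dots> = (\<integral>\<^sup>+w. \<integral>\<^sup>+\<omega>. indicator L w * indicator (?E w) \<omega> \<partial>M \<partial>count_space UNIV)"
    by (rule nn_integral_count_space_nn_integral) auto
  also have "\<dots> = (\<integral>\<^sup>+w. word_weight p w * indicator L w \<partial>count_space UNIV)"
    by (intro nn_integral_cong) (simp add: nn_integral_cmult prob_prefix mult.commute)
  finally show ?thesis unfolding lang_weight_def .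
qed

abbreviation seq :: "'a \<Rightarrow> nat \<Rightarrow> nat" where "seq \<omega> \<equiv> \<lambda>j. Y j \<omega>"

lemma link_measurable [measurable]: "Measurable.pred M (\<lambda>\<omega>. link (seq \<omega>) b a)"
proof -
  have "Measurable.pred M (\<lambda>\<omega>. \<exists>t. Y (Suc t) \<omega> = a \<and> Y t \<omega> = b \<and> (\<forall>s. s \<le> t \<longrightarrow> Y s \<omega> \<noteq> a))"
    by measurable
  then show ?thesis unfolding link_def .
qed

lemma visited_measurable [measurable]: "Measurable.pred M (\<lambda>\<omega>. a \<in> range (seq \<omega>))"
proof -
  have "Measurable.pred M (\<lambda>\<omega>. \<exists>t. Y t \<omega> = a)" by measurable
  then show ?thesis by (simp add: image_iff eq_commute)
qed

lemma ancestral_measurable [measurable]: "Measurable.pred M (\<lambda>\<omega>. ancestral (seq \<omega>) l)"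
proof (induction l rule: induct_list012)
  case (3 a b l)
  then show ?case by (simp, measurable)
qed (simp_all, measurable)

lemma AE_visited:
  assumes "v \<in> set_pmf p"
  shows "AE \<omega> in M. v \<in> range (seq \<omega>)"
proof -
  define q where "q = measure_pmf.prob p (- {v})"
  have "q = 1 - measure_pmf.prob p {v}" unfolding q_def by (rule prob_pmf_Compl)
  then have q: "0 \<le> q" "q < 1" using assms by (auto simp: measure_pmf_single pmf_positive q_def pmf_le_1)
  let ?N = "{\<omega> \<in> space M. \<forall>i. Y i \<omega> \<noteq> v}"
  have le: "prob ?N \<le> q ^ n" for n
  proof -
    have "prob ?N \<le> prob {\<omega> \<in> space M. \<forall>i<n. Y i \<omega> \<in> - {v}}"
      by (intro finite_measure_mono) auto
    then show ?thesis using prob_prefix_in[of n "\<lambda>_. - {v}"] unfolding q_def by simp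
  qed
  have "prob ?N \<le> 0"
    by (rule LIMSEQ_le_const[OF LIMSEQ_power_zero]) (use q le in auto)
  then have "prob ?N = 0" by (simp add: measure_le_0_iff)
  moreover have "?N \<in> sets M" by measurable
  ultimately have "AE \<omega> in M. \<omega> \<notin> ?N" by (intro AE_not_in) (simp add: null_sets_def emeasure_eq_measure)
  then show ?thesis using AE_space by eventually_elim auto
qed

lemma AE_not_visited:
  assumes "v \<notin> set_pmf p"
  shows "AE \<omega> in M. v \<notin> range (seq \<omega>)"
proof -
  have "AE \<omega> in M. Y j \<omega> \<noteq> v" for j
  proof -
    have "prob {\<omega> \<in> space M. Y j \<omega> \<in> {v}} = 0"
      using assms by (simp only: prob_Y measure_pmf_single) (simp add: pmf_eq_0_set_pmf)
    moreover have "{\<omega> \<in> space M. Y j \<omega> \<in> {v}} \<in> sets M" by simp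
    ultimately have "AE \<omega> in M. \<omega> \<notin> {\<omega> \<in> space M. Y j \<omega> \<in> {v}}"
      by (intro AE_not_in) (simp add: null_sets_def emeasure_eq_measure)
    then show ?thesis using AE_space by eventually_elim auto
  qed
  then have "AE \<omega> in M. \<forall>j. Y j \<omega> \<noteq> v" by (simp add: AE_all_countable)
  then show ?thesis by eventually_elim auto
qed

lemma emeasure_ancestral_le:
  assumes "distinct (a # l)" "set (a # l) \<subseteq> set_pmf p"
  shows "emeasure M {\<omega> \<in> space M. ancestral (seq \<omega>) (a # l)} \<le> ennreal (\<Prod>x\<leftarrow>l. pmf p x)"
proof -
  have "emeasure M {\<omega> \<in> space M. ancestral (seq \<omega>) (a # l)} \<le> lang_weight p (path_lang {} (a # l))"
  proof (rule emeasure_prefix_in_lang)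
    fix \<omega> assume "\<omega> \<in> {\<omega> \<in> space M. ancestral (seq \<omega>) (a # l)}"
    then have "map (seq \<omega>) [0..<Suc (hit (seq \<omega>) a)] \<in> path_lang {} (a # l)"
      by (intro ancestral_path_lang) auto
    then show "\<exists>n. map (seq \<omega>) [0..<n] \<in> path_lang {} (a # l)" by blast
  qed measurable
  also have "\<dots> \<le> ennreal (\<Prod>x\<leftarrow>l. pmf p x)" by (rule path_lang_weight_root[OF assms])
  finally show ?thesis .
qed

text \<open>Summing over the next ancestor v multiplies the bound by p(v), and v is new because a
  line of ancestors has no repetitions: this is the recursion of
  \<open>distinct_avoid\<close>.\<close>

lemma emeasure_ancestral_extension_le:
  assumes "a \<in> set_pmf p" "set l \<subseteq> set_pmf p" "distinct (a # l)"
  shows "emeasure M {\<omega> \<in> space M. \<exists>as. length as = k \<and> ancestral (seq \<omega>) (a # l @ as)}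
    \<le> ennreal (\<Prod>x\<leftarrow>l. pmf p x) * distinct_avoid p k (set (a # l))"
  using assms(2,3)
proof (induction k arbitrary: l)
  case 0
  then show ?case using emeasure_ancestral_le[of a l] assms(1) by simp
next
  case (Suc k)
  define D where "D v = {\<omega> \<in> space M. \<exists>as. length as = k \<and> ancestral (seq \<omega>) (a # (l @ [v]) @ as)}" for v
  let ?A = "set (a # l)"
  have D_meas [measurable]: "D v \<in> sets M" for v unfolding D_def by measurable
  have D_le: "emeasure M (D v) \<le> ennreal (\<Prod>x\<leftarrow>l. pmf p x) * ennreal (pmf p v) * distinct_avoid p k (insert v ?A)"
    if "v \<notin> ?A" for v
  proof (cases "v \<in> set_pmf p")
    case True
    have "emeasure M (D v) \<le> ennreal (\<Prod>x\<leftarrow>l @ [v]. pmf p x) * distinct_avoid p k (set (a # l @ [v]))"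
      unfolding D_def using Suc.prems True that by (intro Suc.IH) auto
    also have "ennreal (\<Prod>x\<leftarrow>l @ [v]. pmf p x) = ennreal (\<Prod>x\<leftarrow>l. pmf p x) * ennreal (pmf p v)"
    proof -
      have "0 \<le> (\<Prod>x\<leftarrow>l. pmf p x)" by (intro prod_list_nonneg) auto
      then show ?thesis by (simp add: ennreal_mult)
    qed
    also have "set (a # l @ [v]) = insert v ?A" by auto
    finally show ?thesis .
  next
    case False
    \<comment> \<open>A vertex without mass is almost surely never visited, so it cannot be an
      ancestor.\<close>
    have "AE \<omega> in M. \<omega> \<notin> D v"
      using AE_not_visited[OF False]
    proof eventually_elim
      case (elim \<omega>)
      have False if in_D: "\<omega> \<in> D v"
      proof -
        obtain as where "ancestral (seq \<omega>) (a # (l @ [v]) @ as)" using in_D unfolding D_def by blast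
        from ancestral_range[OF this] elim show False by simp
      qed
      then show ?case by blast
    qed
    then have "D v \<in> null_sets M" by (simp add: AE_iff_null_sets)
    then have "emeasure M (D v) = 0" by (rule null_setsD1)
    then show ?thesis by simp
  qed
  have "emeasure M {\<omega> \<in> space M. \<exists>as. length as = Suc k \<and> ancestral (seq \<omega>) (a # l @ as)}
      = (\<integral>\<^sup>+\<omega>. indicator {\<omega> \<in> space M. \<exists>as. length as = Suc k \<and> ancestral (seq \<omega>) (a # l @ as)} \<omega> \<partial>M)"
    by (rule nn_integral_indicator[symmetric]) measurable
  also have "\<dots> \<le> (\<integral>\<^sup>+\<omega>. \<integral>\<^sup>+v. indicator (- ?A) v * indicator (D v) \<omega> \<partial>count_space UNIV \<partial>M)"
  proof (rule nn_integral_mono)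
    fix \<omega> assume \<omega>: "\<omega> \<in> space M"
    show "indicator {\<omega> \<in> space M. \<exists>as. length as = Suc k \<and> ancestral (seq \<omega>) (a # l @ as)} \<omega>
      \<le> (\<integral>\<^sup>+v. indicator (- ?A) v * indicator (D v) \<omega> \<partial>count_space UNIV)"
    proof (cases "\<exists>as. length as = Suc k \<and> ancestral (seq \<omega>) (a # l @ as)")
      case True
      then obtain v as where as: "length as = k" "ancestral (seq \<omega>) (a # (l @ [v]) @ as)"
        by (auto simp: length_Suc_conv)
      then have "v \<notin> ?A" using ancestral_distinct[OF as(2)] by auto
      moreover have "\<omega> \<in> D v" unfolding D_def using as \<omega> by blast
      ultimately have "(1::ennreal) = indicator (- ?A) v * indicator (D v) \<omega>" by simp
      also have "\<dots> \<le> (\<integral>\<^sup>+v. indicator (- ?A) v * indicator (D v) \<omega> \<partial>count_space UNIV)"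
        by (rule nn_integral_ge_point) simp
      finally show ?thesis using True \<omega> by simp
    qed simp
  qed
  also have "\<dots> = (\<integral>\<^sup>+v. \<integral>\<^sup>+\<omega>. indicator (- ?A) v * indicator (D v) \<omega> \<partial>M \<partial>count_space UNIV)"
    by (rule nn_integral_count_space_nn_integral) auto
  also have "\<dots> = (\<integral>\<^sup>+v. indicator (- ?A) v * emeasure M (D v) \<partial>count_space UNIV)"
    by (intro nn_integral_cong) (simp add: nn_integral_cmult)
  also have "\<dots> \<le> (\<integral>\<^sup>+v. ennreal (\<Prod>x\<leftarrow>l. pmf p x) * (ennreal (pmf p v) *
      (indicator (- ?A) v * distinct_avoid p k (insert v ?A))) \<partial>count_space UNIV)"
  proof (rule nn_integral_mono)
    fix v
    show "indicator (- ?A) v * emeasure M (D v) \<le> ennreal (\<Prod>x\<leftarrow>l. pmf p x) * (ennreal (pmf p v) *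
      (indicator (- ?A) v * distinct_avoid p k (insert v ?A)))"
      using D_le[of v] by (cases "v \<in> ?A") (simp_all add: mult.assoc)
  qed
  also have "\<dots> = ennreal (\<Prod>x\<leftarrow>l. pmf p x) * distinct_avoid p (Suc k) ?A"
    by (simp add: nn_integral_cmult nn_integral_measure_pmf)
  finally show ?case .
qed

lemma deep_measurable [measurable]: "Measurable.pred M (\<lambda>\<omega>. deep (seq \<omega>) k u)"
  unfolding deep_def by measurable

lemma emeasure_deep_le:
  assumes "u \<in> set_pmf p"
  shows "emeasure M {\<omega> \<in> space M. deep (seq \<omega>) k u} \<le> distinct_avoid p k {u}"
  using emeasure_ancestral_extension_le[of u "[]" k] assms unfolding deep_def by simp

end

section \<open>Second moments of depths and distances\<close>

locale iid_sigma = iid_pmf M p Y + pmf_sigma p \<sigma> for M :: "'a measure" and p Y \<sigma>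
begin

text \<open>For a visited vertex of depth d the series equals (d + 1)^2; in this form it can be
  integrated termwise.\<close>

definition depth_sq :: "nat \<Rightarrow> 'a \<Rightarrow> ennreal" where
  "depth_sq v \<omega> = (\<Sum>i. ennreal (2 * real i + 1) * indicator {\<omega> \<in> space M. deep (seq \<omega>) i v} \<omega>)"

lemma depth_sq_measurable [measurable]: "depth_sq v \<in> borel_measurable M"
  unfolding depth_sq_def[abs_def] by measurable

lemma nn_integral_depth_sq:
  assumes "v \<in> set_pmf p"
  shows "(\<integral>\<^sup>+\<omega>. depth_sq v \<omega> \<partial>M) \<le> ennreal (20 / \<sigma>\<^sup>2)"
proof -
  have "(\<integral>\<^sup>+\<omega>. depth_sq v \<omega> \<partial>M)
      = (\<Sum>i. ennreal (2 * real i + 1) * emeasure M {\<omega> \<in> space M. deep (seq \<omega>) i v})"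
    unfolding depth_sq_def by (subst nn_integral_suminf) (auto simp: nn_integral_cmult_indicator)
  also have "\<dots> \<le> (\<Sum>i. ennreal ((2 * real i + 1) * decay i))"
  proof (rule suminf_le)
    fix i
    have "emeasure M {\<omega> \<in> space M. deep (seq \<omega>) i v} \<le> ennreal (decay i)"
      using emeasure_deep_le[OF assms, of i] distinct_avoid_le_decay[of i "{v}"] by (rule order_trans)
    then have "ennreal (2 * real i + 1) * emeasure M {\<omega> \<in> space M. deep (seq \<omega>) i v}
        \<le> ennreal (2 * real i + 1) * ennreal (decay i)" by (rule mult_left_mono) simp
    also have "\<dots> = ennreal ((2 * real i + 1) * decay i)"
      by (intro ennreal_mult[symmetric]) (auto simp: decay_nonneg)
    finally show "ennreal (2 * real i + 1) * emeasure M {\<omega> \<in> space M. deep (seq \<omega>) i v}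
        \<le> ennreal ((2 * real i + 1) * decay i)" .
  qed auto
  also have "\<dots> \<le> ennreal (20 / \<sigma>\<^sup>2)" by (rule suminf_decay)
  finally show ?thesis .
qed

lemma depth_sq_ge:
  assumes "\<omega> \<in> space M" "\<And>i. i \<le> k \<Longrightarrow> deep (seq \<omega>) i v"
  shows "ennreal ((real k)\<^sup>2) \<le> depth_sq v \<omega>"
proof -
  have "ennreal ((real k)\<^sup>2) = (\<Sum>i<k. ennreal (2 * real i + 1))"
    by (subst sum_odd[symmetric], subst sum_ennreal) auto
  also have "\<dots> = (\<Sum>i<k. ennreal (2 * real i + 1) * indicator {\<omega> \<in> space M. deep (seq \<omega>) i v} \<omega>)"
    using assms by (intro sum.cong) auto
  also have "\<dots> \<le> depth_sq v \<omega>" unfolding depth_sq_def by (intro sum_le_suminf) auto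
  finally show ?thesis .
qed

text \<open>In the tree this is the distance between \<open>u\<close> and \<open>r\<close>.\<close>

definition separations :: "nat \<Rightarrow> nat \<Rightarrow> 'a \<Rightarrow> ennreal" where
  "separations r u \<omega> = (\<integral>\<^sup>+e. indicator (separating_edges (birthday_edges (seq \<omega>)) r u) e \<partial>count_space UNIV)"

lemma AE_separations_sq_le:
  assumes "u \<in> set_pmf p" "r \<in> set_pmf p"
  shows "AE \<omega> in M. (separations r u \<omega>)\<^sup>2 \<le> 2 * depth_sq u \<omega> + 2 * depth_sq r \<omega>"
  using AE_visited[OF assms(1)] AE_visited[OF assms(2)] AE_space
proof eventually_elim
  case (elim \<omega>)
  let ?S = "separating_edges (birthday_edges (seq \<omega>)) r u"
  obtain k k' where k: "finite ?S" "card ?S \<le> k + k'" "\<And>i. i \<le> k \<Longrightarrow> deep (seq \<omega>) i u" "\<And>i. i \<le> k' \<Longrightarrow> deep (seq \<omega>) i r"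
    using card_separating_edges[OF elim(1,2)] by blast
  have "separations r u \<omega> = ennreal (real (card ?S))"
    unfolding separations_def using k(1) by (simp add: emeasure_count_space ennreal_of_nat_eq_real_of_nat)
  also have "\<dots> ^ 2 = ennreal ((real (card ?S))\<^sup>2)" by (simp add: ennreal_power)
  also have "\<dots> \<le> ennreal (2 * (real k)\<^sup>2 + 2 * (real k')\<^sup>2)"
  proof (rule ennreal_leI)
    have "(real (card ?S))\<^sup>2 \<le> (real k + real k')\<^sup>2" using k(2) by (intro power_mono) auto
    also have "\<dots> \<le> 2 * (real k)\<^sup>2 + 2 * (real k')\<^sup>2"
      using sum_squares_ge_zero[of "real k - real k'" 0] by (simp add: power2_eq_square algebra_simps)
    finally show "(real (card ?S))\<^sup>2 \<le> 2 * (real k)\<^sup>2 + 2 * (real k')\<^sup>2" .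
  qed
  also have "\<dots> = 2 * ennreal ((real k)\<^sup>2) + 2 * ennreal ((real k')\<^sup>2)"
    by (simp add: ennreal_mult)
  also have "\<dots> \<le> 2 * depth_sq u \<omega> + 2 * depth_sq r \<omega>"
    using elim(3) k(3,4) by (intro add_mono mult_left_mono depth_sq_ge) auto
  finally show ?case .
qed

text \<open>The distance is at most the sum k + k' of two depths, and (k + k')^2 \<le> 2 k^2 + 2
  k'^2; hence the constant 2 * 20 + 2 * 20.\<close>

lemma nn_integral_separations_sq:
  assumes "u \<in> set_pmf p" "r \<in> set_pmf p"
  shows "(\<integral>\<^sup>+\<omega>. (separations r u \<omega>)\<^sup>2 \<partial>M) \<le> ennreal (80 / \<sigma>\<^sup>2)"
proof -
  have "(\<integral>\<^sup>+\<omega>. (separations r u \<omega>)\<^sup>2 \<partial>M) \<le> (\<integral>\<^sup>+\<omega>. 2 * depth_sq u \<omega> + 2 * depth_sq r \<omega> \<partial>M)"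
    by (rule nn_integral_mono_AE[OF AE_separations_sq_le[OF assms]])
  also have "\<dots> = 2 * (\<integral>\<^sup>+\<omega>. depth_sq u \<omega> \<partial>M) + 2 * (\<integral>\<^sup>+\<omega>. depth_sq r \<omega> \<partial>M)"
    by (simp add: nn_integral_add nn_integral_cmult)
  also have "\<dots> \<le> 2 * ennreal (20 / \<sigma>\<^sup>2) + 2 * ennreal (20 / \<sigma>\<^sup>2)"
    by (intro add_mono mult_left_mono nn_integral_depth_sq assms) auto
  also have "\<dots> = ennreal (80 / \<sigma>\<^sup>2)"
    by (simp flip: ennreal_plus ennreal_mult add: ennreal_mult[symmetric] flip: ennreal_numeral)
  finally show ?thesis .
qed

end

section \<open>Measurability of the fragmentation process\<close>

lemma connected_measurable:
  assumes "\<And>e. Measurable.pred N (\<lambda>\<omega>. e \<in> H \<omega>)"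
  shows "Measurable.pred N (\<lambda>\<omega>. (u, v) \<in> (edge_rel (H \<omega>))\<^sup>*)"
proof -
  have "Measurable.pred N (\<lambda>\<omega>. (u, v) \<in> edge_rel (H \<omega>) ^^ n)" for n
  proof (induction n arbitrary: v)
    case (Suc n)
    have "(u, v) \<in> edge_rel (H \<omega>) ^^ Suc n \<longleftrightarrow> (\<exists>w. (u, w) \<in> edge_rel (H \<omega>) ^^ n \<and> {w, v} \<in> H \<omega>)" for \<omega>
      unfolding relpow.simps edge_rel_def by blast
    moreover have "Measurable.pred N (\<lambda>\<omega>. \<exists>w. (u, w) \<in> edge_rel (H \<omega>) ^^ n \<and> {w, v} \<in> H \<omega>)"
      by (intro pred_intros_countable pred_intros_logic Suc assms)
    ultimately show ?case by presburger
  qed simp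
  then have "Measurable.pred N (\<lambda>\<omega>. \<exists>n. (u, v) \<in> edge_rel (H \<omega>) ^^ n)" by (intro pred_intros_countable)
  then show ?thesis by (simp add: rtrancl_power)
qed

lemma emeasure_pmf_nat: "emeasure (measure_pmf p) A = (\<Sum>v. ennreal (pmf p v) * indicator A v)" for p :: "nat pmf"
proof -
  have "emeasure (measure_pmf p) A = (\<integral>\<^sup>+v. indicator A v \<partial>measure_pmf p)" by simp
  also have "\<dots> = (\<integral>\<^sup>+v. ennreal (pmf p v) * indicator A v \<partial>count_space UNIV)"
    by (rule nn_integral_measure_pmf)
  also have "\<dots> = (\<Sum>v. ennreal (pmf p v) * indicator A v)" by (rule nn_integral_count_space_nat)
  finally show ?thesis .
qed

lemma prob_pmf_measurable:
  fixes p :: "nat pmf"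
  assumes [measurable]: "\<And>v. Measurable.pred N (\<lambda>\<omega>. v \<in> A \<omega>)"
  shows "(\<lambda>\<omega>. measure_pmf.prob p (A \<omega>)) \<in> borel_measurable N"
proof -
  have "(\<lambda>\<omega>. ennreal (pmf p v) * indicator (A \<omega>) v) \<in> borel_measurable N" for v
  proof -
    have "(\<lambda>\<omega>. ennreal (pmf p v) * (if v \<in> A \<omega> then 1 else 0)) \<in> borel_measurable N" by measurable
    then show ?thesis by (simp add: indicator_def of_bool_def)
  qed
  then have "(\<lambda>\<omega>. emeasure (measure_pmf p) (A \<omega>)) \<in> borel_measurable N"
    unfolding emeasure_pmf_nat by measurable
  then show ?thesis unfolding measure_def by measurable
qed

text \<open>Classes are replaced by lists of representatives, which range over a fixed countable set
  although the relation will be random; this makes the event measurable.\<close>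

lemma less_rank_masses_iff_list:
  assumes eq: "equiv (set_pmf p) R" and s: "0 < s"
  shows "s < rank_masses p R k \<longleftrightarrow> (\<exists>vs. length vs = Suc k \<and> distinct vs \<and> set vs \<subseteq> set_pmf p \<and>
     (\<forall>u\<in>set vs. \<forall>v\<in>set vs. u \<noteq> v \<longrightarrow> (u, v) \<notin> R) \<and> (\<forall>u\<in>set vs. s < measure_pmf.prob p (R `` {u})))"
    (is "_ \<longleftrightarrow> ?rhs")
proof -
  define C where "C = {c \<in> set_pmf p // R. s < measure_pmf.prob p c}"
  have fin: "finite C" unfolding C_def by (rule finite_massive_classes[OF eq s])
  have "k < card C \<longleftrightarrow> ?rhs"
  proof
    assume "k < card C"
    then obtain D where D: "D \<subseteq> C" "card D = Suc k" "finite D"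
      using obtain_subset_with_card_n[of "Suc k" C] by (auto simp: Suc_le_eq)
    have "\<exists>v\<in>set_pmf p. c = R `` {v}" if "c \<in> D" for c
    proof -
      have "c \<in> set_pmf p // R" using that D(1) unfolding C_def by blast
      then show ?thesis by (rule quotientE) blast
    qed
    then obtain g where g: "\<And>c. c \<in> D \<Longrightarrow> g c \<in> set_pmf p" "\<And>c. c \<in> D \<Longrightarrow> c = R `` {g c}" by metis
    have inj: "inj_on g D"
    proof (rule inj_onI)
      fix c d assume "c \<in> D" "d \<in> D" "g c = g d"
      then show "c = d" using g(2)[of c] g(2)[of d] by metis
    qed
    obtain vs where vs: "set vs = g ` D" "distinct vs" using finite_distinct_list[of "g ` D"] D(3) by blast
    have len: "length vs = Suc k" using distinct_card[OF vs(2)] vs(1) card_image[OF inj] D(2) by simp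
    have sep: "(u, v) \<notin> R" if uv: "u \<in> set vs" "v \<in> set vs" "u \<noteq> v" for u v
    proof
      assume "(u, v) \<in> R"
      then have "R `` {u} = R `` {v}" by (rule equiv_class_eq[OF eq])
      moreover obtain c d where cd: "c \<in> D" "d \<in> D" "u = g c" "v = g d" using vs(1) uv(1,2) by blast
      ultimately have "R `` {g c} = R `` {g d}" by simp
      then have "c = d" using g(2)[OF cd(1)] g(2)[OF cd(2)] by metis
      then show False using cd(3,4) uv(3) by simp
    qed
    have mass: "s < measure_pmf.prob p (R `` {u})" if u: "u \<in> set vs" for u
    proof -
      obtain c where c: "c \<in> D" "u = g c" using vs(1) u by blast
      have "c = R `` {u}" unfolding c(2) by (rule g(2)[OF c(1)])
      moreover have "c \<in> C" using D(1) c(1) by blast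
      ultimately show ?thesis unfolding C_def by simp
    qed
    have sub: "set vs \<subseteq> set_pmf p" unfolding vs(1) using g(1) by blast
    have sep': "\<forall>u\<in>set vs. \<forall>v\<in>set vs. u \<noteq> v \<longrightarrow> (u, v) \<notin> R"
      by (intro ballI impI) (rule sep)
    have mass': "\<forall>u\<in>set vs. s < measure_pmf.prob p (R `` {u})" by (rule ballI) (rule mass)
    show ?rhs by (rule exI[of _ vs]) (rule conjI len vs(2) sub sep' mass')+
  next
    assume ?rhs
    then obtain vs where vs: "length vs = Suc k" "distinct vs" "set vs \<subseteq> set_pmf p"
      "\<forall>u\<in>set vs. \<forall>v\<in>set vs. u \<noteq> v \<longrightarrow> (u, v) \<notin> R"
      "\<forall>u\<in>set vs. s < measure_pmf.prob p (R `` {u})" by (elim exE conjE)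
    have "inj_on (\<lambda>u. R `` {u}) (set vs)"
    proof (rule inj_onI)
      fix u v assume uv: "u \<in> set vs" "v \<in> set vs" "R `` {u} = R `` {v}"
      then have "v \<in> set_pmf p" using vs(3) by blast
      then have "(u, v) \<in> R" using eq_equiv_class[OF uv(3) eq] by blast
      then show "u = v" using vs(4) uv(1,2) by blast
    qed
    then have "card ((\<lambda>u. R `` {u}) ` set vs) = Suc k" using vs(1,2) by (simp add: card_image distinct_card)
    moreover have "(\<lambda>u. R `` {u}) ` set vs \<subseteq> C"
    proof (rule image_subsetI)
      fix u assume u: "u \<in> set vs"
      then have "R `` {u} \<in> set_pmf p // R" using vs(3) by (intro quotientI) blast
      then show "R `` {u} \<in> C" unfolding C_def using vs(5) u by simp
    qed
    ultimately show "k < card C" using card_mono[OF fin, of "(\<lambda>u. R `` {u}) ` set vs"] by simp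
  qed
  then show ?thesis using less_rank_masses_iff[OF eq s, of k] unfolding C_def by simp
qed

lemma rank_masses_measurable:
  fixes R :: "'a \<Rightarrow> (nat \<times> nat) set"
  assumes eq: "\<And>\<omega>. equiv (set_pmf p) (R \<omega>)"
    and meas: "\<And>u v. Measurable.pred N (\<lambda>\<omega>. (u, v) \<in> R \<omega>)"
  shows "(\<lambda>\<omega>. rank_masses p (R \<omega>)) \<in> borel_measurable N"
proof (rule measurable_coordinatewise_then_product)
  fix k
  have mass: "Measurable.pred N (\<lambda>\<omega>. s < measure_pmf.prob p (R \<omega> `` {u}))" for s u
  proof -
    have "(\<lambda>\<omega>. measure_pmf.prob p (R \<omega> `` {u})) \<in> borel_measurable N"
      by (rule prob_pmf_measurable) (use meas in \<open>simp add: Image_singleton\<close>)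
    then show ?thesis by measurable
  qed
  have pos: "Measurable.pred N (\<lambda>\<omega>. s < rank_masses p (R \<omega>) k)" if s: "0 < s" for s
    unfolding less_rank_masses_iff_list[OF eq s]
    by (intro pred_intros_countable pred_intros_logic pred_intros_finite pred_intros_conj1' mass meas
        pred_intros_imp' finite_set) auto
  \<comment> \<open>The description by lists is available for s > 0 only. The level 0 is a union
    over positive levels, and below 0 the event is the whole space.\<close>
  have "{\<omega> \<in> space N. s < rank_masses p (R \<omega>) k} \<in> sets N" for s
  proof (cases "0 < s")
    case True
    from pos[OF this] show ?thesis unfolding pred_def .
  next
    case False
    show ?thesis
    proof (cases "s = 0")
      case True
      have "0 < x \<longleftrightarrow> (\<exists>n. inverse (real (Suc n)) < x)" for x :: real
        using reals_Archimedean[of x] by (metis inverse_positive_iff_positive of_nat_0_less_iff order_less_trans zero_less_Suc)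
      then have "{\<omega> \<in> space N. s < rank_masses p (R \<omega>) k}
          = {\<omega> \<in> space N. \<exists>n. inverse (real (Suc n)) < rank_masses p (R \<omega>) k}" using True by simp
      also have "Measurable.pred N (\<lambda>\<omega>. \<exists>n. inverse (real (Suc n)) < rank_masses p (R \<omega>) k)"
        by (intro pred_intros_countable pos) simp
      then have "{\<omega> \<in> space N. \<exists>n. inverse (real (Suc n)) < rank_masses p (R \<omega>) k} \<in> sets N" unfolding pred_def .
      finally show ?thesis .
    next
      case False
      then have "s < rank_masses p (R \<omega>) k" for \<omega>
        using rank_masses_nonneg[OF eq, of \<omega> k] \<open>\<not> 0 < s\<close> by linarith
      then show ?thesis by simp
    qed
  qed
  then show "(\<lambda>\<omega>. rank_masses p (R \<omega>) k) \<in> borel_measurable N"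
    unfolding borel_measurable_iff_greater by blast
qed

lemma right_continuous_rational_near:
  fixes x :: "real \<Rightarrow> 'a::metric_space"
  assumes "(x \<longlongrightarrow> x r) (at_right r)" "\<eta> > 0" "r < b"
  shows "\<exists>r'. r < real_of_rat r' \<and> real_of_rat r' < b \<and> dist (x (real_of_rat r')) (x r) < \<eta>"
proof -
  have "eventually (\<lambda>s. dist (x s) (x r) < \<eta>) (at_right r)" using assms by (intro tendstoD)
  then obtain c where c: "c > r" "\<And>s. r < s \<Longrightarrow> s < c \<Longrightarrow> dist (x s) (x r) < \<eta>"
    unfolding eventually_at_right_field by blast
  obtain r' where "r < real_of_rat r'" "real_of_rat r' < min b c"
    using of_rat_dense[of r "min b c"] c(1) assms(3) by auto
  then show ?thesis using c(2) by auto
qed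

text \<open>Rational times slightly to the right approximate all values by right-continuity, and the
  strict inequalities between the times leave room for them. The countably many conditions that
  remain give measurability.\<close>

lemma jump_modulus_rational:
  fixes x :: "real \<Rightarrow> 'a::metric_space"
  assumes rc: "\<And>t. t \<ge> 0 \<Longrightarrow> (x \<longlongrightarrow> x t) (at_right t)"
  shows "jump_modulus \<delta> x \<longleftrightarrow> (\<forall>j::nat.
     (\<forall>r s t. 0 \<le> real_of_rat r \<and> r < s \<and> s < t \<and> real_of_rat t < real j \<and> real_of_rat t - real_of_rat r < \<delta> j \<longrightarrow>
        dist (x (real_of_rat r)) (x (real_of_rat s)) \<le> 1 / real (Suc j) \<or>
        dist (x (real_of_rat s)) (x (real_of_rat t)) \<le> 1 / real (Suc j)) \<and>
     (\<forall>s. 0 \<le> real_of_rat s \<and> real_of_rat s < \<delta> j \<longrightarrow> dist (x 0) (x (real_of_rat s)) \<le> 1 / real (Suc j)))"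
    (is "_ \<longleftrightarrow> (\<forall>j. ?A j \<and> ?B j)")
proof
  assume m: "jump_modulus \<delta> x"
  show "\<forall>j. ?A j \<and> ?B j"
  proof (intro allI conjI impI)
    fix j r s t
    assume "0 \<le> real_of_rat r \<and> r < s \<and> s < t \<and> real_of_rat t < real j \<and> real_of_rat t - real_of_rat r < \<delta> j"
    then show "dist (x (real_of_rat r)) (x (real_of_rat s)) \<le> 1 / real (Suc j) \<or>
        dist (x (real_of_rat s)) (x (real_of_rat t)) \<le> 1 / real (Suc j)"
      by (intro jump_modulusD[OF m]) (simp_all add: of_rat_less)
  next
    fix j s assume "0 \<le> real_of_rat s \<and> real_of_rat s < \<delta> j"
    then show "dist (x 0) (x (real_of_rat s)) \<le> 1 / real (Suc j)"
      by (intro jump_modulus_startD[OF m]) simp_all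
  qed
next
  assume R: "\<forall>j. ?A j \<and> ?B j"
  show "jump_modulus \<delta> x"
    unfolding jump_modulus_def
  proof (intro allI conjI impI)
    fix j :: nat and r s t :: real
    assume a: "0 \<le> r \<and> r < s \<and> s < t \<and> t < real j \<and> t - r < \<delta> j"
    let ?c = "1 / real (Suc j)"
    show "dist (x r) (x s) \<le> ?c \<or> dist (x s) (x t) \<le> ?c"
    proof (rule ccontr)
      assume n: "\<not> ?thesis"
      \<comment> \<open>The slack is twice \<eta>, since both ends of a move are displaced, each at
        a cost below \<eta>.\<close>
      have "\<exists>\<eta>>0. c + 2 * \<eta> \<le> a \<and> c + 2 * \<eta> \<le> b" if "c < a" "c < b" for a b c :: real
        using that by (intro exI[of _ "(min a b - c) / 2"]) (auto simp: min_def field_simps)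
      then obtain \<eta> where \<eta>: "\<eta> > 0"
        and \<eta>2: "?c + 2 * \<eta> \<le> dist (x r) (x s)" "?c + 2 * \<eta> \<le> dist (x s) (x t)"
        using n unfolding not_le de_Morgan_disj by blast
      obtain r' where r': "r < real_of_rat r'" "real_of_rat r' < s" "dist (x (real_of_rat r')) (x r) < \<eta>"
        using right_continuous_rational_near[OF rc \<eta>, of r s] a by auto
      obtain s' where s': "s < real_of_rat s'" "real_of_rat s' < t" "dist (x (real_of_rat s')) (x s) < \<eta>"
        using right_continuous_rational_near[OF rc \<eta>, of s t] a by auto
      obtain t' where t': "t < real_of_rat t'" "real_of_rat t' < min (real j) (r + \<delta> j)" "dist (x (real_of_rat t')) (x t) < \<eta>"
        using right_continuous_rational_near[OF rc \<eta>, of t "min (real j) (r + \<delta> j)"] a by auto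
      have "real_of_rat r' < real_of_rat s'" "real_of_rat s' < real_of_rat t'" using r' s' t' by linarith+
      then have "r' < s'" "s' < t'" by (simp_all add: of_rat_less)
      moreover have "0 \<le> real_of_rat r'" "real_of_rat t' < real j" "real_of_rat t' - real_of_rat r' < \<delta> j"
        using r'(1) t'(2) a by linarith+
      ultimately have "dist (x (real_of_rat r')) (x (real_of_rat s')) \<le> ?c \<or>
          dist (x (real_of_rat s')) (x (real_of_rat t')) \<le> ?c" using R by blast
      moreover have "dist (x r) (x s) < dist (x (real_of_rat r')) (x (real_of_rat s')) + 2 * \<eta>"
        using r'(3) s'(3) dist_triangle3[of "x r" "x s" "x (real_of_rat r')"]
          dist_triangle[of "x (real_of_rat r')" "x s" "x (real_of_rat s')"] by linarith
      moreover have "dist (x s) (x t) < dist (x (real_of_rat s')) (x (real_of_rat t')) + 2 * \<eta>"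
        using t'(3) s'(3) dist_triangle3[of "x s" "x t" "x (real_of_rat s')"]
          dist_triangle[of "x (real_of_rat s')" "x t" "x (real_of_rat t')"] by linarith
      ultimately show False using \<eta>2 by linarith
    qed
  next
    fix j :: nat and s :: real
    assume a: "0 \<le> s \<and> s < \<delta> j"
    let ?c = "1 / real (Suc j)"
    show "dist (x 0) (x s) \<le> ?c"
    proof (rule field_le_epsilon)
      fix \<eta> :: real assume \<eta>: "0 < \<eta>"
      obtain s' where s': "s < real_of_rat s'" "real_of_rat s' < \<delta> j" "dist (x (real_of_rat s')) (x s) < \<eta>"
        using right_continuous_rational_near[OF rc \<eta>, of s "\<delta> j"] a by auto
      have "0 \<le> real_of_rat s'" using s'(1) a by linarith
      then have "dist (x 0) (x (real_of_rat s')) \<le> ?c" using R s'(2) by blast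
      then show "dist (x 0) (x s) \<le> ?c + \<eta>"
        using s'(3) dist_triangle[of "x 0" "x s" "x (real_of_rat s')"] by linarith
    qed
  qed
qed

lemma jump_modulus_measurable:
  fixes X :: "'b \<Rightarrow> real \<Rightarrow> nat \<Rightarrow> real"
  assumes rc: "\<And>\<omega> t. t \<ge> 0 \<Longrightarrow> (X \<omega> \<longlongrightarrow> X \<omega> t) (at_right t)"
    and meas [measurable]: "\<And>t. t \<ge> 0 \<Longrightarrow> (\<lambda>\<omega>. X \<omega> t) \<in> borel_measurable N"
  shows "Measurable.pred N (\<lambda>\<omega>. jump_modulus \<delta> (X \<omega>))"
proof -
  have d: "Measurable.pred N (\<lambda>\<omega>. dist (X \<omega> r) (X \<omega> s) \<le> c)" if "0 \<le> r" "0 \<le> s" for r s c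
  proof -
    have "(\<lambda>\<omega>. dist (X \<omega> r) (X \<omega> s)) \<in> borel_measurable N"
      by (intro borel_measurable_dist meas that)
    then show ?thesis by measurable
  qed
  have d': "Measurable.pred N (\<lambda>\<omega>. 0 \<le> real_of_rat r \<and> r < s \<and> s < t \<and> real_of_rat t < real j \<and>
      real_of_rat t - real_of_rat r < \<delta> j \<longrightarrow>
        dist (X \<omega> (real_of_rat r)) (X \<omega> (real_of_rat s)) \<le> 1 / real (Suc j) \<or>
        dist (X \<omega> (real_of_rat s)) (X \<omega> (real_of_rat t)) \<le> 1 / real (Suc j))" for j r s t
  proof (rule pred_intros_imp')
    assume a: "0 \<le> real_of_rat r \<and> r < s \<and> s < t \<and> real_of_rat t < real j \<and>
      real_of_rat t - real_of_rat r < \<delta> j"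
    then have "real_of_rat r < real_of_rat s" "real_of_rat s < (real_of_rat t :: real)" by (simp_all add: of_rat_less)
    then have "0 \<le> (real_of_rat r :: real)" "0 \<le> (real_of_rat s :: real)" "0 \<le> (real_of_rat t :: real)"
      using a by linarith+
    then show "Measurable.pred N (\<lambda>\<omega>.
        dist (X \<omega> (real_of_rat r)) (X \<omega> (real_of_rat s)) \<le> 1 / real (Suc j) \<or>
        dist (X \<omega> (real_of_rat s)) (X \<omega> (real_of_rat t)) \<le> 1 / real (Suc j))"
      by (intro pred_intros_logic d)
  qed
  have d0: "Measurable.pred N (\<lambda>\<omega>. 0 \<le> real_of_rat s \<and> real_of_rat s < \<delta> j \<longrightarrow>
      dist (X \<omega> 0) (X \<omega> (real_of_rat s)) \<le> 1 / real (Suc j))" for j s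
    by (rule pred_intros_imp') (intro d; linarith)
  show ?thesis
    apply (rule iffD2[OF measurable_cong[OF jump_modulus_rational]])
     apply (erule rc)
    apply (intro pred_intros_countable(1) pred_intros_logic(3) d' d0)
    done
qed

section \<open>Deletion of edges\<close>

abbreviation potential_edges :: "nat set set" where
  "potential_edges \<equiv> {e. card e = 2}"

text \<open>An enumeration turns sums over edges into series that can be exchanged with
  integrals.\<close>

definition nth_edge :: "nat \<Rightarrow> nat set" where
  "nth_edge = from_nat_into potential_edges"

lemma nth_edge_bij: "bij_betw nth_edge UNIV potential_edges"
  unfolding nth_edge_def
proof (rule bij_betw_from_nat_into)
  have "potential_edges \<subseteq> Collect finite" by (auto intro: card_ge_0_finite)
  then show "countable potential_edges"
    using countable_Collect_finite countable_subset by blast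
  have "inj (\<lambda>n. {0, Suc n})" by (auto simp: inj_def doubleton_eq_iff)
  moreover have "range (\<lambda>n. {0, Suc n}) \<subseteq> potential_edges" by auto
  ultimately show "infinite potential_edges" using infinite_iff_countable_subset by blast
qed

lemma card_nth_edge [simp]: "card (nth_edge i) = 2"
  using nth_edge_bij by (auto simp: bij_betw_def)

lemma nth_edge_eq_iff [simp]: "nth_edge i = nth_edge j \<longleftrightarrow> i = j"
  using nth_edge_bij by (auto simp: bij_betw_def inj_on_def)

lemma nth_edge_ex: "card e = 2 \<Longrightarrow> \<exists>i. e = nth_edge i"
  using nth_edge_bij unfolding bij_betw_def by (metis (mono_tags, lifting) imageE mem_Collect_eq)

lemma nn_integral_indicator_edges:
  assumes "S \<subseteq> potential_edges"
  shows "(\<integral>\<^sup>+e. indicator S e \<partial>count_space UNIV) = (\<Sum>i. indicator S (nth_edge i))"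
proof -
  have "(\<integral>\<^sup>+e. indicator S e \<partial>count_space UNIV) = (\<integral>\<^sup>+e. indicator S e * indicator potential_edges e \<partial>count_space UNIV)"
    using assms by (intro nn_integral_cong) (auto simp: indicator_def)
  also have "\<dots> = (\<integral>\<^sup>+e. indicator S e \<partial>count_space potential_edges)"
    by (simp add: nn_integral_count_space_indicator)
  also have "\<dots> = (\<integral>\<^sup>+i. indicator S (nth_edge i) \<partial>count_space UNIV)"
    by (rule nn_integral_bij_count_space[OF nth_edge_bij, symmetric])
  also have "\<dots> = (\<Sum>i. indicator S (nth_edge i))" by (rule nn_integral_count_space_nat)
  finally show ?thesis .
qed

text \<open>In terms of u the event is an interval of length \<sigma> (b - a), of which only the
  part inside (0, 1) counts.\<close>

lemma uniform_deletion_time_prob: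
  fixes a b \<sigma> :: real
  assumes \<sigma>: "0 < \<sigma>" and ab: "a \<le> b"
  shows "measure (uniform_measure lborel {0<..<1}) {u. a < (1 - u) / \<sigma> \<and> (1 - u) / \<sigma> \<le> b} \<le> \<sigma> * (b - a)"
proof -
  have eq: "{u. a < (1 - u) / \<sigma> \<and> (1 - u) / \<sigma> \<le> b} = {1 - \<sigma> * b..<1 - \<sigma> * a}"
    using \<sigma> by (auto simp: field_simps)
  have "emeasure (uniform_measure lborel {0<..<1}) {1 - \<sigma> * b..<1 - \<sigma> * a}
      = emeasure lborel ({0<..<1} \<inter> {1 - \<sigma> * b..<1 - \<sigma> * a})"
    by (subst emeasure_uniform_measure) (auto simp: divide_ennreal_def)
  also have "\<dots> \<le> emeasure lborel {1 - \<sigma> * b..<1 - \<sigma> * a}" by (intro emeasure_mono) auto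
  also have "\<dots> = ennreal (\<sigma> * (b - a))"
    using \<sigma> ab by (simp add: algebra_simps)
  finally show ?thesis unfolding eq measure_def using \<sigma> ab
    by (intro enn2real_leI) auto
qed

text \<open>The separating edges are taken with respect to a fixed vertex \<open>r\<close>, and not the root \<open>Y\<^sub>0\<close>:
  the deletion times are only known to be independent given the edge set, which does not determine the root.\<close>

locale frag = iid_sigma M p Y \<sigma> for M :: "'a measure" and p Y \<sigma> +
  fixes U :: "nat set \<Rightarrow> 'a \<Rightarrow> real" and r :: nat
  assumes cond_U: "cond_iid_uniform M (\<lambda>\<omega>. birthday_edges (seq \<omega>)) U"
    and r: "r \<in> set_pmf p"
begin

definition E :: "'a \<Rightarrow> nat set set" where "E \<omega> = birthday_edges (seq \<omega>)"

definition \<tau> :: "'a \<Rightarrow> nat set \<Rightarrow> real" where "\<tau> \<omega> e = (1 - U e \<omega>) / \<sigma>"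

abbreviation F :: "'a measure" where "F \<equiv> sigma_edges M E"

lemma E_card: "e \<in> E \<omega> \<Longrightarrow> card e = 2"
  unfolding E_def by (rule card_birthday_edge)

lemma edge_pred: "Measurable.pred M (\<lambda>\<omega>. e \<in> E \<omega>)"
proof -
  have "e \<in> E \<omega> \<longleftrightarrow> (\<exists>b a. e = {b, a} \<and> link (seq \<omega>) b a)" for \<omega>
    unfolding E_def birthday_edges_link by blast
  moreover have "Measurable.pred M (\<lambda>\<omega>. \<exists>b a. e = {b, a} \<and> link (seq \<omega>) b a)" by measurable
  ultimately show ?thesis by presburger
qed

lemma space_F: "space F = space M"
  unfolding sigma_edges_def by (rule space_measure_of) auto

lemma sets_F: "sets F = sigma_sets (space M) (range (\<lambda>e. {\<omega> \<in> space M. e \<in> E \<omega>}))"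
  unfolding sigma_edges_def by (rule sets_measure_of) auto

lemma subalgebra_F: "subalgebra M F"
  unfolding subalgebra_def space_F sets_F
proof
  show "sigma_sets (space M) (range (\<lambda>e. {\<omega> \<in> space M. e \<in> E \<omega>})) \<subseteq> sets M"
    using edge_pred by (intro sets.sigma_sets_subset) (auto simp: pred_def)
qed simp

sublocale cond: sigma_finite_subalgebra M F
proof -
  interpret finite_measure_subalgebra M F by unfold_locales (rule subalgebra_F)
  show "sigma_finite_subalgebra M F" by unfold_locales
qed

lemma F_edge_pred: "Measurable.pred F (\<lambda>\<omega>. e \<in> E \<omega>)"
  unfolding pred_def space_F sets_F by (rule sigma_sets.Basic) auto

lemma F_separating_pred: "Measurable.pred F (\<lambda>\<omega>. e \<in> separating_edges (E \<omega>) r u)"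
proof -
  have "Measurable.pred F (\<lambda>\<omega>. (u, r) \<in> (edge_rel (E \<omega> - {e}))\<^sup>*)"
  proof (rule connected_measurable)
    show "Measurable.pred F (\<lambda>\<omega>. f \<in> E \<omega> - {e})" for f
      by (cases "f = e") (use F_edge_pred in auto)
  qed
  then show ?thesis unfolding separating_edges_def
    by (simp, intro pred_intros_logic F_edge_pred)
qed

lemma F_to_M: "f \<in> measurable F N \<Longrightarrow> f \<in> measurable M N"
  using measurable_from_subalg[OF subalgebra_F] .

lemma separating_subset: "separating_edges (E \<omega>) r u \<subseteq> potential_edges"
  unfolding separating_edges_def using E_card by blast

text \<open>The mass that the deletion of this edge alone would cut off from \<open>r\<close>; it is
  a function of the edge set.\<close>

definition sep_mass :: "nat \<Rightarrow> 'a \<Rightarrow> real" where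
  "sep_mass i \<omega> = measure_pmf.prob p {u. nth_edge i \<in> separating_edges (E \<omega>) r u}"

lemma sep_mass_F: "sep_mass i \<in> borel_measurable F"
  unfolding sep_mass_def[abs_def] by (rule prob_pmf_measurable) (simp add: F_separating_pred)

lemma sep_mass_M [measurable]: "sep_mass i \<in> borel_measurable M"
  using sep_mass_F by (rule F_to_M)

lemma sep_mass_bounds [simp]: "0 \<le> sep_mass i \<omega>" "sep_mass i \<omega> \<le> 1"
  unfolding sep_mass_def by simp_all

lemma sep_mass_nonedge: "nth_edge i \<notin> E \<omega> \<Longrightarrow> sep_mass i \<omega> = 0"
  unfolding sep_mass_def separating_edges_def by simp

lemma U_measurable: "U (nth_edge i) \<in> borel_measurable M"
  using cond_U unfolding cond_iid_uniform_def by simp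

lemma \<tau>_measurable [measurable]: "(\<lambda>\<omega>. \<tau> \<omega> (nth_edge i)) \<in> borel_measurable M"
  unfolding \<tau>_def using U_measurable by measurable

text \<open>The conditional law of the deletion times is known only where all the edges are present,
  hence the support condition on \<open>h\<close>. As \<open>h\<close> is determined by the edge
  set, it can be taken out of the conditional expectation.\<close>

lemma conditional_deletion_bound:
  assumes I: "finite I" and ab: "a \<le> b" and h: "h \<in> borel_measurable F" "\<And>\<omega>. 0 \<le> h \<omega>" "\<And>\<omega>. h \<omega> \<le> 1"
    and supp: "\<And>\<omega> i. i \<in> I \<Longrightarrow> nth_edge i \<notin> E \<omega> \<Longrightarrow> h \<omega> = 0"
  shows "(\<integral>\<^sup>+\<omega>. ennreal (h \<omega>) * indicator {\<omega> \<in> space M. \<forall>i\<in>I. a < \<tau> \<omega> (nth_edge i) \<and> \<tau> \<omega> (nth_edge i) \<le> b} \<omega> \<partial>M)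
    \<le> ennreal ((\<sigma> * (b - a)) ^ card I) * (\<integral>\<^sup>+\<omega>. ennreal (h \<omega>) \<partial>M)"
proof -
  define D where "D = nth_edge ` I"
  define B where "B = {u. a < (1 - u) / \<sigma> \<and> (1 - u) / \<sigma> \<le> b}"
  define A where "A = {\<omega> \<in> space M. \<forall>e\<in>D. U e \<omega> \<in> B}"
  define m where "m = measure (uniform_measure lborel {0<..<1}) B"
  have hM [measurable]: "h \<in> borel_measurable M" using h(1) by (rule F_to_M)
  have B: "B \<in> sets borel" unfolding B_def by measurable
  have A_eq: "{\<omega> \<in> space M. \<forall>i\<in>I. a < \<tau> \<omega> (nth_edge i) \<and> \<tau> \<omega> (nth_edge i) \<le> b} = A"
    unfolding A_def D_def B_def \<tau>_def by auto
  have A [measurable]: "A \<in> sets M" unfolding A_eq[symmetric] using I by measurable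
  have cardD: "card D = card I" unfolding D_def by (intro card_image inj_onI) simp
  have "AE \<omega> in M. D \<subseteq> E \<omega> \<longrightarrow> real_cond_exp M F (indicator A) \<omega> = (\<Prod>e\<in>D. m)"
  proof -
    have "finite D" "\<forall>e\<in>D. card e = 2 \<and> B \<in> sets borel" using I B unfolding D_def by auto
    moreover have "\<forall>D B. finite D \<longrightarrow> (\<forall>e\<in>D. card e = 2 \<and> B e \<in> sets borel) \<longrightarrow>
        (AE \<omega> in M. D \<subseteq> E \<omega> \<longrightarrow>
           real_cond_exp M F (indicator {\<omega> \<in> space M. \<forall>e\<in>D. U e \<omega> \<in> B e}) \<omega> =
           (\<Prod>e\<in>D. measure (uniform_measure lborel {0<..<1}) (B e)))"
    proof -
      have "(\<lambda>\<omega>. birthday_edges (seq \<omega>)) = E" unfolding E_def by blast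
      then have "cond_iid_uniform M E U" using cond_U by (simp only:)
      then show ?thesis unfolding cond_iid_uniform_def by (rule conjunct2)
    qed
    ultimately show ?thesis unfolding A_def m_def by (elim allE[of _ D] allE[of _ "\<lambda>_. B"]) blast
  qed
  then have ae: "AE \<omega> in M. h \<omega> * real_cond_exp M F (indicator A) \<omega> = h \<omega> * m ^ card I"
  proof eventually_elim
    case (elim \<omega>)
    show ?case
    proof (cases "D \<subseteq> E \<omega>")
      case True
      then show ?thesis using elim cardD by simp
    next
      case False
      then obtain i where "i \<in> I" "nth_edge i \<notin> E \<omega>" unfolding D_def by blast
      then have "h \<omega> = 0" by (rule supp)
      then show ?thesis by simp
    qed
  qed
  have int: "integrable M h" by (rule integrable_const_bound[where B = 1]) (use h in auto)
  have intA: "integrable M (\<lambda>\<omega>. h \<omega> * indicator A \<omega>)"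
    by (rule integrable_const_bound[where B = 1]) (use h in \<open>auto simp: indicator_def\<close>)
  have "(\<integral>\<omega>. h \<omega> * indicator A \<omega> \<partial>M) = (\<integral>\<omega>. h \<omega> * real_cond_exp M F (indicator A) \<omega> \<partial>M)"
    by (rule cond.real_cond_exp_intg(2)[symmetric, OF intA h(1)]) simp
  also have "\<dots> = (\<integral>\<omega>. h \<omega> * m ^ card I \<partial>M)"
  proof (rule integral_cong_AE[OF _ _ ae])
    have "real_cond_exp M F (indicator A) \<in> borel_measurable M"
      by (rule F_to_M) simp
    then show "(\<lambda>\<omega>. h \<omega> * real_cond_exp M F (indicator A) \<omega>) \<in> borel_measurable M"
      by (rule borel_measurable_times[OF hM])
  qed simp
  also have "\<dots> = m ^ card I * (\<integral>\<omega>. h \<omega> \<partial>M)" by simp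
  also have "\<dots> \<le> (\<sigma> * (b - a)) ^ card I * (\<integral>\<omega>. h \<omega> \<partial>M)"
    using uniform_deletion_time_prob[OF \<sigma> ab] h(2) unfolding m_def B_def
    by (intro mult_right_mono power_mono integral_nonneg) auto
  finally have le: "(\<integral>\<omega>. h \<omega> * indicator A \<omega> \<partial>M) \<le> (\<sigma> * (b - a)) ^ card I * (\<integral>\<omega>. h \<omega> \<partial>M)" .
  have "(\<integral>\<^sup>+\<omega>. ennreal (h \<omega>) * indicator A \<omega> \<partial>M) = (\<integral>\<^sup>+\<omega>. ennreal (h \<omega> * indicator A \<omega>) \<partial>M)"
    by (intro nn_integral_cong) (auto simp: indicator_def)
  also have "\<dots> = ennreal (\<integral>\<omega>. h \<omega> * indicator A \<omega> \<partial>M)"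
    by (rule nn_integral_eq_integral[OF intA]) (use h in auto)
  also have "\<dots> \<le> ennreal ((\<sigma> * (b - a)) ^ card I * (\<integral>\<omega>. h \<omega> \<partial>M))" by (rule ennreal_leI[OF le])
  also have "\<dots> = ennreal ((\<sigma> * (b - a)) ^ card I) * ennreal (\<integral>\<omega>. h \<omega> \<partial>M)"
    using \<sigma> ab h(2) by (intro ennreal_mult integral_nonneg zero_le_power) auto
  also have "ennreal (\<integral>\<omega>. h \<omega> \<partial>M) = (\<integral>\<^sup>+\<omega>. ennreal (h \<omega>) \<partial>M)"
    by (rule nn_integral_eq_integral[OF int, symmetric]) (use h in auto)
  finally show ?thesis unfolding A_eq .
qed

text \<open>Given the tree, the mean distance from \<open>r\<close> to a vertex sampled from
  \<open>p\<close>, arranged by edges.\<close>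

definition total_sep :: "'a \<Rightarrow> ennreal" where
  "total_sep \<omega> = (\<Sum>i. ennreal (sep_mass i \<omega>))"

lemma total_sep_measurable [measurable]: "total_sep \<in> borel_measurable M"
  unfolding total_sep_def[abs_def] by measurable

lemma separations_eq: "separations r u \<omega> = (\<Sum>i. indicator (separating_edges (E \<omega>) r u) (nth_edge i))"
  unfolding separations_def E_def[symmetric] by (rule nn_integral_indicator_edges[OF separating_subset])

lemma separations_measurable [measurable]: "separations r u \<in> borel_measurable M"
proof -
  have "(\<lambda>\<omega>. indicator (separating_edges (E \<omega>) r u) (nth_edge i) :: ennreal) \<in> borel_measurable M" for i
  proof -
    have [measurable]: "Measurable.pred M (\<lambda>\<omega>. nth_edge i \<in> separating_edges (E \<omega>) r u)"
      by (rule F_to_M[OF F_separating_pred])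
    have "(\<lambda>\<omega>. if nth_edge i \<in> separating_edges (E \<omega>) r u then 1 else 0 :: ennreal) \<in> borel_measurable M"
      by measurable
    then show ?thesis by (simp add: indicator_def of_bool_def)
  qed
  then show ?thesis unfolding separations_eq[abs_def] by measurable
qed

lemma total_sep_eq: "total_sep \<omega> = (\<integral>\<^sup>+u. separations r u \<omega> \<partial>measure_pmf p)"
proof -
  have "(\<integral>\<^sup>+u. separations r u \<omega> \<partial>measure_pmf p)
      = (\<Sum>i. \<integral>\<^sup>+u. indicator (separating_edges (E \<omega>) r u) (nth_edge i) \<partial>measure_pmf p)"
    unfolding separations_eq by (rule nn_integral_suminf) simp
  also have "\<dots> = (\<Sum>i. ennreal (sep_mass i \<omega>))"
  proof (rule suminf_cong)
    fix i
    have "(\<integral>\<^sup>+u. indicator (separating_edges (E \<omega>) r u) (nth_edge i) \<partial>measure_pmf p)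
        = (\<integral>\<^sup>+u. indicator {u. nth_edge i \<in> separating_edges (E \<omega>) r u} u \<partial>measure_pmf p)"
      by (intro nn_integral_cong) (simp add: indicator_def)
    then show "(\<integral>\<^sup>+u. indicator (separating_edges (E \<omega>) r u) (nth_edge i) \<partial>measure_pmf p) = ennreal (sep_mass i \<omega>)"
      unfolding sep_mass_def by (simp add: measure_pmf.emeasure_eq_measure)
  qed
  finally show ?thesis unfolding total_sep_def by simp
qed

text \<open>The Cauchy-Schwarz inequality for the sampled vertex bounds the square of the mean
  distance by the mean of the squared distance.\<close>

lemma nn_integral_total_sep_sq: "(\<integral>\<^sup>+\<omega>. (total_sep \<omega>)\<^sup>2 \<partial>M) \<le> ennreal (80 / \<sigma>\<^sup>2)"
proof -
  have "(\<integral>\<^sup>+\<omega>. (total_sep \<omega>)\<^sup>2 \<partial>M) \<le> (\<integral>\<^sup>+\<omega>. \<integral>\<^sup>+u. (separations r u \<omega>)\<^sup>2 \<partial>measure_pmf p \<partial>M)"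
  proof (rule nn_integral_mono)
    fix \<omega>
    have "(\<integral>\<^sup>+u. separations r u \<omega> * 1 \<partial>measure_pmf p)\<^sup>2
        \<le> (\<integral>\<^sup>+u. (separations r u \<omega>)\<^sup>2 \<partial>measure_pmf p) * (\<integral>\<^sup>+u. 1\<^sup>2 \<partial>measure_pmf p)"
      by (rule Cauchy_Schwarz_nn_integral) auto
    then show "(total_sep \<omega>)\<^sup>2 \<le> (\<integral>\<^sup>+u. (separations r u \<omega>)\<^sup>2 \<partial>measure_pmf p)"
      unfolding total_sep_eq by simp
  qed
  also have "\<dots> = (\<integral>\<^sup>+\<omega>. \<integral>\<^sup>+u. ennreal (pmf p u) * (separations r u \<omega>)\<^sup>2 \<partial>count_space UNIV \<partial>M)"
    by (simp add: nn_integral_measure_pmf)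
  also have "\<dots> = (\<integral>\<^sup>+u. \<integral>\<^sup>+\<omega>. ennreal (pmf p u) * (separations r u \<omega>)\<^sup>2 \<partial>M \<partial>count_space UNIV)"
    by (rule nn_integral_count_space_nn_integral) auto
  also have "\<dots> = (\<integral>\<^sup>+u. ennreal (pmf p u) * (\<integral>\<^sup>+\<omega>. (separations r u \<omega>)\<^sup>2 \<partial>M) \<partial>count_space UNIV)"
    by (simp add: nn_integral_cmult)
  also have "\<dots> \<le> (\<integral>\<^sup>+u. ennreal (pmf p u) * ennreal (80 / \<sigma>\<^sup>2) \<partial>count_space UNIV)"
  proof (rule nn_integral_mono)
    fix u
    show "ennreal (pmf p u) * (\<integral>\<^sup>+\<omega>. (separations r u \<omega>)\<^sup>2 \<partial>M) \<le> ennreal (pmf p u) * ennreal (80 / \<sigma>\<^sup>2)"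
    proof (cases "u \<in> set_pmf p")
      case True
      then show ?thesis by (intro mult_left_mono nn_integral_separations_sq r) auto
    next
      case False
      then have "pmf p u = 0" by (simp add: pmf_eq_0_set_pmf)
      then show ?thesis by simp
    qed
  qed
  also have "\<dots> = (\<integral>\<^sup>+u. ennreal (80 / \<sigma>\<^sup>2) \<partial>measure_pmf p)" by (rule nn_integral_measure_pmf[symmetric])
  also have "\<dots> = ennreal (80 / \<sigma>\<^sup>2)" by simp
  finally show ?thesis .
qed

end

lemma (in prob_space) emeasure_ge_le:
  assumes [measurable]: "u \<in> borel_measurable M" and c: "0 < c"
  shows "emeasure M {\<omega> \<in> space M. ennreal c \<le> u \<omega>} \<le> ennreal (1 / c) * (\<integral>\<^sup>+\<omega>. u \<omega> \<partial>M)"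
proof -
  have "emeasure M {\<omega> \<in> space M. ennreal c \<le> u \<omega>} = (\<integral>\<^sup>+\<omega>. indicator {\<omega> \<in> space M. ennreal c \<le> u \<omega>} \<omega> \<partial>M)"
    by (rule nn_integral_indicator[symmetric]) measurable
  also have "\<dots> \<le> (\<integral>\<^sup>+\<omega>. ennreal (1 / c) * u \<omega> \<partial>M)"
  proof (rule nn_integral_mono)
    fix \<omega>
    show "indicator {\<omega> \<in> space M. ennreal c \<le> u \<omega>} \<omega> \<le> ennreal (1 / c) * u \<omega>"
    proof (cases "ennreal c \<le> u \<omega>")
      case True
      have "1 = ennreal (1 / c) * ennreal c" using c by (simp flip: ennreal_mult)
      also have "\<dots> \<le> ennreal (1 / c) * u \<omega>" using True by (rule mult_left_mono) simp
      finally show ?thesis by (auto simp: indicator_def)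
    qed simp
  qed
  also have "\<dots> = ennreal (1 / c) * (\<integral>\<^sup>+\<omega>. u \<omega> \<partial>M)" by (rule nn_integral_cmult) measurable
  finally show ?thesis .
qed

lemma ennreal_le_one_plus_sq: "x \<le> 1 + x\<^sup>2" for x :: ennreal
proof (cases "x \<le> 1")
  case True
  then show ?thesis by (meson add_increasing2 zero_le)
next
  case False
  then have "x * 1 \<le> x * x" by (intro mult_left_mono) auto
  then have "x \<le> x\<^sup>2" by (simp add: power2_eq_square)
  then show ?thesis by (meson add_increasing zero_le)
qed

section \<open>Eroded mass and moves of the fragmentation\<close>

context frag
begin

text \<open>The eroded vertices. The interval is half-open because an edge is absent from its
  deletion time on; consecutive intervals thus share no deletion.\<close>

definition bad :: "real \<Rightarrow> real \<Rightarrow> 'a \<Rightarrow> nat set" where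
  "bad a b \<omega> = {u. \<exists>e\<in>separating_edges (E \<omega>) r u. a < \<tau> \<omega> e \<and> \<tau> \<omega> e \<le> b}"

definition cut :: "real \<Rightarrow> real \<Rightarrow> nat \<Rightarrow> 'a \<Rightarrow> ennreal" where
  "cut a b i \<omega> = ennreal (sep_mass i \<omega>) * (if a < \<tau> \<omega> (nth_edge i) \<and> \<tau> \<omega> (nth_edge i) \<le> b then 1 else 0)"

text \<open>The diagonal is left out: the bound on the deletion probability is quadratic in the
  length of the interval for two distinct edges, but only linear for a single one.\<close>

definition cut_pairs :: "real \<Rightarrow> real \<Rightarrow> 'a \<Rightarrow> ennreal" where
  "cut_pairs a b \<omega> = (\<Sum>i. \<Sum>j. if i = j then 0 else cut a b i \<omega> * cut a b j \<omega>)"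

lemma cut_measurable [measurable]: "cut a b i \<in> borel_measurable M"
  unfolding cut_def[abs_def] by measurable

lemma cut_pairs_measurable [measurable]: "cut_pairs a b \<in> borel_measurable M"
  unfolding cut_pairs_def[abs_def] by measurable

lemma emeasure_bad_le: "emeasure (measure_pmf p) (bad a b \<omega>) \<le> (\<Sum>i. cut a b i \<omega>)"
proof -
  define ob :: "nat \<Rightarrow> ennreal" where "ob i = (if a < \<tau> \<omega> (nth_edge i) \<and> \<tau> \<omega> (nth_edge i) \<le> b then 1 else 0)" for i
  let ?A = "\<lambda>i. {u. nth_edge i \<in> separating_edges (E \<omega>) r u}"
  have "emeasure (measure_pmf p) (bad a b \<omega>) = (\<integral>\<^sup>+u. indicator (bad a b \<omega>) u \<partial>measure_pmf p)" by simp
  also have "\<dots> \<le> (\<integral>\<^sup>+u. (\<Sum>i. indicator (?A i) u * ob i) \<partial>measure_pmf p)"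
  proof (rule nn_integral_mono)
    fix u
    show "indicator (bad a b \<omega>) u \<le> (\<Sum>i. indicator (?A i) u * ob i)"
    proof (cases "u \<in> bad a b \<omega>")
      case True
      then obtain e where e: "e \<in> separating_edges (E \<omega>) r u" "a < \<tau> \<omega> e" "\<tau> \<omega> e \<le> b"
        unfolding bad_def by blast
      then obtain i where i: "e = nth_edge i" using separating_subset nth_edge_ex by blast
      have "(1::ennreal) = (\<Sum>j\<in>{i}. indicator (?A j) u * ob j)" using e unfolding i ob_def by simp
      also have "\<dots> \<le> (\<Sum>i. indicator (?A i) u * ob i)" by (rule sum_le_suminf) auto
      finally show ?thesis using True by simp
    qed simp
  qed
  also have "\<dots> = (\<Sum>i. \<integral>\<^sup>+u. indicator (?A i) u * ob i \<partial>measure_pmf p)"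
    by (rule nn_integral_suminf) simp
  also have "\<dots> = (\<Sum>i. cut a b i \<omega>)"
  proof (rule suminf_cong)
    fix i
    show "(\<integral>\<^sup>+u. indicator (?A i) u * ob i \<partial>measure_pmf p) = cut a b i \<omega>"
      unfolding cut_def ob_def[symmetric] sep_mass_def
      by (simp add: nn_integral_multc measure_pmf.emeasure_eq_measure)
  qed
  finally show ?thesis .
qed

text \<open>The two erosions use disjoint sets of edges, since an edge is cut only once.\<close>

lemma bad_product_le:
  assumes "a \<le> s" "s \<le> b"
  shows "emeasure (measure_pmf p) (bad a s \<omega>) * emeasure (measure_pmf p) (bad s b \<omega>) \<le> cut_pairs a b \<omega>"
proof -
  have "emeasure (measure_pmf p) (bad a s \<omega>) * emeasure (measure_pmf p) (bad s b \<omega>)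
      \<le> (\<Sum>i. cut a s i \<omega>) * (\<Sum>j. cut s b j \<omega>)"
    by (intro mult_mono emeasure_bad_le) auto
  also have "\<dots> = (\<Sum>i. \<Sum>j. cut a s i \<omega> * cut s b j \<omega>)" by simp
  also have "\<dots> \<le> cut_pairs a b \<omega>"
    unfolding cut_pairs_def
  proof (intro suminf_le)
    fix i j
    show "cut a s i \<omega> * cut s b j \<omega> \<le> (if i = j then 0 else cut a b i \<omega> * cut a b j \<omega>)"
      using assms unfolding cut_def by auto
  qed auto
  finally show ?thesis .
qed

lemma nn_integral_cut:
  assumes "a \<le> b"
  shows "(\<integral>\<^sup>+\<omega>. cut a b i \<omega> \<partial>M) \<le> ennreal (\<sigma> * (b - a)) * (\<integral>\<^sup>+\<omega>. ennreal (sep_mass i \<omega>) \<partial>M)"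
proof -
  have "(\<integral>\<^sup>+\<omega>. cut a b i \<omega> \<partial>M) = (\<integral>\<^sup>+\<omega>. ennreal (sep_mass i \<omega>) *
      indicator {\<omega> \<in> space M. \<forall>k\<in>{i}. a < \<tau> \<omega> (nth_edge k) \<and> \<tau> \<omega> (nth_edge k) \<le> b} \<omega> \<partial>M)"
    unfolding cut_def by (intro nn_integral_cong) (auto simp: indicator_def)
  also have "\<dots> \<le> ennreal ((\<sigma> * (b - a)) ^ card {i}) * (\<integral>\<^sup>+\<omega>. ennreal (sep_mass i \<omega>) \<partial>M)"
    by (rule conditional_deletion_bound[OF _ assms sep_mass_F]) (auto simp: sep_mass_nonedge)
  finally show ?thesis by simp
qed

lemma nn_integral_cut_mult:
  assumes "a \<le> b" "i \<noteq> j"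
  shows "(\<integral>\<^sup>+\<omega>. cut a b i \<omega> * cut a b j \<omega> \<partial>M)
    \<le> ennreal ((\<sigma> * (b - a))\<^sup>2) * (\<integral>\<^sup>+\<omega>. ennreal (sep_mass i \<omega>) * ennreal (sep_mass j \<omega>) \<partial>M)"
proof -
  have "(\<integral>\<^sup>+\<omega>. cut a b i \<omega> * cut a b j \<omega> \<partial>M) = (\<integral>\<^sup>+\<omega>. ennreal (sep_mass i \<omega> * sep_mass j \<omega>) *
      indicator {\<omega> \<in> space M. \<forall>k\<in>{i, j}. a < \<tau> \<omega> (nth_edge k) \<and> \<tau> \<omega> (nth_edge k) \<le> b} \<omega> \<partial>M)"
    unfolding cut_def by (intro nn_integral_cong) (auto simp: indicator_def ennreal_mult)
  also have "\<dots> \<le> ennreal ((\<sigma> * (b - a)) ^ card {i, j}) * (\<integral>\<^sup>+\<omega>. ennreal (sep_mass i \<omega> * sep_mass j \<omega>) \<partial>M)"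
  proof (rule conditional_deletion_bound[OF _ assms(1)])
    show "(\<lambda>\<omega>. sep_mass i \<omega> * sep_mass j \<omega>) \<in> borel_measurable F"
      by (intro borel_measurable_times sep_mass_F)
    show "sep_mass i \<omega> * sep_mass j \<omega> \<le> 1" for \<omega> by (intro mult_le_one) auto
    show "sep_mass i \<omega> * sep_mass j \<omega> = 0" if "k \<in> {i, j}" "nth_edge k \<notin> E \<omega>" for \<omega> k
      using that sep_mass_nonedge by auto
  qed auto
  finally show ?thesis using assms(2) by (simp add: ennreal_mult power2_eq_square)
qed

text \<open>Two distinct edges contribute (\<sigma> (b - a))^2 times the product of their masses.
  The full double sum of these products is the square of \<open>total_sep\<close>, whose bound 80 /
  \<sigma>^2 cancels \<sigma>.\<close>

lemma nn_integral_cut_pairs: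
  assumes "a \<le> b"
  shows "(\<integral>\<^sup>+\<omega>. cut_pairs a b \<omega> \<partial>M) \<le> ennreal (80 * (b - a)\<^sup>2)"
proof -
  let ?c = "ennreal ((\<sigma> * (b - a))\<^sup>2)"
  let ?S = "\<lambda>i j. (\<integral>\<^sup>+\<omega>. ennreal (sep_mass i \<omega>) * ennreal (sep_mass j \<omega>) \<partial>M)"
  have "(\<integral>\<^sup>+\<omega>. cut_pairs a b \<omega> \<partial>M) = (\<Sum>i. \<Sum>j. \<integral>\<^sup>+\<omega>. (if i = j then 0 else cut a b i \<omega> * cut a b j \<omega>) \<partial>M)"
    unfolding cut_pairs_def by (simp add: nn_integral_suminf)
  also have "\<dots> \<le> (\<Sum>i. \<Sum>j. ?c * ?S i j)"
  proof (intro suminf_le)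
    fix i j
    show "(\<integral>\<^sup>+\<omega>. (if i = j then 0 else cut a b i \<omega> * cut a b j \<omega>) \<partial>M) \<le> ?c * ?S i j"
      using nn_integral_cut_mult[OF assms, of i j] by (cases "i = j") auto
  qed auto
  also have "\<dots> = ?c * (\<Sum>i. \<Sum>j. ?S i j)" by simp
  also have "(\<Sum>i. \<Sum>j. ?S i j) = (\<integral>\<^sup>+\<omega>. (\<Sum>i. \<Sum>j. ennreal (sep_mass i \<omega>) * ennreal (sep_mass j \<omega>)) \<partial>M)"
  proof -
    have "(\<integral>\<^sup>+\<omega>. (\<Sum>i. \<Sum>j. ennreal (sep_mass i \<omega>) * ennreal (sep_mass j \<omega>)) \<partial>M)
        = (\<Sum>i. \<integral>\<^sup>+\<omega>. (\<Sum>j. ennreal (sep_mass i \<omega>) * ennreal (sep_mass j \<omega>)) \<partial>M)"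
      by (rule nn_integral_suminf) measurable
    also have "\<dots> = (\<Sum>i. \<Sum>j. ?S i j)"
      by (intro suminf_cong nn_integral_suminf) measurable
    finally show ?thesis by simp
  qed
  also have "\<dots> = (\<integral>\<^sup>+\<omega>. (total_sep \<omega>)\<^sup>2 \<partial>M)"
    unfolding total_sep_def power2_eq_square by simp
  also have "?c * \<dots> \<le> ?c * ennreal (80 / \<sigma>\<^sup>2)" by (intro mult_left_mono nn_integral_total_sep_sq) simp
  also have "\<dots> = ennreal ((\<sigma> * (b - a))\<^sup>2 * (80 / \<sigma>\<^sup>2))" by (intro ennreal_mult[symmetric]) auto
  also have "(\<sigma> * (b - a))\<^sup>2 * (80 / \<sigma>\<^sup>2) = 80 * (b - a)\<^sup>2" using \<sigma> by (simp add: power_mult_distrib)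
  finally show ?thesis .
qed

text \<open>A first moment suffices here, and x \<le> 1 + x^2 at \<sigma> times
  \<open>total_sep\<close> derives it from the second; hence 81 = 1 + 80.\<close>

lemma nn_integral_sum_cut:
  assumes "a \<le> b"
  shows "(\<integral>\<^sup>+\<omega>. (\<Sum>i. cut a b i \<omega>) \<partial>M) \<le> ennreal (81 * (b - a))"
proof -
  have "(\<integral>\<^sup>+\<omega>. (\<Sum>i. cut a b i \<omega>) \<partial>M) = (\<Sum>i. \<integral>\<^sup>+\<omega>. cut a b i \<omega> \<partial>M)"
    by (rule nn_integral_suminf) measurable
  also have "\<dots> \<le> (\<Sum>i. ennreal (\<sigma> * (b - a)) * (\<integral>\<^sup>+\<omega>. ennreal (sep_mass i \<omega>) \<partial>M))"
    by (intro suminf_le nn_integral_cut assms) auto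
  also have "\<dots> = ennreal (\<sigma> * (b - a)) * (\<Sum>i. \<integral>\<^sup>+\<omega>. ennreal (sep_mass i \<omega>) \<partial>M)" by simp
  also have "(\<Sum>i. \<integral>\<^sup>+\<omega>. ennreal (sep_mass i \<omega>) \<partial>M) = (\<integral>\<^sup>+\<omega>. total_sep \<omega> \<partial>M)"
    unfolding total_sep_def by (rule nn_integral_suminf[symmetric]) measurable
  also have "ennreal (\<sigma> * (b - a)) * \<dots> = ennreal (b - a) * (\<integral>\<^sup>+\<omega>. ennreal \<sigma> * total_sep \<omega> \<partial>M)"
    using \<sigma> assms by (simp add: nn_integral_cmult ennreal_mult mult_ac)
  also have "\<dots> \<le> ennreal (b - a) * ennreal 81"
  proof (rule mult_left_mono)
    have "(\<integral>\<^sup>+\<omega>. ennreal \<sigma> * total_sep \<omega> \<partial>M) \<le> (\<integral>\<^sup>+\<omega>. 1 + (ennreal \<sigma> * total_sep \<omega>)\<^sup>2 \<partial>M)"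
      by (intro nn_integral_mono ennreal_le_one_plus_sq)
    also have "\<dots> = (\<integral>\<^sup>+\<omega>. 1 + ennreal (\<sigma>\<^sup>2) * (total_sep \<omega>)\<^sup>2 \<partial>M)"
      using \<sigma> by (simp add: power_mult_distrib ennreal_power)
    also have "\<dots> = 1 + ennreal (\<sigma>\<^sup>2) * (\<integral>\<^sup>+\<omega>. (total_sep \<omega>)\<^sup>2 \<partial>M)"
      by (simp add: nn_integral_add nn_integral_cmult emeasure_space_1)
    also have "\<dots> \<le> 1 + ennreal (\<sigma>\<^sup>2) * ennreal (80 / \<sigma>\<^sup>2)"
      by (intro add_left_mono mult_left_mono nn_integral_total_sep_sq) simp
    also have "ennreal (\<sigma>\<^sup>2) * ennreal (80 / \<sigma>\<^sup>2) = ennreal 80"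
      using \<sigma> by (subst ennreal_mult[symmetric]) auto
    also have "1 + ennreal 80 = ennreal 81"
      by (subst ennreal_1[symmetric], subst ennreal_plus[symmetric]) auto
    finally show "(\<integral>\<^sup>+\<omega>. ennreal \<sigma> * total_sep \<omega> \<partial>M) \<le> ennreal 81" .
  qed simp
  also have "\<dots> = ennreal (81 * (b - a))" using assms by (subst ennreal_mult[symmetric]) (auto simp: mult.commute)
  finally show ?thesis .
qed

definition X :: "'a \<Rightarrow> real \<Rightarrow> nat \<Rightarrow> real" where
  "X \<omega> = fragmentation p (E \<omega>) (\<tau> \<omega>)"

text \<open>The eroded set is the exceptional set in \<open>rank_masses_close\<close>; the factor 2
  is the total weight in the metric on sequences.\<close>

lemma dist_X_le:
  assumes "0 \<le> a" "a \<le> b" "measure_pmf.prob p (bad a b \<omega>) \<le> \<eta>"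
  shows "dist (X \<omega> a) (X \<omega> b) \<le> 2 * \<eta>"
proof -
  let ?R = "\<lambda>t. connected_rel p {e \<in> E \<omega>. t < \<tau> \<omega> e}"
  have "dist (rank_masses p (?R a)) (rank_masses p (?R b)) \<le> 2 * \<eta>"
  proof (intro dist_seq_le rank_masses_close[OF _ _ _ _ assms(3)] equiv_connected_rel)
    show "?R b \<subseteq> ?R a" using assms by (intro connected_rel_mono) auto
    fix u v assume uv: "(u, v) \<in> ?R a" "u \<notin> bad a b \<omega>" "v \<notin> bad a b \<omega>"
    have "(u, v) \<in> (edge_rel {e \<in> E \<omega>. b < \<tau> \<omega> e})\<^sup>*"
    proof (rule connected_unless_separated[OF E_def])
      show "(u, v) \<in> (edge_rel {e \<in> E \<omega>. a < \<tau> \<omega> e})\<^sup>*" using uv(1) unfolding connected_rel_def by simp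
    qed (use uv(2,3) in \<open>auto simp: bad_def not_le[symmetric]\<close>)
    then show "(u, v) \<in> ?R b" using uv(1) unfolding connected_rel_def by simp
  qed
  then show ?thesis using assms(1,2) unfolding X_def fragmentation_eq by simp
qed

lemma X_cadlag: "X \<omega> \<in> cadlag S_down_le1"
  unfolding X_def by (rule fragmentation_cadlag)

lemma X_measurable:
  assumes "0 \<le> t"
  shows "(\<lambda>\<omega>. X \<omega> t) \<in> borel_measurable M"
proof -
  have edge: "Measurable.pred M (\<lambda>\<omega>. e \<in> {e \<in> E \<omega>. t < \<tau> \<omega> e})" for e
  proof (cases "card e = 2")
    case True
    then obtain i where i: "e = nth_edge i" using nth_edge_ex by blast
    have [measurable]: "Measurable.pred M (\<lambda>\<omega>. nth_edge i \<in> E \<omega>)" by (rule edge_pred)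
    have "Measurable.pred M (\<lambda>\<omega>. nth_edge i \<in> E \<omega> \<and> t < \<tau> \<omega> (nth_edge i))" by measurable
    then show ?thesis unfolding i by simp
  next
    case False
    then have "(\<lambda>\<omega>. e \<in> {e \<in> E \<omega>. t < \<tau> \<omega> e}) = (\<lambda>\<omega>. False)" using E_card by blast
    then show ?thesis by (simp only: measurable_const UNIV_I space_count_space)
  qed
  have "(\<lambda>\<omega>. rank_masses p (connected_rel p {e \<in> E \<omega>. t < \<tau> \<omega> e})) \<in> borel_measurable M"
  proof (rule rank_masses_measurable[OF equiv_connected_rel])
    fix u v
    have "Measurable.pred M (\<lambda>\<omega>. u \<in> set_pmf p \<and> v \<in> set_pmf p \<and> (u, v) \<in> (edge_rel {e \<in> E \<omega>. t < \<tau> \<omega> e})\<^sup>*)"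
      by (intro pred_intros_conj1' connected_measurable edge)
    then show "Measurable.pred M (\<lambda>\<omega>. (u, v) \<in> connected_rel p {e \<in> E \<omega>. t < \<tau> \<omega> e})"
      unfolding connected_rel_def by simp
  qed
  then show ?thesis using assms unfolding X_def fragmentation_eq by simp
qed

lemma jump_modulus_X_measurable: "Measurable.pred M (\<lambda>\<omega>. jump_modulus \<delta> (X \<omega>))"
proof (rule jump_modulus_measurable)
  show "(X \<omega> \<longlongrightarrow> X \<omega> t) (at_right t)" if "0 \<le> t" for \<omega> t
    using X_cadlag[of \<omega>] that unfolding cadlag_def by simp
qed (rule X_measurable)

text \<open>The blocks have length 2 \<delta> and start at the multiples of \<delta>, so that any
  three times in [0, j) within a span below \<delta> fit into one of them. The last set controls the
  moves shortly after time 0.\<close>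

definition failure :: "nat \<Rightarrow> real \<Rightarrow> real \<Rightarrow> 'a set" where
  "failure j \<delta> \<eta> = (\<Union>k\<in>{..nat \<lceil>real j / \<delta>\<rceil>}.
      {\<omega> \<in> space M. ennreal (\<eta>\<^sup>2) \<le> cut_pairs (real k * \<delta>) (real k * \<delta> + 2 * \<delta>) \<omega>}) \<union>
    {\<omega> \<in> space M. ennreal \<eta> \<le> (\<Sum>i. cut 0 \<delta> i \<omega>)}"

lemma failure_measurable [measurable]: "failure j \<delta> \<eta> \<in> sets M"
  unfolding failure_def by measurable

lemma bad_mono: "a \<le> a' \<Longrightarrow> b' \<le> b \<Longrightarrow> bad a' b' \<omega> \<subseteq> bad a b \<omega>"
proof (rule subsetI)
  fix u assume "a \<le> a'" "b' \<le> b" "u \<in> bad a' b' \<omega>"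
  then obtain e where "e \<in> separating_edges (E \<omega>) r u" "a < \<tau> \<omega> e" "\<tau> \<omega> e \<le> b"
    unfolding bad_def by force
  then show "u \<in> bad a b \<omega>" unfolding bad_def by blast
qed

lemma not_failure_start:
  assumes \<omega>: "\<omega> \<in> space M" "\<omega> \<notin> failure j \<delta> \<eta>" and s: "0 \<le> s" "s < \<delta>" and \<eta>: "0 < \<eta>"
  shows "dist (X \<omega> 0) (X \<omega> s) \<le> 2 * \<eta>"
proof (rule dist_X_le[OF _ s(1)])
  have "(\<Sum>i. cut 0 \<delta> i \<omega>) < ennreal \<eta>" using \<omega> unfolding failure_def by (auto simp: not_le)
  then have "emeasure (measure_pmf p) (bad 0 \<delta> \<omega>) \<le> ennreal \<eta>"
    using emeasure_bad_le[of 0 \<delta> \<omega>] by (meson less_imp_le order_trans)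
  then have "measure_pmf.prob p (bad 0 \<delta> \<omega>) \<le> \<eta>"
    using \<eta> by (simp add: measure_pmf.emeasure_eq_measure)
  moreover have "measure_pmf.prob p (bad 0 s \<omega>) \<le> measure_pmf.prob p (bad 0 \<delta> \<omega>)"
    using s by (intro measure_pmf.finite_measure_mono bad_mono) auto
  ultimately show "measure_pmf.prob p (bad 0 s \<omega>) \<le> \<eta>" by linarith
qed simp

text \<open>A product of eroded masses below \<eta>^2 leaves one of them at most \<eta>. The block
  depends on the earliest time only, and its bound holds for every middle time s, so one event
  serves all triples in the block.\<close>

lemma not_failure_triple:
  assumes \<omega>: "\<omega> \<in> space M" "\<omega> \<notin> failure j \<delta> \<eta>" and t: "0 \<le> x" "x < s" "s < t" "t < real j" "t - x < \<delta>"
    and \<eta>: "0 < \<eta>" and \<delta>: "0 < \<delta>"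
  shows "dist (X \<omega> x) (X \<omega> s) \<le> 2 * \<eta> \<or> dist (X \<omega> s) (X \<omega> t) \<le> 2 * \<eta>"
proof -
  define k where "k = nat \<lfloor>x / \<delta>\<rfloor>"
  have k: "real k \<le> x / \<delta>" "x / \<delta> < real k + 1"
    using t(1) \<delta> unfolding k_def by (simp_all add: of_nat_nat)
  have kx: "real k * \<delta> \<le> x" "x < real k * \<delta> + \<delta>"
    using k \<delta> by (simp_all add: field_simps)
  have "x / \<delta> \<le> real j / \<delta>" using t \<delta> by (intro divide_right_mono) auto
  then have "real k \<le> real j / \<delta>" using k(1) by linarith
  then have kj: "k \<le> nat \<lceil>real j / \<delta>\<rceil>" by linarith
  let ?a = "real k * \<delta>" and ?b = "real k * \<delta> + 2 * \<delta>"
  have less: "cut_pairs ?a ?b \<omega> < ennreal (\<eta>\<^sup>2)"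
    using \<omega> kj unfolding failure_def by (auto simp: not_le)
  have "ennreal (measure_pmf.prob p (bad ?a s \<omega>) * measure_pmf.prob p (bad s ?b \<omega>)) \<le> cut_pairs ?a ?b \<omega>"
    using bad_product_le[of ?a s ?b \<omega>] kx t by (simp add: measure_pmf.emeasure_eq_measure ennreal_mult)
  then have "ennreal (measure_pmf.prob p (bad ?a s \<omega>) * measure_pmf.prob p (bad s ?b \<omega>)) < ennreal (\<eta>\<^sup>2)"
    using less by (rule le_less_trans)
  then have prod: "measure_pmf.prob p (bad ?a s \<omega>) * measure_pmf.prob p (bad s ?b \<omega>) < \<eta> * \<eta>"
    by (simp add: ennreal_less_iff power2_eq_square)
  have mono: "measure_pmf.prob p (bad x s \<omega>) \<le> measure_pmf.prob p (bad ?a s \<omega>)"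
    "measure_pmf.prob p (bad s t \<omega>) \<le> measure_pmf.prob p (bad s ?b \<omega>)"
    using kx t by (intro measure_pmf.finite_measure_mono bad_mono; simp)+
  have "measure_pmf.prob p (bad ?a s \<omega>) \<le> \<eta> \<or> measure_pmf.prob p (bad s ?b \<omega>) \<le> \<eta>"
  proof (rule ccontr)
    assume "\<not> ?thesis"
    then have "\<eta> * \<eta> \<le> measure_pmf.prob p (bad ?a s \<omega>) * measure_pmf.prob p (bad s ?b \<omega>)"
      using \<eta> by (intro mult_mono) auto
    then show False using prod by simp
  qed
  then show ?thesis
  proof
    assume "measure_pmf.prob p (bad ?a s \<omega>) \<le> \<eta>"
    then have "dist (X \<omega> x) (X \<omega> s) \<le> 2 * \<eta>" using mono t by (intro dist_X_le) auto
    then show ?thesis ..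
  next
    assume "measure_pmf.prob p (bad s ?b \<omega>) \<le> \<eta>"
    then have "dist (X \<omega> s) (X \<omega> t) \<le> 2 * \<eta>" using mono t by (intro dist_X_le) auto
    then show ?thesis ..
  qed
qed

text \<open>Each block fails with probability of order \<delta>^2, with 320 = 80 * 2^2 from its
  length 2 \<delta>, and there are at most j / \<delta> + 2 blocks; the total is linear in
  \<delta>.\<close>

lemma emeasure_failure_le:
  assumes \<delta>: "0 < \<delta>" "\<delta> \<le> 1" and \<eta>: "0 < \<eta>"
  shows "emeasure M (failure j \<delta> \<eta>) \<le> ennreal (\<delta> * ((real j + 2) * 320 / \<eta>\<^sup>2 + 81 / \<eta>))"
proof -
  let ?N = "nat \<lceil>real j / \<delta>\<rceil>"
  let ?A = "\<lambda>k. {\<omega> \<in> space M. ennreal (\<eta>\<^sup>2) \<le> cut_pairs (real k * \<delta>) (real k * \<delta> + 2 * \<delta>) \<omega>}"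
  let ?B = "{\<omega> \<in> space M. ennreal \<eta> \<le> (\<Sum>i. cut 0 \<delta> i \<omega>)}"
  have A: "emeasure M (?A k) \<le> ennreal (320 * \<delta>\<^sup>2 / \<eta>\<^sup>2)" for k
  proof -
    have "emeasure M (?A k) \<le> ennreal (1 / \<eta>\<^sup>2) * (\<integral>\<^sup>+\<omega>. cut_pairs (real k * \<delta>) (real k * \<delta> + 2 * \<delta>) \<omega> \<partial>M)"
      using \<eta> by (intro emeasure_ge_le) auto
    also have "\<dots> \<le> ennreal (1 / \<eta>\<^sup>2) * ennreal (80 * (real k * \<delta> + 2 * \<delta> - real k * \<delta>)\<^sup>2)"
      using \<delta> by (intro mult_left_mono nn_integral_cut_pairs) auto
    also have "\<dots> = ennreal (320 * \<delta>\<^sup>2 / \<eta>\<^sup>2)"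
      by (subst ennreal_mult[symmetric]) (auto simp: power_mult_distrib)
    finally show ?thesis .
  qed
  have "emeasure M (\<Union>k\<in>{..?N}. ?A k) \<le> (\<Sum>k\<in>{..?N}. emeasure M (?A k))"
    by (rule emeasure_subadditive_finite) auto
  also have "\<dots> \<le> (\<Sum>k\<in>{..?N}. ennreal (320 * \<delta>\<^sup>2 / \<eta>\<^sup>2))" by (intro sum_mono A)
  also have "\<dots> = ennreal (real (Suc ?N) * (320 * \<delta>\<^sup>2 / \<eta>\<^sup>2))"
    by (simp only: sum_constant card_atMost ennreal_of_nat_eq_real_of_nat) (rule ennreal_mult[symmetric]; simp)
  finally have 1: "emeasure M (\<Union>k\<in>{..?N}. ?A k) \<le> ennreal (real (Suc ?N) * (320 * \<delta>\<^sup>2 / \<eta>\<^sup>2))" .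
  have "emeasure M ?B \<le> ennreal (1 / \<eta>) * (\<integral>\<^sup>+\<omega>. (\<Sum>i. cut 0 \<delta> i \<omega>) \<partial>M)"
    using \<eta> by (intro emeasure_ge_le) auto
  also have "\<dots> \<le> ennreal (1 / \<eta>) * ennreal (81 * (\<delta> - 0))"
    using \<delta> by (intro mult_left_mono nn_integral_sum_cut) auto
  also have "\<dots> = ennreal (81 * \<delta> / \<eta>)" using \<delta> \<eta> by (subst ennreal_mult[symmetric]) auto
  finally have 2: "emeasure M ?B \<le> ennreal (81 * \<delta> / \<eta>)" .
  have "emeasure M (failure j \<delta> \<eta>) \<le> emeasure M (\<Union>k\<in>{..?N}. ?A k) + emeasure M ?B"
    unfolding failure_def by (rule emeasure_subadditive) measurable
  also have "\<dots> \<le> ennreal (real (Suc ?N) * (320 * \<delta>\<^sup>2 / \<eta>\<^sup>2)) + ennreal (81 * \<delta> / \<eta>)"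
    by (intro add_mono 1 2)
  also have "\<dots> = ennreal (real (Suc ?N) * (320 * \<delta>\<^sup>2 / \<eta>\<^sup>2) + 81 * \<delta> / \<eta>)"
  proof (rule ennreal_plus[symmetric])
    show "0 \<le> real (Suc ?N) * (320 * \<delta>\<^sup>2 / \<eta>\<^sup>2)" by (rule mult_nonneg_nonneg) simp_all
  qed (use \<delta> \<eta> in simp)
  also have "\<dots> \<le> ennreal (\<delta> * ((real j + 2) * 320 / \<eta>\<^sup>2 + 81 / \<eta>))"
  proof (rule ennreal_leI)
    have "0 \<le> real j / \<delta>" using \<delta> by simp
    then have "real (Suc ?N) \<le> real j / \<delta> + 2" by linarith
    then have "real (Suc ?N) * (320 * \<delta>\<^sup>2 / \<eta>\<^sup>2) \<le> (real j / \<delta> + 2) * (320 * \<delta>\<^sup>2 / \<eta>\<^sup>2)"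
      by (rule mult_right_mono) auto
    also have "\<dots> = \<delta> * ((real j + 2 * \<delta>) * 320 / \<eta>\<^sup>2)"
      using \<delta> \<eta> by (simp add: field_simps power2_eq_square)
    also have "\<dots> \<le> \<delta> * ((real j + 2) * 320 / \<eta>\<^sup>2)"
      using \<delta> by (intro mult_left_mono divide_right_mono mult_right_mono) auto
    finally have le: "real (Suc ?N) * (320 * \<delta>\<^sup>2 / \<eta>\<^sup>2) \<le> \<delta> * ((real j + 2) * 320 / \<eta>\<^sup>2)" .
    have "81 * \<delta> / \<eta> = \<delta> * (81 / \<eta>)" by simp
    then show "real (Suc ?N) * (320 * \<delta>\<^sup>2 / \<eta>\<^sup>2) + 81 * \<delta> / \<eta> \<le> \<delta> * ((real j + 2) * 320 / \<eta>\<^sup>2 + 81 / \<eta>)"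
      unfolding distrib_left using le by (simp only: add_right_mono)
  qed
  finally show ?thesis .
qed

text \<open>A union bound over j, in which the j-th clause of the modulus may fail with probability
  \<epsilon> / 2^(j + 1). The eroded mass is held to half the tolerance, because a move can be twice
  as large.\<close>

lemma jump_modulus_X_prob:
  assumes \<delta>: "\<And>j. 0 < \<delta> j" "\<And>j. \<delta> j \<le> 1" and \<epsilon>: "0 < \<epsilon>"
    and small: "\<And>j. \<delta> j * ((real j + 2) * 320 / (1 / (2 * real (Suc j)))\<^sup>2 + 81 / (1 / (2 * real (Suc j)))) \<le> \<epsilon> * (1 / 2) ^ Suc j"
  shows "1 - \<epsilon> \<le> prob {\<omega> \<in> space M. jump_modulus \<delta> (X \<omega>)}"
proof -
  define \<eta> where "\<eta> j = 1 / (2 * real (Suc j))" for j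
  have \<eta>: "0 < \<eta> j" for j unfolding \<eta>_def by simp
  have \<eta>2: "2 * \<eta> j = 1 / real (Suc j)" for j unfolding \<eta>_def by (simp add: field_simps)
  let ?G = "{\<omega> \<in> space M. jump_modulus \<delta> (X \<omega>)}"
  have G [measurable]: "?G \<in> sets M" using jump_modulus_X_measurable[of \<delta>] unfolding pred_def .
  have "space M - ?G \<subseteq> (\<Union>j. failure j (\<delta> j) (\<eta> j))"
  proof (rule subsetI, rule ccontr)
    fix \<omega> assume \<omega>: "\<omega> \<in> space M - ?G" and n: "\<omega> \<notin> (\<Union>j. failure j (\<delta> j) (\<eta> j))"
    then have nf: "\<omega> \<in> space M" "\<omega> \<notin> failure j (\<delta> j) (\<eta> j)" for j by auto
    have "jump_modulus \<delta> (X \<omega>)"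
      unfolding jump_modulus_def \<eta>2[symmetric]
    proof (intro allI conjI impI)
      fix j and x s t :: real
      assume "0 \<le> x \<and> x < s \<and> s < t \<and> t < real j \<and> t - x < \<delta> j"
      then show "dist (X \<omega> x) (X \<omega> s) \<le> 2 * \<eta> j \<or> dist (X \<omega> s) (X \<omega> t) \<le> 2 * \<eta> j"
        by (intro not_failure_triple[OF nf _ _ _ _ _ \<eta> \<delta>(1)]) auto
    next
      fix j and s :: real assume "0 \<le> s \<and> s < \<delta> j"
      then show "dist (X \<omega> 0) (X \<omega> s) \<le> 2 * \<eta> j"
        by (intro not_failure_start[OF nf _ _ \<eta>]) auto
    qed
    then show False using \<omega> by simp
  qed
  then have "emeasure M (space M - ?G) \<le> emeasure M (\<Union>j. failure j (\<delta> j) (\<eta> j))"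
    by (rule emeasure_mono) measurable
  also have "\<dots> \<le> (\<Sum>j. emeasure M (failure j (\<delta> j) (\<eta> j)))"
    by (rule emeasure_subadditive_countably) auto
  also have "\<dots> \<le> (\<Sum>j. ennreal (\<epsilon> * (1 / 2) ^ Suc j))"
  proof (intro suminf_le)
    fix j
    have "emeasure M (failure j (\<delta> j) (\<eta> j)) \<le> ennreal (\<delta> j * ((real j + 2) * 320 / (\<eta> j)\<^sup>2 + 81 / \<eta> j))"
      by (rule emeasure_failure_le[OF \<delta> \<eta>])
    also have "\<dots> \<le> ennreal (\<epsilon> * (1 / 2) ^ Suc j)" unfolding \<eta>_def by (rule ennreal_leI[OF small])
    finally show "emeasure M (failure j (\<delta> j) (\<eta> j)) \<le> ennreal (\<epsilon> * (1 / 2) ^ Suc j)" .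
  qed auto
  also have "\<dots> = ennreal \<epsilon>"
  proof -
    have s: "(\<lambda>j. \<epsilon> * (1 / 2) ^ Suc j) sums (\<epsilon> * 1)" by (intro sums_mult power_half_series)
    have "(\<Sum>j. ennreal (\<epsilon> * (1 / 2) ^ Suc j)) = ennreal (\<Sum>j. \<epsilon> * (1 / 2) ^ Suc j)"
      using \<epsilon> by (intro suminf_ennreal2 sums_summable[OF s]) auto
    then show ?thesis using sums_unique[OF s] by simp
  qed
  finally have "prob (space M - ?G) \<le> \<epsilon>" using \<epsilon> by (simp add: emeasure_eq_measure)
  then show ?thesis using prob_compl[OF G] by linarith
qed

end

section \<open>Tightness\<close>

text \<open>The condition on the infinite sum is rewritten through partial sums, which are
  continuous for the product topology, whereas the full sum is not.\<close>

lemma compact_S_down_le1: "compact S_down_le1"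
proof -
  let ?A = "\<lambda>i::nat. {0..1::real}"
  have eq: "S_down_le1 = Pi\<^sub>E UNIV ?A \<inter> ({x. \<forall>i. x (Suc i) \<le> x i} \<inter> {x. \<forall>n. (\<Sum>i<n. x i) \<le> 1})"
  proof (intro equalityI subsetI)
    fix x assume x: "x \<in> S_down_le1"
    then have s: "decseq x" "\<And>i. 0 \<le> x i" "summable x" "suminf x \<le> 1" unfolding S_down_le1_def by auto
    have n: "(\<Sum>i<n. x i) \<le> 1" for n using sum_le_suminf[OF s(3), of "{..<n}"] s(2,4) by simp
    have "x i \<le> (\<Sum>i<Suc i. x i)" for i using sum_nonneg[of "{..<i}" x] s(2) by simp
    then have "x i \<le> 1" for i using n[of "Suc i"] order_trans by blast
    then show "x \<in> Pi\<^sub>E UNIV ?A \<inter> ({x. \<forall>i. x (Suc i) \<le> x i} \<inter> {x. \<forall>n. (\<Sum>i<n. x i) \<le> 1})"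
      using s(1,2) n by (auto simp: decseq_Suc_iff)
  next
    fix x assume x: "x \<in> Pi\<^sub>E UNIV ?A \<inter> ({x. \<forall>i. x (Suc i) \<le> x i} \<inter> {x. \<forall>n. (\<Sum>i<n. x i) \<le> 1})"
    then have s: "decseq x" "\<And>i. 0 \<le> x i" "\<And>n. (\<Sum>i<n. x i) \<le> 1" by (auto simp: decseq_Suc_iff PiE_def Pi_def)
    have "summable x" using s(2,3) by (intro summableI_nonneg_bounded)
    moreover have "suminf x \<le> 1" by (intro suminf_le_const \<open>summable x\<close> s(3))
    ultimately show "x \<in> S_down_le1" unfolding S_down_le1_def using s by simp
  qed
  have "closed {x :: nat \<Rightarrow> real. \<forall>i. x (Suc i) \<le> x i}"
    by (intro closed_Collect_all closed_Collect_le continuous_on_product_coordinates)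
  moreover have "closed {x :: nat \<Rightarrow> real. \<forall>n. (\<Sum>i<n. x i) \<le> 1}"
    by (intro closed_Collect_all closed_Collect_le continuous_on_sum continuous_on_product_coordinates continuous_on_const)
  moreover have "compact (Pi\<^sub>E UNIV ?A)" by (rule compact_PiE_UNIV) simp
  ultimately show ?thesis unfolding eq by (intro compact_Int_closed closed_Int)
qed

text \<open>The label 0 has no mass, so the index shift in \<open>sigma_of\<close> loses nothing;
  some vertex has positive mass, so \<sigma> > 0.\<close>

lemma pmf_sigma_sigma_of:
  assumes "ranked_distribution p"
  shows "pmf_sigma p (sigma_of p)"
proof -
  define f where "f i = (pmf p i)\<^sup>2" for i
  have f0: "f 0 = 0" using assms unfolding f_def ranked_distribution_def by simp
  have nn: "0 \<le> f i" for i unfolding f_def by simp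
  have int: "integrable (measure_pmf p) (pmf p)"
    by (intro measure_pmf.integrable_const_bound[where B = 1]) (auto simp: pmf_le_1)
  have "ennreal (measure_pmf.expectation p (pmf p)) = (\<integral>\<^sup>+v. ennreal (pmf p v) \<partial>measure_pmf p)"
    by (rule nn_integral_eq_integral[OF int, symmetric]) simp
  also have "\<dots> = (\<integral>\<^sup>+v. ennreal (f v) \<partial>count_space UNIV)"
    unfolding f_def power2_eq_square by (simp add: nn_integral_measure_pmf ennreal_mult)
  also have "\<dots> = (\<Sum>v. ennreal (f v))" by (rule nn_integral_count_space_nat)
  finally have eq: "(\<Sum>v. ennreal (f v)) = ennreal (measure_pmf.expectation p (pmf p))" by simp
  have sf: "summable f" by (rule summable_suminf_not_top[OF nn]) (simp add: eq)
  have "ennreal (suminf f) = ennreal (measure_pmf.expectation p (pmf p))"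
    using suminf_ennreal2[OF nn sf] eq by simp
  then have E: "measure_pmf.expectation p (pmf p) = suminf f"
    using suminf_nonneg[OF sf nn] by (simp add: integral_nonneg)
  have shift: "suminf f = (\<Sum>i. f (Suc i))" using suminf_split_head[OF sf] f0 by simp
  obtain v where "v \<in> set_pmf p" using set_pmf_not_empty by fast
  then have "0 < f v" unfolding f_def by (simp add: set_pmf_iff)
  then have pos: "0 < suminf f" by (rule suminf_pos2[OF sf nn])
  have "sigma_of p = sqrt (suminf f)" unfolding sigma_of_def shift f_def ..
  then show ?thesis using pos E by unfold_locales simp_all
qed

theorem corollary10p1:
  fixes p :: "nat \<Rightarrow> nat pmf"
    and M :: "nat \<Rightarrow> 'a measure"
    and Y :: "nat \<Rightarrow> nat \<Rightarrow> 'a \<Rightarrow> nat"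
    and U :: "nat \<Rightarrow> nat set \<Rightarrow> 'a \<Rightarrow> real"
    and E :: "nat \<Rightarrow> 'a \<Rightarrow> nat set set"
    and Yhat :: "nat \<Rightarrow> 'a \<Rightarrow> real \<Rightarrow> nat \<Rightarrow> real"
  assumes ranked: "\<And>n. n \<ge> 1 \<Longrightarrow> ranked_distribution (p n)"
    and prob: "\<And>n. n \<ge> 1 \<Longrightarrow> prob_space (M n)"
    and indep: "\<And>n. n \<ge> 1 \<Longrightarrow> prob_space.indep_vars (M n) (\<lambda>_. count_space UNIV) (Y n) UNIV"
    and distr_Y: "\<And>n j. n \<ge> 1 \<Longrightarrow> distr (M n) (count_space UNIV) (Y n j) = measure_pmf (p n)"
    and tree: "\<And>n \<omega>. E n \<omega> = birthday_edges (\<lambda>j. Y n j \<omega>)"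
    and cond_U: "\<And>n. n \<ge> 1 \<Longrightarrow> cond_iid_uniform (M n) (E n) (U n)"
    and Yhat: "\<And>n \<omega>. Yhat n \<omega> = fragmentation (p n) (E n \<omega>) (\<lambda>e. (1 - U n e \<omega>) / sigma_of (p n))"
    and sigma_lim: "(\<lambda>n. sigma_of (p n)) \<longlonglongrightarrow> 0"
  shows "tight_family (skorohod_J1 S_down_le1) {1..} M Yhat"
  unfolding tight_family_def
proof (intro allI impI)
  fix \<epsilon> :: real assume \<epsilon>: "0 < \<epsilon>"
  \<comment> \<open>\<open>C j\<close> is the factor of \<delta> in
    \<open>emeasure_failure_le\<close> at half the tolerance of the j-th clause.\<close>
  define C where "C j = (real j + 2) * 320 / (1 / (2 * real (Suc j)))\<^sup>2 + 81 / (1 / (2 * real (Suc j)))" for j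
  have C: "0 < C j" for j unfolding C_def by (intro add_nonneg_pos) auto
  \<comment> \<open>Chosen without reference to n, as one compact set has to serve the whole
    family.\<close>
  define \<delta> where "\<delta> j = min 1 (\<epsilon> * (1 / 2) ^ Suc j / C j)" for j
  have \<delta>: "0 < \<delta> j" "\<delta> j \<le> 1" for j using \<epsilon> C unfolding \<delta>_def by auto
  have small: "\<delta> j * C j \<le> \<epsilon> * (1 / 2) ^ Suc j" for j
  proof -
    have "\<delta> j \<le> \<epsilon> * (1 / 2) ^ Suc j / C j" unfolding \<delta>_def by simp
    then show ?thesis using C[of j] by (simp only: pos_le_divide_eq)
  qed
  let ?K = "{x \<in> cadlag S_down_le1. jump_modulus \<delta> x}"
  have "compactin (skorohod_J1 S_down_le1) ?K"
    by (rule compactin_jump_modulus[OF compact_S_down_le1 \<delta>(1)])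
  moreover have "1 - \<epsilon> \<le> measure (M n) {\<omega> \<in> space (M n). Yhat n \<omega> \<in> ?K}" if "n \<in> {1..}" for n
  proof -
    have n: "n \<ge> 1" using that by simp
    \<comment> \<open>An arbitrary vertex serves as the point from which separations are
      counted.\<close>
    obtain r where r: "r \<in> set_pmf (p n)" using set_pmf_not_empty by fast
    interpret prob_space "M n" by (rule prob[OF n])
    interpret pmf_sigma "p n" "sigma_of (p n)" by (rule pmf_sigma_sigma_of[OF ranked[OF n]])
    have E_eq: "E n = (\<lambda>\<omega>. birthday_edges (\<lambda>j. Y n j \<omega>))" using tree by blast
    interpret frag "M n" "p n" "Y n" "sigma_of (p n)" "U n" r
      by unfold_locales (use indep[OF n] distr_Y[OF n] cond_U[OF n, unfolded E_eq] r in auto)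
    have X_eq: "X \<omega> = Yhat n \<omega>" for \<omega>
      unfolding X_def Yhat tree local.E_def \<tau>_def ..
    have "1 - \<epsilon> \<le> measure (M n) {\<omega> \<in> space (M n). jump_modulus \<delta> (X \<omega>)}"
      by (rule jump_modulus_X_prob[OF \<delta> \<epsilon> small[unfolded C_def]])
    also have "{\<omega> \<in> space (M n). jump_modulus \<delta> (X \<omega>)} = {\<omega> \<in> space (M n). Yhat n \<omega> \<in> ?K}"
      using X_cadlag unfolding X_eq by auto
    finally show ?thesis .
  qed
  ultimately show "\<exists>K. compactin (skorohod_J1 S_down_le1) K \<and>
      (\<forall>n\<in>{1..}. 1 - \<epsilon> \<le> measure (M n) {\<omega> \<in> space (M n). Yhat n \<omega> \<in> K})" by blast
qed

end
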